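(* Let $\chi$ be a primitive Dirichlet character modulo $q>1$ and let $\kappa\in\{0,1\}$ be determined by $\chi(-1)=(-1)^{\kappa}$. Then for each integer $j\geq 1$: (1) there is a unique zero of $L'(s,\chi)$ in the strip $\{\sigma+it:-2j-\kappa-1<\sigma<-2j-\kappa+1,~t\in\mathbb{R}\}$; (2) $L'(s,\chi)\neq 0$ on the line $\operatorname{Re}(s)=-2j-\kappa+1$.
   Context: $L(s,\chi)$ is the Dirichlet $L$-function of $\chi$ and $L'(s,\chi)$ its derivative with respect to $s$. *)

theory Defs
  imports "HOL-Complex_Analysis.Complex_Analysis"
begin

definition dirichlet_character :: "nat \<Rightarrow> (int \<Rightarrow> complex) \<Rightarrow> bool" where
  "dirichlet_character q chi \<longleftrightarrow>
     q > 0 \<and>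
     (\<forall>a b. chi (a * b) = chi a * chi b) \<and>
     (\<forall>a. chi (a + int q) = chi a) \<and>
     (\<forall>a. chi a \<noteq> 0 \<longleftrightarrow> coprime a (int q))"

definition principal_character :: "nat \<Rightarrow> (int \<Rightarrow> complex) \<Rightarrow> bool" where
  "principal_character q chi \<longleftrightarrow>
     dirichlet_character q chi \<and> (\<forall>a. coprime a (int q) \<longrightarrow> chi a = 1)"

definition primitive_character :: "nat \<Rightarrow> (int \<Rightarrow> complex) \<Rightarrow> bool" where
  "primitive_character q chi \<longleftrightarrow>
     dirichlet_character q chi \<and>
     \<not> (\<exists>d \<psi>. d dvd q \<and> d < q \<and> dirichlet_character d \<psi> \<and>
            (\<forall>a. coprime a (int q) \<longrightarrow> chi a = \<psi> a))"

text \<open>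
  The Dirichlet \<open>L\<close>-function of a character modulo \<open>q\<close> is the analytic continuation of its
  Dirichlet series from the half-plane \<open>Re s > 1\<close>: to the whole plane if the character is
  non-principal, and to the plane without the pole at 1 if it is principal, where the value
  at 1 is set to 0 by convention. The continuation is unique by the identity theorem.
\<close>

definition dirichlet_L :: "nat \<Rightarrow> (int \<Rightarrow> complex) \<Rightarrow> complex \<Rightarrow> complex" where
  "dirichlet_L q chi = (THE f.
     f holomorphic_on (if principal_character q chi then UNIV - {1} else UNIV) \<and>
     (principal_character q chi \<longrightarrow> f 1 = 0) \<and>
     (\<forall>s. Re s > 1 \<longrightarrow> (\<lambda>n. chi (int (Suc n)) / of_nat (Suc n) powr s) sums f s))"

end

theory Submission
  imports Defs "HOL-Number_Theory.Number_Theory"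
begin

text \<open>
  For \<open>Re s \<le> -1\<close> the functional equation expresses \<open>-L'/L(s, \<chi>)\<close> as
  \<open>ln (q / 2\<pi>) + \<psi>(1 - s) + L'/L(1 - s, cnj \<chi>) - (\<pi>/2) cot (\<pi>(s + \<kappa>)/2)\<close>. On the lines
  \<open>Re s = -2j - \<kappa> \<plusminus> 1\<close> the cotangent is purely imaginary, and the other terms have positive real part:
  the digamma function and the logarithm beat the Dirichlet series of \<open>L'/L\<close>. High up in the strip this holds as
  well, because \<open>Re \<psi>\<close> tends to infinity. So \<open>-L'/L\<close> has positive real part on the boundary of
  every sufficiently tall rectangle in the strip, and by Rouche's theorem \<open>L'\<close> has there as many
  zeros as \<open>L\<close>, namely one: the simple trivial zero at \<open>-2j - \<kappa>\<close>.

  The functional equation is obtained on the real interval \<open>(0, 1)\<close>, by computing the Mellin transform of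
  \<open>\<Sum>n. \<chi>(n) exp (-n x)\<close> once termwise and once from its partial fraction expansion. Since both sides of it
  are given by series of period blocks that converge in overlapping half planes, it also provides the
  analytic continuation.
\<close>

section \<open>Dirichlet characters\<close>

text \<open>Positivity of Re(-L'/L) on a contour does not compare |L'| with |L| directly. Rouche's
  theorem is applied to L' and -c L for one large constant c: with W = -L'/L, the inequality |c - W|
  < c holds as soon as |W|^2 < 2 c Re W, and compactness of the contour provides a single c. The
  left edge of the strip for j is the right edge of the strip for j + 1, so one inequality on the
  lines Re w = 2j + kappa, where w = 1 - s, serves both vertical edges. On the right edge it is
  already the second claim, since L' cannot vanish where L'/L has nonzero real part. The inequality
  is delicate for small moduli, where ln(q / 2 pi) is negative. On the line Re w = 2 the character
  is even, which rules out the moduli 2, 3, 4 and 6 and leaves 5 as the only modulus with a negative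
  logarithm. The bounds for L'/L all descend from one estimate of -zeta'/zeta(2); the other
  constants come from bounds for pi, ln 2 and the Euler-Mascheroni constant. The Mellin computation
  needs only real s in (0, 1), where every integral is explicit; the identity theorem does the
  rest.\<close>

lemma dirichlet_character_periodic:
  assumes "dirichlet_character q chi"
  shows "chi (a + int q * k) = chi a"
proof (induction k rule: int_induct[where k = 0])
  case base
  show ?case by simp
next
  case (step1 i)
  have "chi (a + int q * i + int q) = chi (a + int q * i)"
    using assms unfolding dirichlet_character_def by blast
  with step1 show ?case by (simp add: algebra_simps)
next
  case (step2 i)
  have "chi (a + int q * (i - 1) + int q) = chi (a + int q * (i - 1))"
    using assms unfolding dirichlet_character_def by blast
  with step2 show ?case by (simp add: algebra_simps)
qed

lemma dirichlet_character_cong: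
  assumes "dirichlet_character q chi" "[a = b] (mod int q)"
  shows "chi a = chi b"
proof -
  obtain k where "b = a + int q * k"
    using assms(2) by (metis cong_iff_lin)
  thus ?thesis using dirichlet_character_periodic[OF assms(1)] by simp
qed

lemma dirichlet_character_mult:
  "dirichlet_character q chi \<Longrightarrow> chi (a * b) = chi a * chi b"
  unfolding dirichlet_character_def by blast

lemma dirichlet_character_eq_0_iff:
  "dirichlet_character q chi \<Longrightarrow> chi a = 0 \<longleftrightarrow> \<not> coprime a (int q)"
  unfolding dirichlet_character_def by blast

lemma dirichlet_character_1:
  assumes "dirichlet_character q chi"
  shows "chi 1 = 1"
proof -
  have "chi 1 * chi 1 = chi 1" "chi 1 \<noteq> 0"
    using dirichlet_character_mult[OF assms, of 1 1] dirichlet_character_eq_0_iff[OF assms, of 1]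
    by simp_all
  thus ?thesis by simp
qed

lemma dirichlet_character_power:
  assumes "dirichlet_character q chi"
  shows "chi (a ^ k) = chi a ^ k"
  by (induction k) (simp_all add: dirichlet_character_mult[OF assms] dirichlet_character_1[OF assms])

text \<open>By Euler's theorem the value is a root of unity.\<close>

lemma norm_dirichlet_character:
  assumes "dirichlet_character q chi" "coprime a (int q)"
  shows "norm (chi a) = 1"
proof -
  have q: "q > 0" using assms(1) by (simp add: dirichlet_character_def)
  have "[a ^ totient q = 1] (mod int q)"
  proof -
    define b where "b = nat (a mod int q)"
    have b: "int b = a mod int q" using q by (simp add: b_def)
    have "coprime b q"
      using assms(2) q by (metis b coprime_int_iff coprime_mod_left_iff of_nat_0_less_iff less_irrefl)
    hence "[b ^ totient q = 1] (mod q)" by (rule euler_theorem)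
    hence "[int b ^ totient q = 1] (mod int q)"
      by (metis cong_int_iff of_nat_1 of_nat_power)
    thus ?thesis unfolding b by (simp add: cong_def power_mod)
  qed
  hence "chi a ^ totient q = 1"
    using dirichlet_character_cong[OF assms(1)] dirichlet_character_power[OF assms(1)]
      dirichlet_character_1[OF assms(1)] by metis
  hence "norm (chi a) ^ totient q = 1" by (metis norm_one norm_power)
  thus ?thesis using q by (metis norm_ge_zero power_eq_1_iff totient_gt_0_iff not_gr_zero abs_norm_cancel real_norm_def)
qed

lemma norm_dirichlet_character_le:
  assumes "dirichlet_character q chi"
  shows "norm (chi a) \<le> 1"
  using norm_dirichlet_character[OF assms] dirichlet_character_eq_0_iff[OF assms]
  by (metis norm_zero order.refl zero_le_one)

lemma dirichlet_character_cnj: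
  "dirichlet_character q chi \<Longrightarrow> dirichlet_character q (\<lambda>a. cnj (chi a))"
  by (auto simp: dirichlet_character_def)

text \<open>Multiplication by a unit permutes the residues modulo \<open>q\<close>. Both the
  vanishing of character sums and the transformation of Gauss sums rest on this.\<close>

lemma sum_residues_mult_coprime:
  fixes g :: "int \<Rightarrow> 'a :: comm_monoid_add"
  assumes q: "q > 0" and a: "coprime a (int q)"
    and g: "\<And>x y. [x = y] (mod int q) \<Longrightarrow> g x = g y"
  shows "(\<Sum>b<q. g (a * int b)) = (\<Sum>b<q. g (int b))"
proof -
  have "(\<Sum>b<q. g (int (nat (a * int b mod int q)))) = (\<Sum>b<q. g (int b))"
  proof (rule sum.reindex_bij_betw[of "\<lambda>b. nat (a * int b mod int q)" _ _ "\<lambda>b. g (int b)"])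
    show "bij_betw (\<lambda>b. nat (a * int b mod int q)) {..<q} {..<q}"
    proof (rule bij_betwI')
      fix x y assume xy: "x \<in> {..<q}" "y \<in> {..<q}"
      show "(nat (a * int x mod int q) = nat (a * int y mod int q)) = (x = y)"
      proof
        assume "nat (a * int x mod int q) = nat (a * int y mod int q)"
        hence "[a * int x = a * int y] (mod int q)"
          using q by (simp add: cong_def nat_eq_iff2)
        hence "[int x = int y] (mod int q)" using a cong_mult_lcancel by blast
        thus "x = y" using xy by (simp add: cong_def)
      qed simp
    next
      fix x assume "x \<in> {..<q}"
      thus "nat (a * int x mod int q) \<in> {..<q}" using q by (simp add: nat_less_iff)
    next
      fix y assume y: "y \<in> {..<q}"
      obtain a' where a': "[a * a' = 1] (mod int q)" using a cong_solve_coprime_int by blast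
      show "\<exists>x\<in>{..<q}. y = nat (a * int x mod int q)"
      proof
        let ?x = "nat (a' * int y mod int q)"
        have "[a * (a' * int y) = 1 * int y] (mod int q)"
          using a' by (metis cong_scalar_right mult.assoc)
        hence "a * int ?x mod int q = int y mod int q"
          using q by (simp add: cong_def mod_mult_right_eq)
        thus "y = nat (a * int ?x mod int q)" using y by simp
        show "?x \<in> {..<q}" using q by (simp add: nat_less_iff)
      qed
    qed
  qed
  moreover have "(\<Sum>b<q. g (int (nat (a * int b mod int q)))) = (\<Sum>b<q. g (a * int b))"
    using q by (intro sum.cong refl g) (simp add: cong_def)
  ultimately show ?thesis by simp
qed

lemma sum_dirichlet_character_eq_0:
  assumes chi: "dirichlet_character q chi"
    and nontriv: "\<exists>a. coprime a (int q) \<and> chi a \<noteq> 1"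
  shows "(\<Sum>b<q. chi (int b)) = 0"
proof -
  have q: "q > 0" using chi by (simp add: dirichlet_character_def)
  obtain a where a: "coprime a (int q)" "chi a \<noteq> 1" using nontriv by blast
  have "(\<Sum>b<q. chi (a * int b)) = (\<Sum>b<q. chi (int b))"
    using dirichlet_character_cong[OF chi] by (rule sum_residues_mult_coprime[OF q a(1)])
  hence "chi a * (\<Sum>b<q. chi (int b)) = (\<Sum>b<q. chi (int b))"
    by (simp add: sum_distrib_left dirichlet_character_mult[OF chi])
  thus ?thesis using a(2) by simp
qed

text \<open>A trivial character is induced by the constant 1, a character modulo the proper divisor
  1.\<close>

lemma primitive_character_imp_nontrivial:
  assumes "q > 1" "primitive_character q chi"
  shows "\<exists>a. coprime a (int q) \<and> chi a \<noteq> 1"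
proof (rule ccontr)
  assume "\<not> ?thesis"
  hence "\<forall>a. coprime a (int q) \<longrightarrow> chi a = (\<lambda>_. 1) a" by blast
  moreover have "dirichlet_character 1 (\<lambda>_. 1)" by (simp add: dirichlet_character_def)
  ultimately show False using assms unfolding primitive_character_def
    by (metis one_dvd)
qed

lemma primitive_character_imp_not_principal:
  assumes "q > 1" "primitive_character q chi"
  shows "\<not> principal_character q chi"
  using primitive_character_imp_nontrivial[OF assms] by (auto simp: principal_character_def)

lemma primitive_character_cnj:
  assumes "primitive_character q chi"
  shows "primitive_character q (\<lambda>a. cnj (chi a))"
  unfolding primitive_character_def
proof (intro conjI notI)
  show "dirichlet_character q (\<lambda>a. cnj (chi a))"
    using assms by (auto simp: primitive_character_def intro: dirichlet_character_cnj)
next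
  assume "\<exists>d \<psi>. d dvd q \<and> d < q \<and> dirichlet_character d \<psi> \<and>
            (\<forall>a. coprime a (int q) \<longrightarrow> cnj (chi a) = \<psi> a)"
  then obtain d \<psi> where d: "d dvd q" "d < q" "dirichlet_character d \<psi>"
    "\<forall>a. coprime a (int q) \<longrightarrow> cnj (chi a) = \<psi> a" by blast
  have "dirichlet_character d (\<lambda>a. cnj (\<psi> a))" by (intro dirichlet_character_cnj d)
  moreover have "\<forall>a. coprime a (int q) \<longrightarrow> chi a = cnj (\<psi> a)"
    using d(4) by (metis complex_cnj_cnj)
  ultimately show False using assms d unfolding primitive_character_def by blast
qed

text \<open>To \<open>a\<close> one adds \<open>d\<close> times the product of the primes of
  \<open>q\<close> that do not divide \<open>a\<close>. Each prime of \<open>q\<close> then divides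
  exactly one of the two summands, hence not their sum.\<close>

lemma coprime_lift:
  fixes a :: int
  assumes "coprime a (int d)" "q > 0"
  shows "\<exists>a'. [a' = a] (mod int d) \<and> coprime a' (int q)"
proof
  define S where "S = {p. prime p \<and> p dvd q \<and> \<not> int p dvd a}"
  have fin: "finite S" unfolding S_def
    by (rule finite_subset[of _ "{..q}"]) (use assms(2) in \<open>auto intro: dvd_imp_le\<close>)
  let ?a = "a + int d * int (\<Prod>S)"
  show "[?a = a] (mod int d) \<and> coprime ?a (int q)"
  proof
    show "[?a = a] (mod int d)" by (simp add: cong_def)
    show "coprime ?a (int q)"
    proof (rule ccontr)
      assume "\<not> coprime ?a (int q)"
      hence "gcd ?a (int q) \<noteq> 1" by (simp only: coprime_iff_gcd_eq_1 not_False_eq_True)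
      hence "\<bar>gcd ?a (int q)\<bar> \<noteq> 1" by (simp only: abs_gcd_int not_False_eq_True)
      then obtain p0 :: int where p0': "prime p0" "p0 dvd gcd ?a (int q)"
        using prime_factor_int by blast
      have p0: "prime p0" "p0 dvd ?a" "p0 dvd int q"
        using p0' dvd_trans[OF p0'(2) gcd_dvd1] dvd_trans[OF p0'(2) gcd_dvd2] by blast+
      define p where "p = nat p0"
      have p: "prime p" "int p dvd ?a" "p dvd q" and [simp]: "p0 = int p"
        using p0 by (auto simp: p_def prime_ge_0_int prime_nat_iff_prime nat_dvd_iff int_dvd_int_iff[symmetric])
      show False
      proof (cases "int p dvd a")
        case True
        hence "int p dvd int d * int (\<Prod>S)" using p(2) by (simp add: dvd_add_right_iff)
        hence "p dvd d * \<Prod>S" by (metis int_dvd_int_iff of_nat_mult)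
        hence "p dvd d \<or> p dvd \<Prod>S" using p(1) by (simp add: prime_dvd_mult_iff)
        thus False
        proof
          assume "p dvd d"
          hence "is_unit (int p)" using assms(1) True by (meson coprime_common_divisor int_dvd_int_iff)
          thus False using p(1) by (simp add: prime_nat_iff)
        next
          assume "p dvd \<Prod>S"
          then obtain r where "r \<in> S" "p dvd r"
            using p(1) fin by (metis prime_dvd_prod_iff)
          hence "p = r" using p(1) by (auto simp: S_def primes_dvd_imp_eq)
          thus False using \<open>r \<in> S\<close> True by (simp add: S_def)
        qed
      next
        case False
        hence "p \<in> S" using p by (simp add: S_def)
        hence "p dvd \<Prod>S" using fin dvd_prodI[of S p "\<lambda>x. x"] by simp
        hence "p dvd d * \<Prod>S" by (rule dvd_mult)
        hence "int p dvd int d * int (\<Prod>S)" by (metis int_dvd_int_iff of_nat_mult)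
        hence "int p dvd a" using p(2) by (simp add: dvd_add_left_iff)
        with False show False by simp
      qed
    qed
  qed
qed

text \<open>Otherwise \<open>chi\<close> would depend only on residues modulo \<open>d\<close>, and
  composing it with a lift of units from \<open>d\<close> to \<open>q\<close> would give a character
  modulo \<open>d\<close> inducing it.\<close>

lemma primitive_character_nontrivial_on_kernel:
  assumes prim: "primitive_character q chi" and d: "d dvd q" "d < q"
  shows "\<exists>c. [c = 1] (mod int d) \<and> coprime c (int q) \<and> chi c \<noteq> 1"
proof (rule ccontr)
  assume "\<not> ?thesis"
  hence triv: "chi c = 1" if "[c = 1] (mod int d)" "coprime c (int q)" for c using that by blast
  have chi: "dirichlet_character q chi" using prim by (simp add: primitive_character_def)
  have q: "q > 0" using chi by (simp add: dirichlet_character_def)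
  have dpos: "d > 0" using d q by (metis dvd_0_left_iff gr0I)
  \<comment> \<open>Multiplying by an inverse of \<open>b\<close> modulo \<open>q\<close> turns
    \<open>a\<close> into a residue congruent to 1 modulo \<open>d\<close>, where \<open>chi\<close>
    is assumed trivial.\<close>
  have same: "chi a = chi b" if ab: "[a = b] (mod int d)" "coprime a (int q)" "coprime b (int q)" for a b
  proof -
    obtain b' where b': "[b * b' = 1] (mod int q)" using ab(3) cong_solve_coprime_int by blast
    have cop: "coprime b' (int q)"
      using b' by (metis cong_imp_coprime coprime_1_left cong_sym coprime_mult_left_iff)
    have "[a * b' = b * b'] (mod int d)" using ab(1) by (rule cong_scalar_right)
    moreover have "[b * b' = 1] (mod int d)" using b' d(1)
      by (meson cong_dvd_modulus int_dvd_int_iff)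
    ultimately have "[a * b' = 1] (mod int d)" by (rule cong_trans)
    hence "chi (a * b') = 1" using triv ab(2) cop by simp
    moreover have "chi (b * b') = 1"
      using dirichlet_character_cong[OF chi b'] dirichlet_character_1[OF chi] by simp
    moreover have "chi b' \<noteq> 0" using cop dirichlet_character_eq_0_iff[OF chi] by blast
    ultimately show ?thesis 
      by (metis dirichlet_character_mult[OF chi] mult_right_cancel)
  qed
  define lift where "lift a = (SOME a'. [a' = a] (mod int d) \<and> coprime a' (int q))" for a
  have lift: "[lift a = a] (mod int d) \<and> coprime (lift a) (int q)" if "coprime a (int d)" for a
    unfolding lift_def using coprime_lift[OF that q] by (rule someI_ex)
  define \<psi> where "\<psi> a = (if coprime a (int d) then chi (lift a) else 0)" for a
  have psi: "\<psi> a = chi b" if "[b = a] (mod int d)" "coprime b (int q)" for a b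
  proof -
    have "coprime b (int d)" using that(2) d(1)
      by (meson coprime_divisors dvd_refl int_dvd_int_iff)
    hence *: "coprime a (int d)" using that(1) cong_imp_coprime by blast
    have "chi (lift a) = chi b"
      using lift[OF *] that by (intro same) (auto intro: cong_trans cong_sym)
    thus ?thesis using * by (simp add: \<psi>_def)
  qed
  have "dirichlet_character d \<psi>"
    unfolding dirichlet_character_def
  proof (intro conjI allI)
    show "d > 0" by (rule dpos)
    show "\<psi> (a * b) = \<psi> a * \<psi> b" for a b
    proof (cases "coprime a (int d) \<and> coprime b (int d)")
      case True
      have "\<psi> (a * b) = chi (lift a * lift b)"
        using True lift by (intro psi cong_mult) auto
      thus ?thesis using True by (simp add: dirichlet_character_mult[OF chi] \<psi>_def)
    qed (auto simp: \<psi>_def)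
    show "\<psi> (a + int d) = \<psi> a" for a
    proof (cases "coprime a (int d)")
      case True
      have "\<psi> (a + int d) = chi (lift a)"
        using lift[OF True] by (intro psi) (auto simp: cong_def)
      thus ?thesis using True by (simp add: \<psi>_def)
    next
      case False
      hence "\<not> coprime (a + int d) (int d)" by (simp add: coprime_iff_gcd_eq_1)
      with False show ?thesis by (simp add: \<psi>_def)
    qed
    show "(\<psi> a \<noteq> 0) = coprime a (int d)" for a
      using lift[of a] dirichlet_character_eq_0_iff[OF chi] by (auto simp: \<psi>_def)
  qed
  moreover have "\<forall>a. coprime a (int q) \<longrightarrow> chi a = \<psi> a"
    using psi by (metis cong_refl)
  ultimately show False using prim d unfolding primitive_character_def by blast
qed

lemma dirichlet_character_mod_eq_1:
  assumes "dirichlet_character q chi" "chi (-1) = 1" "coprime a (int q)" "[a = 1] (mod int q) \<or> [a = -1] (mod int q)"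
  shows "chi a = 1"
  using assms(4) dirichlet_character_cong[OF assms(1), of a] assms(2) dirichlet_character_1[OF assms(1)] by metis

section \<open>Gauss sums\<close>

definition unit_root :: "nat \<Rightarrow> int \<Rightarrow> complex" where
  "unit_root q k = cis (2 * pi * of_int k / of_nat q)"

lemma unit_root_add: "unit_root q (a + b) = unit_root q a * unit_root q b"
  by (simp add: unit_root_def cis_mult ring_distribs add_divide_distrib)

lemma unit_root_0 [simp]: "unit_root q 0 = 1"
  by (simp add: unit_root_def)

lemma unit_root_mult_nat: "unit_root q (k * int n) = unit_root q k ^ n"
  by (induction n) (simp_all add: unit_root_add ring_distribs)

lemma unit_root_eq_1_iff:
  assumes "q > 0"
  shows "unit_root q k = 1 \<longleftrightarrow> int q dvd k"
proof
  assume "unit_root q k = 1"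
  hence "exp (\<i> * of_real (2 * pi * of_int k / of_nat q)) = 1"
    by (simp add: unit_root_def cis_conv_exp)
  then obtain n :: int where n: "2 * pi * of_int k / of_nat q = of_int (2 * n) * pi"
    by (auto simp: exp_eq_1)
  hence "real_of_int k = real_of_int (int q * n)" using assms by (simp add: field_simps)
  thus "int q dvd k" by (metis dvd_triv_left of_int_eq_iff)
next
  assume "int q dvd k"
  then obtain m where "k = int q * m" by blast
  hence "2 * pi * of_int k / of_nat q = 2 * pi * of_int m" using assms by simp
  thus "unit_root q k = 1"
    unfolding unit_root_def by (simp only: cis_multiple_2pi[OF Ints_of_int])
qed

lemma unit_root_cong:
  assumes "q > 0" "[a = b] (mod int q)"
  shows "unit_root q a = unit_root q b"
proof -
  have "unit_root q (a - b) = 1"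
    using assms by (simp add: unit_root_eq_1_iff cong_iff_dvd_diff)
  thus ?thesis using unit_root_add[of q "a - b" b] by simp
qed

lemma sum_unit_root:
  assumes "q > 0"
  shows "(\<Sum>a<q. unit_root q (k * int a)) = (if int q dvd k then of_nat q else 0)"
proof (cases "int q dvd k")
  case True
  hence "unit_root q k = 1" using unit_root_eq_1_iff[OF assms] by simp
  thus ?thesis using True by (simp add: unit_root_mult_nat)
next
  case False
  have "unit_root q k ^ q = unit_root q (k * int q)" by (simp add: unit_root_mult_nat)
  also have "\<dots> = 1" using unit_root_eq_1_iff[OF assms] by simp
  finally show ?thesis
    using False unit_root_eq_1_iff[OF assms, of k]
    by (simp add: unit_root_mult_nat sum_gp_strict)
qed

definition gauss_sum :: "nat \<Rightarrow> (int \<Rightarrow> complex) \<Rightarrow> int \<Rightarrow> complex" where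
  "gauss_sum q chi a = (\<Sum>b<q. chi (int b) * unit_root q (a * int b))"

text \<open>Substitute \<open>c * b\<close> for \<open>b\<close> in the sum. The form with
  \<open>a * c\<close> serves twice: with \<open>a = 1\<close> it evaluates the sum at units, and
  with \<open>a * c\<close> congruent to \<open>a\<close> it forces the sum to vanish.\<close>

lemma gauss_sum_mult:
  assumes chi: "dirichlet_character q chi" and c: "coprime c (int q)"
  shows "chi c * gauss_sum q chi (a * c) = gauss_sum q chi a"
proof -
  have q: "q > 0" using chi by (simp add: dirichlet_character_def)
  have "(\<Sum>b<q. chi (c * int b) * unit_root q (a * (c * int b))) = gauss_sum q chi a"
    unfolding gauss_sum_def
    by (rule sum_residues_mult_coprime[OF q c, of "\<lambda>x. chi x * unit_root q (a * x)"])
       (metis dirichlet_character_cong[OF chi] unit_root_cong[OF q] cong_scalar_left)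
  thus ?thesis
    by (simp add: gauss_sum_def sum_distrib_left dirichlet_character_mult[OF chi] mult_ac)
qed

text \<open>If \<open>gcd a q > 1\<close>, then \<open>unit_root q (a * b)\<close> only depends on \<open>b\<close> modulo a proper divisor \<open>d\<close> of
  \<open>q\<close>, while a primitive character is nontrivial on the residues congruent to 1 modulo \<open>d\<close>; this forces the sum to vanish.\<close>

lemma gauss_sum_primitive:
  assumes prim: "primitive_character q chi"
  shows "gauss_sum q chi a = cnj (chi a) * gauss_sum q chi 1"
proof (cases "coprime a (int q)")
  case True
  have chi: "dirichlet_character q chi" using prim by (simp add: primitive_character_def)
  have "chi a * gauss_sum q chi a = gauss_sum q chi 1"
    using gauss_sum_mult[OF chi True, of 1] by simp
  moreover have "cnj (chi a) * chi a = 1"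
    using norm_dirichlet_character[OF chi True] by (simp add: complex_norm_square[symmetric] mult.commute)
  ultimately show ?thesis by (metis mult.assoc mult_1)
next
  case False
  have chi: "dirichlet_character q chi" using prim by (simp add: primitive_character_def)
  have q: "q > 0" using chi by (simp add: dirichlet_character_def)
  define g where "g = nat (gcd a (int q))"
  have g: "int g = gcd a (int q)" by (simp add: g_def)
  have gq: "g dvd q" using g by (metis gcd_dvd2 int_dvd_int_iff)
  then obtain d where d: "q = d * g" by (metis dvd_def mult.commute)
  have "g \<noteq> 1" using False g by (simp add: coprime_iff_gcd_eq_1)
  hence "g > 1" using q d by (cases g) auto
  hence "d < q" using q d by simp
  then obtain c where c: "[c = 1] (mod int d)" "coprime c (int q)" "chi c \<noteq> 1"
    using primitive_character_nontrivial_on_kernel[OF prim, of d] d by auto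
  have "int d dvd c - 1" using c(1) by (simp add: cong_iff_dvd_diff)
  moreover have "int g dvd a" using g by simp
  ultimately have "int d * int g dvd (c - 1) * a" by (rule mult_dvd_mono)
  hence "[a * c = a] (mod int q)" by (simp add: d cong_iff_dvd_diff algebra_simps)
  hence "gauss_sum q chi (a * c) = gauss_sum q chi a"
    unfolding gauss_sum_def
    by (intro sum.cong refl arg_cong2[of _ _ _ _ "(*)"] unit_root_cong[OF q] cong_scalar_right)
  hence "chi c * gauss_sum q chi a = gauss_sum q chi a"
    using gauss_sum_mult[OF chi c(2), of a] by simp
  moreover have "chi a = 0" using False dirichlet_character_eq_0_iff[OF chi] by blast
  ultimately show ?thesis using c(3) by simp
qed

text \<open>Finite Fourier inversion: if the sum at 1 were zero, separability would make the whole
  transform of \<open>chi\<close> vanish, but inverting it at the residue 1 returns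
  \<open>q * chi 1 = q\<close>.\<close>

lemma gauss_sum_primitive_nonzero:
  assumes q: "q > 1" and prim: "primitive_character q chi"
  shows "gauss_sum q chi 1 \<noteq> 0"
proof
  assume 0: "gauss_sum q chi 1 = 0"
  have chi: "dirichlet_character q chi" using prim by (simp add: primitive_character_def)
  have "0 = (\<Sum>a<q. unit_root q (-int a) * gauss_sum q chi (int a))"
    using gauss_sum_primitive[OF prim] 0 by simp
  also have "\<dots> = (\<Sum>b<q. \<Sum>a<q. unit_root q (-int a) * (chi (int b) * unit_root q (int a * int b)))"
    unfolding gauss_sum_def sum_distrib_left by (rule sum.swap)
  also have "\<dots> = (\<Sum>b<q. chi (int b) * (\<Sum>a<q. unit_root q ((int b - 1) * int a)))"
    unfolding sum_distrib_left
  proof (intro sum.cong refl)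
    fix a b
    have "(int b - 1) * int a = - int a + int a * int b" by (simp add: algebra_simps)
    thus "unit_root q (- int a) * (chi (int b) * unit_root q (int a * int b)) =
      chi (int b) * unit_root q ((int b - 1) * int a)"
      by (simp only: unit_root_add mult_ac)
  qed
  also have "\<dots> = (\<Sum>b<q. if b = 1 then of_nat q else 0)"
  proof (intro sum.cong refl)
    fix b assume b: "b \<in> {..<q}"
    have "int q dvd int b - 1 \<longleftrightarrow> b = 1"
    proof
      assume "int q dvd int b - 1"
      hence "\<not> 0 < int b - 1" using b zdvd_imp_le by force
      moreover have "b \<noteq> 0"
      proof
        assume "b = 0"
        hence "int q dvd 1" using \<open>int q dvd int b - 1\<close> by (metis dvd_minus_iff diff_0 of_nat_0)
        thus False using q by simp
      qed
      ultimately show "b = 1" by simp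
    qed simp
    thus "chi (int b) * (\<Sum>a<q. unit_root q ((int b - 1) * int a)) = (if b = 1 then of_nat q else 0)"
      using q by (simp add: sum_unit_root dirichlet_character_1[OF chi])
  qed
  also have "\<dots> = of_nat q" using q by simp
  finally show False using q by simp
qed

section \<open>Continuation to the right half plane\<close>

text \<open>Mean value inequality on the segment from \<open>x\<close> to \<open>y\<close>. The
  bound on \<open>Re s\<close> makes the modulus of the derivative decreasing, so it is largest at
  \<open>x\<close>.\<close>

lemma norm_powr_neg_diff_le:
  fixes s :: complex
  assumes "0 < x" "x \<le> y" "Re s \<ge> -1"
  shows "norm (of_real y powr (-s) - of_real x powr (-s)) \<le> norm s * x powr (-Re s - 1) * (y - x)"
proof -
  let ?S = "closed_segment (complex_of_real x) (of_real y)"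
  have "norm ((of_real y) powr (-s) - of_real x powr (-s)) \<le>
          (norm s * x powr (-Re s - 1)) * norm (complex_of_real y - of_real x)"
  proof (rule field_differentiable_bound[of ?S "\<lambda>z. z powr (-s)" "\<lambda>z. -s * z powr (-s - 1)"])
    fix z assume "z \<in> ?S"
    then obtain u where u: "z = of_real u" "x \<le> u" "u \<le> y"
      using assms(2) by (auto simp: closed_segment_of_real closed_segment_eq_real_ivl)
    show "((\<lambda>z. z powr (-s)) has_field_derivative -s * z powr (-s - 1)) (at z within ?S)"
      using assms(1) u by (intro has_field_derivative_at_within[OF has_field_derivative_powr]) auto
    have "u powr (-Re s - 1) \<le> x powr (-Re s - 1)"
      using assms u by (intro powr_mono2') auto
    thus "norm (-s * z powr (-s - 1)) \<le> norm s * x powr (-Re s - 1)"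
      using assms u by (simp add: norm_mult norm_powr_real_powr mult_left_mono)
  qed auto
  also have "norm (complex_of_real y - of_real x) = y - x"
    using assms(2) by (simp flip: of_real_diff)
  finally show ?thesis .
qed

text \<open>Grouping the Dirichlet series into complete periods makes it converge absolutely
  on \<open>Re s > 0\<close>.\<close>

definition L_block :: "nat \<Rightarrow> (int \<Rightarrow> complex) \<Rightarrow> complex \<Rightarrow> nat \<Rightarrow> complex" where
  "L_block q chi s m = (\<Sum>a\<in>{1..<q}. chi (int a) * of_nat (m * q + a) powr (-s))"

definition L_half :: "nat \<Rightarrow> (int \<Rightarrow> complex) \<Rightarrow> complex \<Rightarrow> complex" where
  "L_half q chi s = (\<Sum>m. L_block q chi s m)"

lemma sum_dirichlet_character_atLeast1:
  fixes f :: "nat \<Rightarrow> complex"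
  assumes "dirichlet_character q chi" "q > 1"
  shows "(\<Sum>a\<in>{1..<q}. chi (int a) * f a) = (\<Sum>a<q. chi (int a) * f a)"
proof -
  have "chi 0 = 0" using dirichlet_character_eq_0_iff[OF assms(1), of 0] assms(2) by simp
  moreover have "{..<q} = insert 0 {1..<q}" using assms(2) by auto
  ultimately show ?thesis by simp
qed

text \<open>Since the coefficients of a block sum to zero, the value at \<open>m * q\<close> may be
  subtracted from every term; the difference gains a factor of order \<open>1 / m\<close>. The
  reference point must be positive, hence \<open>m > 0\<close>.\<close>

lemma norm_L_block_le:
  assumes chi: "dirichlet_character q chi" and q: "q > 1" and sum0: "(\<Sum>b<q. chi (int b)) = 0"
    and s: "Re s \<ge> \<sigma>" "norm s \<le> B" "\<sigma> > 0" and m: "m > 0"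
  shows "norm (L_block q chi s m) \<le> real q * real q * B * real m powr (-\<sigma> - 1)"
proof -
  have "(\<Sum>a\<in>{1..<q}. chi (int a)) = 0"
    using sum_dirichlet_character_atLeast1[OF chi q, of "\<lambda>_. 1"] sum0 by simp
  hence "L_block q chi s m = (\<Sum>a\<in>{1..<q}. chi (int a) * (of_real (real (m * q + a)) powr (-s) -
       of_real (real (m * q)) powr (-s)))"
    unfolding L_block_def right_diff_distrib sum_subtractf
    by (simp flip: sum_distrib_right)
  also have "norm \<dots> \<le> (\<Sum>a\<in>{1..<q}. B * real m powr (-\<sigma> - 1) * q)"
  proof (rule sum_norm_le)
    fix a assume a: "a \<in> {1..<q}"
    have pos: "0 < real (m * q)" using m q by simp
    have "norm (chi (int a) * (of_real (real (m * q + a)) powr (-s) - of_real (real (m * q)) powr (-s)))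
        \<le> 1 * (norm s * real (m * q) powr (-Re s - 1) * (real (m * q + a) - real (m * q)))"
      unfolding norm_mult using s pos a
      by (intro mult_mono norm_dirichlet_character_le[OF chi] norm_powr_neg_diff_le) auto
    also have "\<dots> \<le> B * real m powr (-\<sigma> - 1) * q"
    proof -
      have "real (m * q) powr (-Re s - 1) \<le> real m powr (-Re s - 1)"
        using m q s by (intro powr_mono2') auto
      also have "\<dots> \<le> real m powr (-\<sigma> - 1)"
        using m s by (intro powr_mono) auto
      finally have "norm s * real (m * q) powr (-Re s - 1) \<le> B * real m powr (-\<sigma> - 1)"
        using s by (intro mult_mono order_trans[OF norm_ge_zero s(2)]) auto
      moreover have "real (m * q + a) - real (m * q) \<le> q" using a by simp
      moreover have "0 \<le> B" by (rule order_trans[OF norm_ge_zero s(2)])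
      ultimately have "norm s * real (m * q) powr (-Re s - 1) * (real (m * q + a) - real (m * q))
         \<le> B * real m powr (-\<sigma> - 1) * q"
        by (intro mult_mono[of "norm s * real (m * q) powr (-Re s - 1)"]) auto
      thus ?thesis by simp
    qed
    finally show "norm (chi (int a) * (of_real (real (m * q + a)) powr (-s) - of_real (real (m * q)) powr (-s)))
       \<le> B * real m powr (-\<sigma> - 1) * q" .
  qed
  also have "\<dots> = real (q - 1) * (B * real m powr (-\<sigma> - 1) * q)" by simp
  also have "\<dots> \<le> real q * (B * real m powr (-\<sigma> - 1) * q)"
  proof (intro mult_right_mono)
    have "0 \<le> B" using s(2) norm_ge_zero order_trans by blast
    thus "0 \<le> B * real m powr (-\<sigma> - 1) * q" by simp
  qed simp
  finally show ?thesis by (simp add: mult_ac)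
qed

lemma L_half_holomorphic_sums:
  assumes chi: "dirichlet_character q chi" and q: "q > 1" and sum0: "(\<Sum>b<q. chi (int b)) = 0"
  shows L_half_holomorphic: "L_half q chi holomorphic_on {s. Re s > 0}"
    and L_half_sums: "Re s > 0 \<Longrightarrow> L_block q chi s sums L_half q chi s"
proof -
  let ?S = "{s. Re s > 0}"
  let ?f' = "\<lambda>m s. \<Sum>a\<in>{1..<q}. chi (int a) * (- (Ln (of_nat (m * q + a)) * of_nat (m * q + a) powr (-s)))"
  have "\<exists>g g'. \<forall>s \<in> ?S. ((\<lambda>m. L_block q chi s m) sums g s) \<and> ((\<lambda>m. ?f' m s) sums g' s) \<and>
          (g has_field_derivative g' s) (at s)"
  proof (rule series_and_derivative_comparison_local)
    show "open ?S" by (rule open_halfspace_Re_gt)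
    show "((\<lambda>s. L_block q chi s m) has_field_derivative ?f' m s) (at s)" for m s
      unfolding L_block_def
    proof (intro DERIV_sum DERIV_cmult)
      fix a assume "a \<in> {1..<q}"
      hence "complex_of_nat (m * q + a) \<noteq> 0" by (simp del: of_nat_add)
      from DERIV_chain'[OF DERIV_minus[OF DERIV_ident] has_field_derivative_powr_right[OF this], of s]
      show "((\<lambda>s. of_nat (m * q + a) powr (-s)) has_field_derivative
          - (Ln (of_nat (m * q + a)) * of_nat (m * q + a) powr (-s))) (at s)"
        by simp
    qed
    fix s assume s: "s \<in> ?S"
    \<comment> \<open>A ball of this radius stays in \<open>Re y \<ge> \<sigma> > 0\<close>, where
      the block bound is uniform and summable.\<close>
    define \<sigma> where "\<sigma> = Re s / 2"
    have \<sigma>: "\<sigma> > 0" using s by (simp add: \<sigma>_def)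
    let ?h = "\<lambda>m. real q * real q * (norm s + \<sigma>) * real m powr (-\<sigma> - 1)"
    have "summable ?h" using \<sigma> by (intro summable_mult) (simp add: summable_real_powr_iff)
    moreover have "\<forall>\<^sub>F m in sequentially. \<forall>y\<in>ball s \<sigma> \<inter> ?S. norm (L_block q chi y m) \<le> ?h m"
      using eventually_gt_at_top[of 0]
    proof eventually_elim
      case (elim m)
      show ?case
      proof
        fix y assume "y \<in> ball s \<sigma> \<inter> ?S"
        hence d: "norm (s - y) < \<sigma>" by (simp add: dist_norm)
        have "Re (s - y) < \<sigma>" using d complex_Re_le_cmod[of "s - y"] by linarith
        hence "Re y \<ge> \<sigma>" by (simp add: \<sigma>_def)
        moreover have "norm y \<le> norm s + \<sigma>" using d norm_triangle_ineq2[of y s]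
          by (simp add: norm_minus_commute)
        ultimately show "norm (L_block q chi y m) \<le> ?h m"
          by (intro norm_L_block_le chi q sum0 \<sigma> elim)
      qed
    qed
    ultimately show "\<exists>d h. 0 < d \<and> summable h \<and> (\<forall>\<^sub>F m in sequentially. \<forall>y\<in>ball s d \<inter> ?S.
        norm (L_block q chi y m) \<le> h m)" using \<sigma> by blast
  qed
  then obtain g g' where g: "\<And>s. Re s > 0 \<Longrightarrow> L_block q chi s sums g s"
     "\<And>s. Re s > 0 \<Longrightarrow> (g has_field_derivative g' s) (at s)" by auto
  have eq: "L_half q chi s = g s" if "Re s > 0" for s
    using g(1)[OF that] by (simp add: L_half_def sums_iff)
  have "g holomorphic_on ?S"
    using g(2) by (auto simp: holomorphic_on_def field_differentiable_def intro: has_field_derivative_at_within)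
  thus "L_half q chi holomorphic_on ?S"
    by (rule holomorphic_transform) (simp add: eq)
  show "Re s > 0 \<Longrightarrow> L_block q chi s sums L_half q chi s" using g(1) eq by simp
qed

lemma summable_dirichlet_series:
  fixes f :: "nat \<Rightarrow> complex"
  assumes "\<And>n. norm (f n) \<le> 1" "Re s > 1"
  shows "summable (\<lambda>n. norm (f (Suc n) / of_nat (Suc n) powr s))"
proof (rule summable_comparison_test')
  have "summable (\<lambda>n. real n powr (-Re s))" using assms(2) by (simp add: summable_real_powr_iff)
  thus "summable (\<lambda>n. real (Suc n) powr (-Re s))" by (subst summable_Suc_iff)
  fix n :: nat
  have "norm (f (Suc n) / of_nat (Suc n) powr s) = norm (f (Suc n)) / real (Suc n) powr (Re s)"
    using norm_powr_real_powr[of "of_nat (Suc n)" s]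
    by (simp add: norm_divide del: of_nat_Suc)
  also have "\<dots> \<le> 1 / real (Suc n) powr (Re s)" by (intro divide_right_mono assms) auto
  finally show "norm (norm (f (Suc n) / of_nat (Suc n) powr s)) \<le> real (Suc n) powr (-Re s)"
    by (simp add: powr_minus field_simps)
qed

lemma dirichlet_series_sums_L_half:
  assumes chi: "dirichlet_character q chi" and q: "q > 1" and sum0: "(\<Sum>b<q. chi (int b)) = 0"
    and s: "Re s > 1"
  shows "(\<lambda>n. chi (int (Suc n)) / of_nat (Suc n) powr s) sums L_half q chi s"
proof -
  let ?f = "\<lambda>n. chi (int (Suc n)) / of_nat (Suc n) powr s"
  have "summable ?f"
    using norm_dirichlet_character_le[OF chi]
    by (intro summable_norm_cancel[OF summable_dirichlet_series[of "\<lambda>n. chi (int n)", OF _ s]])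
  then obtain l where l: "?f sums l" by (auto simp: summable_def)
  have "(\<lambda>n. sum ?f {n * q..<n * q + q}) sums l" using sums_group[OF l, of q] q by simp
  moreover have "sum ?f {n * q..<n * q + q} = L_block q chi s n" for n
  proof -
    have "sum ?f {n * q..<n * q + q} = (\<Sum>r\<in>{0..<q}. ?f (r + n * q))"
      using sum.shift_bounds_nat_ivl[of ?f 0 "n * q" q] by (simp add: add.commute)
    also have "\<dots> = (\<Sum>r\<in>{0..<q}. chi (int (Suc r)) * of_nat (n * q + Suc r) powr (-s))"
    proof (intro sum.cong refl)
      fix r
      have "[int (Suc (r + n * q)) = int (Suc r)] (mod int q)" by (simp add: cong_iff_dvd_diff)
      hence "chi (int (Suc (r + n * q))) = chi (int (Suc r))"
        using dirichlet_character_cong[OF chi] by blast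
      moreover have "Suc (r + n * q) = n * q + Suc r" by simp
      ultimately show "?f (r + n * q) = chi (int (Suc r)) * of_nat (n * q + Suc r) powr (-s)"
        by (simp only: powr_minus divide_inverse)
    qed
    also have "\<dots> = (\<Sum>a\<in>{Suc 0..<Suc q}. chi (int a) * of_nat (n * q + a) powr (-s))"
      by (rule sum.shift_bounds_Suc_ivl[symmetric])
    \<comment> \<open>The series starts at 1, so each group runs through the residues 1 to
      \<open>q\<close>; the residue \<open>q\<close> contributes zero.\<close>
    also have "\<dots> = L_block q chi s n"
      using q dirichlet_character_eq_0_iff[OF chi, of "int q"] by (simp add: L_block_def)
    finally show ?thesis .
  qed
  ultimately have "L_block q chi s sums l" by simp
  with L_half_sums[OF chi q sum0, of s] s have "l = L_half q chi s" by (simp add: sums_iff)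
  with l show ?thesis by simp
qed

section \<open>Mellin integrals\<close>

lemma Gamma_reflection_real:
  fixes x :: real
  shows "Gamma x * Gamma (1 - x) = pi / sin (pi * x)"
proof -
  have "Gamma (complex_of_real x) * Gamma (complex_of_real (1 - x)) = of_real (pi / sin (pi * x))"
    using Gamma_reflection_complex[of "of_real x"] by (simp flip: sin_of_real)
  hence "complex_of_real (Gamma x * Gamma (1 - x)) = of_real (pi / sin (pi * x))"
    by (simp only: Gamma_complex_of_real of_real_mult)
  thus ?thesis by (simp only: of_real_eq_iff)
qed

text \<open>The substitution \<open>x = sqrt (t / (1 - t))\<close>, with inverse
  \<open>t = x\<^sup>2 / (1 + x\<^sup>2)\<close>, gives half the Beta integral with parameters
  \<open>a/2\<close> and \<open>1 - a/2\<close>, which the reflection formula evaluates.\<close>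

lemma powr_over_one_plus_square:
  assumes a: "0 < a" "a < (2::real)"
  shows "(\<lambda>x. x powr (a - 1) / (1 + x\<^sup>2)) absolutely_integrable_on {0<..} \<and>
         integral {0<..} (\<lambda>x. x powr (a - 1) / (1 + x\<^sup>2)) = pi / (2 * sin (pi * a / 2))"
proof -
  define g where "g t = (t / (1 - t)) powr (1/2)" for t :: real
  define g' where "g' t = 1/2 * (t / (1 - t)) powr (1/2 - 1) * (1 / (1 - t)\<^sup>2)" for t :: real
  let ?f = "\<lambda>x::real. x powr (a - 1) / (1 + x\<^sup>2)"
  let ?B = "\<lambda>t::real. t powr (a/2 - 1) * (1 - t) powr ((1 - a/2) - 1)"
  have img: "g ` {0<..<1} = {0<..}"
  proof safe
    fix t :: real assume "t \<in> {0<..<1}" thus "0 < g t" by (simp add: g_def)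
  next
    fix x :: real assume x: "0 < x"
    have "x\<^sup>2 / (1 + x\<^sup>2) / (1 - x\<^sup>2 / (1 + x\<^sup>2)) = x\<^sup>2"
    proof -
      have "1 - x\<^sup>2 / (1 + x\<^sup>2) = 1 / (1 + x\<^sup>2)"
        by (simp add: field_simps add_nonneg_eq_0_iff)
      thus ?thesis by (simp add: add_nonneg_eq_0_iff)
    qed
    hence "g (x\<^sup>2 / (1 + x\<^sup>2)) = x" using x by (simp add: g_def powr_half_sqrt)
    moreover have "x\<^sup>2 / (1 + x\<^sup>2) \<in> {0<..<1}" using x by (simp add: add_pos_pos)
    ultimately show "x \<in> g ` {0<..<1}" by force
  qed
  have inj: "inj_on g {0<..<1}"
  proof (rule inj_onI)
    fix s t :: real assume *: "s \<in> {0<..<1}" "t \<in> {0<..<1}" "g s = g t"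
    hence "s / (1 - s) = t / (1 - t)" by (simp add: g_def powr_half_sqrt)
    thus "s = t" using * by (simp add: field_simps)
  qed
  have eq: "\<bar>g' t\<bar> * ?f (g t) = 1/2 * ?B t" if t: "t \<in> {0<..<1}" for t
  proof -
    have "(g t)\<^sup>2 = t / (1 - t)" using t by (simp add: g_def powr_half_sqrt)
    hence 1: "1 + (g t)\<^sup>2 = 1 / (1 - t)" using t by (simp add: field_simps)
    have 2: "\<bar>g' t\<bar> = g' t" using t by (simp add: g'_def)
    have 3: "g t powr (a - 1) = (t / (1 - t)) powr (1/2 * (a - 1))" by (simp add: g_def powr_powr)
    have 4: "(1 - t) powr (-1) = 1 / (1 - t)" using t by (simp add: powr_minus divide_inverse)
    have alg: "1/2 * U * (1 / d\<^sup>2) * (V / (1 / d)) = 1/2 * (U * V) * (1 / d)" if "d \<noteq> 0" for U V d :: real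
      using that by (simp add: power2_eq_square)
    have "\<bar>g' t\<bar> * ?f (g t) =
        1/2 * ((t / (1 - t)) powr (1/2 - 1) * (t / (1 - t)) powr (1/2 * (a - 1))) * (1 - t) powr (-1)"
      unfolding 1 2 3 4 unfolding g'_def by (rule alg) (use t in simp)
    also have "(t / (1 - t)) powr (1/2 - 1) * (t / (1 - t)) powr (1/2 * (a - 1)) =
        (t / (1 - t)) powr (a / 2 - 1)"
    proof -
      have "1/2 - 1 + 1/2 * (a - 1) = a / 2 - 1" by (simp add: field_simps)
      thus ?thesis by (metis powr_add)
    qed
    also have "\<dots> = t powr (a / 2 - 1) * (1 - t) powr (1 - a / 2)"
    proof -
      have "(1 - t) powr (1 - a / 2) = inverse ((1 - t) powr (a / 2 - 1))"
        using powr_minus[of "1 - t" "a / 2 - 1"] by simp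
      moreover have "(t / (1 - t)) powr (a / 2 - 1) = t powr (a / 2 - 1) / (1 - t) powr (a / 2 - 1)"
        by (rule powr_divide)
      ultimately show ?thesis by (simp only: divide_inverse)
    qed
    also have "1/2 * (t powr (a / 2 - 1) * (1 - t) powr (1 - a / 2)) * (1 - t) powr (-1) = 1/2 * ?B t"
    proof -
      have "1 - a / 2 - 1 = (1 - a / 2) + (-1)" by simp
      thus ?thesis by (simp only: powr_add mult.assoc)
    qed
    finally show ?thesis .
  qed
  have "(?B has_integral Beta (a/2) (1 - a/2)) {0..1}"
    by (rule has_integral_Beta_real) (use a in auto)
  hence "(?B has_integral Beta (a/2) (1 - a/2)) {0<..<1}"
    by (simp add: has_integral_Icc_iff_Ioo)
  hence "((\<lambda>t. 1/2 * ?B t) has_integral 1/2 * Beta (a/2) (1 - a/2)) {0<..<1}"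
    by (rule has_integral_mult_right)
  also have "Beta (a/2) (1 - a/2) = pi / sin (pi * (a / 2))"
    using Gamma_reflection_real[of "a/2"] by (simp add: Beta_def)
  finally have "((\<lambda>t. 1/2 * ?B t) has_integral 1/2 * (pi / sin (pi * (a / 2)))) {0<..<1}" .
  hence int: "((\<lambda>t. \<bar>g' t\<bar> * ?f (g t)) has_integral 1/2 * (pi / sin (pi * (a / 2)))) {0<..<1}"
    by (rule has_integral_eq[rotated]) (simp only: eq)
  have "(\<lambda>t. \<bar>g' t\<bar> * ?f (g t)) absolutely_integrable_on {0<..<1} \<and>
        integral {0<..<1} (\<lambda>t. \<bar>g' t\<bar> * ?f (g t)) = 1/2 * (pi / sin (pi * (a / 2)))"
    using int by (auto simp: has_integral_iff intro!: nonnegative_absolutely_integrable_1)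
  moreover have "(g has_field_derivative g' t) (at t within {0<..<1})" if "t \<in> {0<..<1}" for t
    unfolding g_def g'_def using that
    by (auto intro!: derivative_eq_intros simp: field_simps power2_eq_square)
  ultimately have "?f absolutely_integrable_on (g ` {0<..<1}) \<and> integral (g ` {0<..<1}) ?f = 1/2 * (pi / sin (pi * (a / 2)))"
    using has_absolute_integral_change_of_variables_1'[of "{0<..<1}" g g' ?f, OF _ _ inj] by auto
  thus ?thesis by (simp add: img)
qed

lemma absolutely_integrable_integral_cong:
  fixes f g :: "real \<Rightarrow> real"
  assumes "\<And>x. x \<in> S \<Longrightarrow> f x = g x"
    and "f absolutely_integrable_on S \<and> integral S f = I"
  shows "g absolutely_integrable_on S \<and> integral S g = I"
  using assms set_integrable_cong[of lebesgue lebesgue S S f g] integral_cong[of S f g] by auto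

lemma absolutely_integrable_scale:
  fixes f :: "real \<Rightarrow> real"
  assumes c: "c > 0"
    and f: "f absolutely_integrable_on {0<..} \<and> integral {0<..} f = I"
  shows "(\<lambda>x. f (x / c)) absolutely_integrable_on {0<..} \<and> integral {0<..} (\<lambda>x. f (x / c)) = c * I"
proof -
  have img: "(\<lambda>x. c * x) ` {0<..} = {0<..}"
  proof safe
    fix x :: real assume "0 < x"
    hence "x = c * (x / c)" "x / c \<in> {0<..}" using c by auto
    thus "x \<in> (\<lambda>x. c * x) ` {0<..}" by blast
  qed (use c in auto)
  have "(\<lambda>x. c * f x) absolutely_integrable_on {0<..} \<and> integral {0<..} (\<lambda>x. c * f x) = c * I"
    using f by auto
  hence *: "(\<lambda>x. \<bar>c\<bar> * f (c * x / c)) absolutely_integrable_on {0<..} \<and>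
         integral {0<..} (\<lambda>x. \<bar>c\<bar> * f (c * x / c)) = c * I" using c by simp
  have "(\<lambda>x. \<bar>c\<bar> * f (c * x / c)) absolutely_integrable_on {0<..} \<and>
         integral {0<..} (\<lambda>x. \<bar>c\<bar> * f (c * x / c)) = c * I \<longleftrightarrow>
       (\<lambda>x. f (x / c)) absolutely_integrable_on (\<lambda>x. c * x) ` {0<..} \<and>
          integral ((\<lambda>x. c * x) ` {0<..}) (\<lambda>x. f (x / c)) = c * I"
    by (rule has_absolute_integral_change_of_variables_1')
       (use c in \<open>auto intro!: derivative_eq_intros inj_onI\<close>)
  with * have "(\<lambda>x. f (x / c)) absolutely_integrable_on (\<lambda>x. c * x) ` {0<..} \<and>
          integral ((\<lambda>x. c * x) ` {0<..}) (\<lambda>x. f (x / c)) = c * I" by blast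
  thus ?thesis by (simp add: img)
qed

lemma powr_over_sum_squares:
  assumes a: "0 < a" "a < (2::real)" and y: "y > 0"
  shows "(\<lambda>x. x powr (a - 1) / (x\<^sup>2 + y\<^sup>2)) absolutely_integrable_on {0<..} \<and>
         integral {0<..} (\<lambda>x. x powr (a - 1) / (x\<^sup>2 + y\<^sup>2)) = y powr (a - 2) * (pi / (2 * sin (pi * a / 2)))"
proof -
  define f where "f = (\<lambda>x::real. y powr (a - 3) * (x powr (a - 1) / (1 + x\<^sup>2)))"
  define I where "I = pi / (2 * sin (pi * a / 2))"
  have "f absolutely_integrable_on {0<..} \<and> integral {0<..} f = y powr (a - 3) * I"
    unfolding f_def I_def using powr_over_one_plus_square[OF a]
    using y by (simp only: integral_mult_right) (simp del: times_divide_eq_right)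
  from absolutely_integrable_scale[OF y this]
  have base: "(\<lambda>x. f (x / y)) absolutely_integrable_on {0<..} \<and>
        integral {0<..} (\<lambda>x. f (x / y)) = y powr (a - 2) * I"
    using y by (simp add: powr_diff powr_numeral field_simps power3_eq_cube power2_eq_square)
  have eq: "f (x / y) = x powr (a - 1) / (x\<^sup>2 + y\<^sup>2)" if "x \<in> {0<..}" for x
  proof -
    have "y powr (a - 3) = y powr (a - 1) / y\<^sup>2"
      using y powr_diff[of y "a - 1" 2] by (simp add: powr_numeral)
    moreover have "1 + (x / y)\<^sup>2 = (x\<^sup>2 + y\<^sup>2) / y\<^sup>2" using y by (simp add: field_simps)
    ultimately show ?thesis using that y by (simp add: f_def powr_divide)
  qed
  show ?thesis
    using absolutely_integrable_integral_cong[OF eq base] unfolding I_def .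
qed

lemma powr_times_exp:
  assumes s: "0 < (s::real)" and c: "c > 0"
  shows "(\<lambda>x. x powr (s - 1) * exp (-(c * x))) absolutely_integrable_on {0<..} \<and>
         integral {0<..} (\<lambda>x. x powr (s - 1) * exp (-(c * x))) = Gamma s * c powr (-s)"
proof -
  define f where "f = (\<lambda>x::real. c powr (1 - s) * (x powr (s - 1) / exp x))"
  have "((\<lambda>x. x powr (s - 1) / exp x) has_integral Gamma s) {0<..}"
    by (rule has_integral_spike_set_eq[THEN iffD1, OF _ _ Gamma_integral_real[OF s]])
       (auto intro: negligible_subset[of "{0}"])
  hence "(\<lambda>x. x powr (s - 1) / exp x) absolutely_integrable_on {0<..} \<and>
      integral {0<..} (\<lambda>x. x powr (s - 1) / exp x) = Gamma s"
    by (auto simp: has_integral_iff intro!: nonnegative_absolutely_integrable_1)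
  hence "f absolutely_integrable_on {0<..} \<and> integral {0<..} f = c powr (1 - s) * Gamma s"
    unfolding f_def using c by (simp only: integral_mult_right) (simp del: times_divide_eq_right)
  from absolutely_integrable_scale[of "1 / c", OF _ this] c
  have base: "(\<lambda>x. f (c * x)) absolutely_integrable_on {0<..} \<and>
        integral {0<..} (\<lambda>x. f (c * x)) = Gamma s * c powr (-s)"
    by (simp add: powr_diff powr_minus field_simps mult.commute)
  have eq: "f (c * x) = x powr (s - 1) * exp (-(c * x))" if "x \<in> {0<..}" for x
    using that c by (simp add: f_def powr_mult exp_minus powr_diff field_simps)
  show ?thesis
    using absolutely_integrable_integral_cong[OF eq base] .
qed

text \<open>The term at 0 needs only integrability. In both applications the majorant
  \<open>B 0\<close> fails to be integrable, at infinity in one case and at 0 in the other, so the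
  majorants start at 1.\<close>

lemma sums_integral_dominated:
  fixes f :: "nat \<Rightarrow> real \<Rightarrow> complex" and B :: "nat \<Rightarrow> real \<Rightarrow> real"
  assumes f: "\<And>m. f m absolutely_integrable_on {0<..}"
    and B: "\<And>m. m > 0 \<Longrightarrow> B m absolutely_integrable_on {0<..} \<and> integral {0<..} (B m) = I m"
    and le: "\<And>m x. m > 0 \<Longrightarrow> x > 0 \<Longrightarrow> norm (f m x) \<le> B m x"
    and ptw: "\<And>x. x > 0 \<Longrightarrow> summable (\<lambda>m. B m x)"
    and I: "summable I"
  shows "(\<lambda>m. integral {0<..} (f m)) sums integral {0<..} (\<lambda>x. \<Sum>m. f m x)"
proof -
  let ?M = "lebesgue_on {0::real<..}"
  have S: "{0::real<..} \<in> sets lebesgue" by simp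
  have intf: "integrable ?M (f m)" for m using f by (simp add: set_integrable_def integrable_restrict_space)
  have AE: "AE x in ?M. summable (\<lambda>m. norm (f m x))"
  proof (rule AE_I2)
    fix x assume "x \<in> space ?M"
    hence x: "x > 0" by (simp add: space_restrict_space)
    show "summable (\<lambda>m. norm (f m x))"
      by (rule summable_comparison_test'[OF ptw[OF x], of 1]) (use le x in auto)
  qed
  have sumI: "summable (\<lambda>m. \<integral>x. norm (f m x) \<partial>?M)"
  proof (rule summable_comparison_test'[OF I, of 1])
    fix m :: nat assume m: "m \<ge> 1"
    have intB: "integrable ?M (B m)" using B[of m] m by (simp add: set_integrable_def integrable_restrict_space)
    have "(\<integral>x. norm (f m x) \<partial>?M) \<le> (\<integral>x. B m x \<partial>?M)"
      using intf intB le m by (intro integral_mono) (auto simp: space_restrict_space)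
    also have "\<dots> = I m" using B[of m] m lebesgue_integral_eq_integral[OF intB S] by simp
    finally show "norm (\<integral>x. norm (f m x) \<partial>?M) \<le> I m" by simp
  qed
  have "(\<lambda>m. \<integral>x. f m x \<partial>?M) sums (\<integral>x. (\<Sum>m. f m x) \<partial>?M)"
    by (rule sums_integral[OF intf AE sumI])
  moreover have "(\<integral>x. f m x \<partial>?M) = integral {0<..} (f m)" for m
    by (rule lebesgue_integral_eq_integral[OF intf S])
  moreover have "(\<integral>x. (\<Sum>m. f m x) \<partial>?M) = integral {0<..} (\<lambda>x. \<Sum>m. f m x)"
    by (rule lebesgue_integral_eq_integral[OF integrable_suminf[OF intf AE sumI] S])
  ultimately show ?thesis by simp
qed

section \<open>Partial fractions of the cotangent\<close>

text \<open>The product \<open>Gamma z * Gamma (1 - z) * sin (pi z)\<close> is constant on the open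
  set of non-integers; its derivative is therefore zero, and dividing by the Gamma values gives the
  formula.\<close>

lemma Digamma_reflection_complex:
  fixes z :: complex
  assumes z: "z \<notin> \<int>"
  shows "Digamma (1 - z) - Digamma z = of_real pi * cos (of_real pi * z) / sin (of_real pi * z)"
proof -
  have z': "z \<notin> \<int>\<^sub>\<le>\<^sub>0" "1 - z \<notin> \<int>\<^sub>\<le>\<^sub>0"
    using z nonpos_Ints_Int Ints_diff[of 1 "1 - z"] by auto
  have sin: "sin (of_real pi * z) \<noteq> 0" using z by (auto simp: sin_eq_0)
  let ?f = "\<lambda>z::complex. Gamma z * Gamma (1 - z) * sin (of_real pi * z)"
  have "?f w = of_real pi" if "w \<notin> \<int>" for w
  proof -
    have "sin (of_real pi * w) \<noteq> 0" using that by (auto simp: sin_eq_0)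
    thus ?thesis by (simp add: Gamma_reflection_complex)
  qed
  hence ev: "eventually (\<lambda>w. ?f w = of_real pi) (nhds z)"
    unfolding eventually_nhds
    using z closed_Ints[where ?'a = complex] by (intro exI[of _ "- \<int>"]) auto
  have "((\<lambda>w. of_real pi) has_field_derivative 0) (at z)" by simp
  hence "(?f has_field_derivative 0) (at z)"
    by (subst DERIV_cong_ev[OF refl ev refl])
  moreover have "(?f has_field_derivative
     (Gamma z * Digamma z * Gamma (1 - z) - Gamma z * (Gamma (1 - z) * Digamma (1 - z))) * sin (of_real pi * z)
      + Gamma z * Gamma (1 - z) * (of_real pi * cos (of_real pi * z))) (at z)"
    using z' by (auto intro!: derivative_eq_intros simp: algebra_simps)
  ultimately have "(Gamma z * Digamma z * Gamma (1 - z) - Gamma z * (Gamma (1 - z) * Digamma (1 - z))) * sin (of_real pi * z)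
      + Gamma z * Gamma (1 - z) * (of_real pi * cos (of_real pi * z)) = 0"
    by (rule DERIV_unique[symmetric])
  hence "Gamma z * Gamma (1 - z) * ((Digamma z - Digamma (1 - z)) * sin (of_real pi * z) + of_real pi * cos (of_real pi * z)) = 0"
    by (simp add: algebra_simps)
  moreover have "Gamma z \<noteq> 0" "Gamma (1 - z) \<noteq> 0" using z' by (simp_all add: Gamma_eq_zero_iff)
  ultimately have "(Digamma z - Digamma (1 - z)) * sin (of_real pi * z) + of_real pi * cos (of_real pi * z) = 0"
    by simp
  thus ?thesis using sin by (simp add: field_simps)
qed

text \<open>In the difference of the limit formulas for \<open>Digamma (1 - z)\<close> and
  \<open>Digamma z\<close> the logarithms cancel.\<close>

lemma cot_sums_complex:
  fixes z :: complex
  assumes z: "z \<notin> \<int>"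
  shows "(\<lambda>k. 1 / (z + of_nat k) - 1 / (1 - z + of_nat k)) sums
           (of_real pi * cos (of_real pi * z) / sin (of_real pi * z))"
proof -
  have "z \<noteq> 0" "1 - z \<noteq> 0" using z by auto
  from tendsto_diff[OF Digamma_LIMSEQ[OF this(2)] Digamma_LIMSEQ[OF this(1)]]
  show ?thesis unfolding Digamma_reflection_complex[OF z] sums_def
    by (simp add: sum_subtractf inverse_eq_divide)
qed

text \<open>As a function of \<open>x\<close> the right-hand side is a cotangent on a rotated axis.
  The poles are paired as in the expansion of the cotangent, which is what makes the series
  converge.\<close>

lemma geometric_inverse_sums:
  fixes x c :: real
  assumes x: "x > 0"
  shows "(\<lambda>k. 1 / (of_real x - 2 * of_real pi * \<i> * (of_real c + of_nat k)) +
              1 / (of_real x + 2 * of_real pi * \<i> * (1 - of_real c + of_nat k))) sums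
         (1 / (1 - exp (-of_real x) * cis (2 * pi * c)) - 1 / 2)"
proof -
  \<comment> \<open>Chosen so that \<open>exp (2 pi i w)\<close> equals
    \<open>exp (-x) * cis (2 pi c)\<close>; its nonzero imaginary part keeps it away from the
    integers.\<close>
  define w where "w = of_real c + \<i> * of_real x / (2 * of_real pi)"
  define E where "E = exp (2 * of_real pi * \<i> * w)"
  have "Im w \<noteq> 0" using x by (simp add: w_def)
  hence w: "w \<notin> \<int>" by (metis Ints_cases complex_Im_of_int)
  have E: "E = exp (-of_real x) * cis (2 * pi * c)"
    by (simp add: E_def w_def cis_conv_exp algebra_simps flip: exp_add)
  have "norm E = exp (-x)" unfolding E by (simp add: norm_mult flip: of_real_minus)
  hence "E \<noteq> 1" using x by auto
  define e where "e = exp (\<i> * (of_real pi * w))"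
  have E2: "E = e ^ 2" by (simp add: E_def e_def algebra_simps flip: exp_of_nat_mult exp_double)
  have "exp (- (\<i> * (of_real pi * w))) = 1 / e" by (simp add: e_def exp_minus inverse_eq_divide)
  hence cs: "cos (of_real pi * w) = (e + 1 / e) / 2" "sin (of_real pi * w) = (e - 1 / e) / (2 * \<i>)"
    by (simp_all add: cos_exp_eq sin_exp_eq e_def)
  have en: "e \<noteq> 0" by (simp add: e_def)
  have ne: "e - 1 / e \<noteq> 0" using \<open>E \<noteq> 1\<close> en by (auto simp: E2 field_simps power2_eq_square)
  have val: "\<i> / (2 * of_real pi) * (of_real pi * cos (of_real pi * w) / sin (of_real pi * w)) = 1 / (1 - E) - 1 / 2"
  proof -
    have X: "\<i> / (2 * of_real pi) * (of_real pi * (\<i> * X)) = - X / 2" for X by simp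
    have "cos (of_real pi * w) / sin (of_real pi * w) = \<i> * ((e + 1 / e) / (e - 1 / e))"
      unfolding cs using ne by (simp add: divide_simps) (simp add: algebra_simps)?
    also have "(e + 1 / e) / (e - 1 / e) = (E + 1) / (E - 1)"
      using en ne \<open>E \<noteq> 1\<close> by (simp add: E2 field_simps power2_eq_square)
    finally have "\<i> / (2 * of_real pi) * (of_real pi * (cos (of_real pi * w) / sin (of_real pi * w))) = - ((E + 1) / (E - 1)) / 2"
      by (simp only: X)
    also have "\<dots> = 1 / (1 - E) - 1 / 2" using \<open>E \<noteq> 1\<close> by (simp add: field_simps)
    finally show ?thesis by simp
  qed
  have "(\<lambda>k. \<i> / (2 * of_real pi) * (1 / (w + of_nat k) - 1 / (1 - w + of_nat k))) sums (1 / (1 - E) - 1 / 2)"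
    using sums_mult[OF cot_sums_complex[OF w], of "\<i> / (2 * of_real pi)"] unfolding val .
  moreover have "\<i> / (2 * of_real pi) * (1 / (w + of_nat k) - 1 / (1 - w + of_nat k)) =
     1 / (of_real x - 2 * of_real pi * \<i> * (of_real c + of_nat k)) +
              1 / (of_real x + 2 * of_real pi * \<i> * (1 - of_real c + of_nat k))" for k
  proof -
    have 1: "of_real x - 2 * of_real pi * \<i> * (of_real c + of_nat k) = (w + of_nat k) * (2 * of_real pi / \<i>)"
      by (simp add: w_def field_simps)
    have 2: "of_real x + 2 * of_real pi * \<i> * (1 - of_real c + of_nat k) = - (1 - w + of_nat k) * (2 * of_real pi / \<i>)"
      by (simp add: w_def field_simps)
    have "1 / (A * (2 * of_real pi / \<i>)) = \<i> / (2 * of_real pi) * (1 / A)" for A by (cases "A = 0") (simp_all add: field_simps)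
    from this[of "w + of_nat k"] this[of "- (1 - w + of_nat k)"] show ?thesis
      unfolding 1 2 right_diff_distrib by (simp only: divide_minus_right mult_minus_right diff_conv_add_uminus)
  qed
  ultimately show ?thesis by (simp add: E)
qed

text \<open>The real part (\<open>\<kappa> = 0\<close>) or the imaginary part
  (\<open>\<kappa> = 1\<close>) of \<open>1 / (x - i y)\<close>. The parity of the character decides
  which of them survives when the poles at \<open>i y\<close> and \<open>- i y\<close> are
  combined.\<close>

definition cauchy_kernel :: "nat \<Rightarrow> real \<Rightarrow> real \<Rightarrow> real" where
  "cauchy_kernel \<kappa> x y = (if \<kappa> = 0 then x else y) / (x\<^sup>2 + y\<^sup>2)"

lemma cauchy_kernel_eq:
  assumes "\<kappa> \<in> {0, 1}" "x > 0"
  shows "1 / (complex_of_real x - \<i> * of_real y) + (-1) ^ \<kappa> / (of_real x + \<i> * of_real y) =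
         2 * \<i> ^ \<kappa> * of_real (cauchy_kernel \<kappa> x y)"
proof -
  let ?A = "complex_of_real x - \<i> * of_real y" and ?B = "complex_of_real x + \<i> * of_real y"
  have nz: "?A \<noteq> 0" "?B \<noteq> 0" using assms(2) by (auto simp: complex_eq_iff)
  have AB: "?A * ?B = of_real (x\<^sup>2 + y\<^sup>2)"
    by (simp add: algebra_simps power2_eq_square)
  have "1 / ?A + (-1) ^ \<kappa> / ?B = (?B + (-1) ^ \<kappa> * ?A) / (?A * ?B)"
    using nz by (simp add: field_simps)
  also have "?B + (-1) ^ \<kappa> * ?A = 2 * \<i> ^ \<kappa> * of_real (if \<kappa> = 0 then x else y)"
    using assms(1) by auto
  finally show ?thesis unfolding AB by (simp add: cauchy_kernel_def)
qed

text \<open>Both parities are handled together: the kernel is a component of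
  \<open>1 / (x - i y)\<close>, and a difference of two such reciprocals is
  \<open>i (y - y0)\<close> divided by the product of their denominators.\<close>

lemma cauchy_kernel_diff_le:
  assumes x: "x > 0" and y: "0 < y0" "y0 \<le> y"
  shows "\<bar>cauchy_kernel \<kappa> x y - cauchy_kernel \<kappa> x y0\<bar> \<le> (y - y0) / (x\<^sup>2 + y0\<^sup>2)"
proof -
  let ?c = "\<lambda>y. 1 / (complex_of_real x - \<i> * of_real y)"
  have nz: "complex_of_real x - \<i> * of_real y \<noteq> 0" for y using x by (auto simp: complex_eq_iff)
  have nrm: "cmod (complex_of_real x - \<i> * of_real y) = sqrt (x\<^sup>2 + y\<^sup>2)" for y
    by (simp add: cmod_def)
  have "?c y = Complex (x / (x\<^sup>2 + y\<^sup>2)) (y / (x\<^sup>2 + y\<^sup>2))" for y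
    by (simp add: complex_eq_iff Re_divide Im_divide)
  hence "\<bar>cauchy_kernel \<kappa> x y - cauchy_kernel \<kappa> x y0\<bar> \<le> cmod (?c y - ?c y0)"
    using abs_Re_le_cmod[of "?c y - ?c y0"] abs_Im_le_cmod[of "?c y - ?c y0"]
    by (simp add: cauchy_kernel_def)
  also have "?c y - ?c y0 = \<i> * of_real (y - y0) / ((of_real x - \<i> * of_real y) * (of_real x - \<i> * of_real y0))"
  proof -
    have "?c y - ?c y0 = ((of_real x - \<i> * of_real y0) - (of_real x - \<i> * of_real y)) /
        ((of_real x - \<i> * of_real y) * (of_real x - \<i> * of_real y0))"
      using diff_frac_eq[OF nz[of y] nz[of y0], of 1 1] by (simp only: mult_1)
    moreover have "(of_real x - \<i> * of_real y0) - (of_real x - \<i> * of_real y) = \<i> * of_real (y - y0)"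
      by (simp add: right_diff_distrib)
    ultimately show ?thesis by (simp only:)
  qed
  also have "cmod \<dots> = (y - y0) / (sqrt (x\<^sup>2 + y\<^sup>2) * sqrt (x\<^sup>2 + y0\<^sup>2))"
    using y by (simp add: norm_divide norm_mult nrm del: of_real_diff)
  also have "\<dots> \<le> (y - y0) / (sqrt (x\<^sup>2 + y0\<^sup>2) * sqrt (x\<^sup>2 + y0\<^sup>2))"
    using y x by (intro divide_left_mono mult_mono real_sqrt_le_mono add_mono power_mono mult_pos_pos)
      (auto simp: add_pos_pos)
  also have "sqrt (x\<^sup>2 + y0\<^sup>2) * sqrt (x\<^sup>2 + y0\<^sup>2) = x\<^sup>2 + y0\<^sup>2" by simp
  finally show ?thesis .
qed

lemma cauchy_kernel_integral:
  assumes s: "0 < s" "s < (1::real)" and y: "y > 0" and kap: "\<kappa> \<in> {0, 1}"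
  shows "(\<lambda>x. x powr (s - 1) * cauchy_kernel \<kappa> x y) absolutely_integrable_on {0<..} \<and>
         integral {0<..} (\<lambda>x. x powr (s - 1) * cauchy_kernel \<kappa> x y) =
           y powr (s - 1) * (pi / (2 * sin (pi * (s + 1 - real \<kappa>) / 2)))"
proof -
  \<comment> \<open>For even characters the numerator of the kernel is \<open>x\<close>, which
    raises the exponent by one; for odd ones it is the constant \<open>y\<close>. The range of
    \<open>s\<close> keeps \<open>a\<close> in (0, 2) in both cases.\<close>
  define a where "a = s + 1 - real \<kappa>"
  have a: "0 < a" "a < 2" using s kap by (auto simp: a_def)
  have base: "(\<lambda>x. y ^ \<kappa> * (x powr (a - 1) / (x\<^sup>2 + y\<^sup>2))) absolutely_integrable_on {0<..} \<and>
        integral {0<..} (\<lambda>x. y ^ \<kappa> * (x powr (a - 1) / (x\<^sup>2 + y\<^sup>2))) =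
          y ^ \<kappa> * (y powr (a - 2) * (pi / (2 * sin (pi * a / 2))))"
    using powr_over_sum_squares[OF a y] y
    by (simp only: integral_mult_right) (simp del: times_divide_eq_right)
  have eq: "y ^ \<kappa> * (x powr (a - 1) / (x\<^sup>2 + y\<^sup>2)) = x powr (s - 1) * cauchy_kernel \<kappa> x y"
    if "x \<in> {0<..}" for x
    using kap that by (auto simp: a_def cauchy_kernel_def powr_diff)
  have "y ^ \<kappa> * (y powr (a - 2) * M) = y powr (s - 1) * M" for M
    using kap y by (auto simp: a_def powr_diff power2_eq_square)
  thus ?thesis
    using absolutely_integrable_integral_cong[OF eq base] by (simp add: a_def)
qed

text \<open>Primitivity enters through the separability of the Gauss sums. The sum over \<open>k\<close> is the
  partial fraction expansion of the cotangent, with the poles \<open>k + b/q\<close> and \<open>-(k + 1 - b/q)\<close> paired.\<close>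

lemma character_generating_function_sums:
  assumes q: "q > 1" and prim: "primitive_character q chi" and kap: "\<kappa> \<in> {0, 1}"
    and sgn: "chi (-1) = (-1) ^ \<kappa>" and x: "x > 0"
  defines "psi \<equiv> (\<lambda>a. cnj (chi a))"
  shows "(\<lambda>k. \<Sum>b\<in>{1..<q}. psi (int b) * (2 * \<i> ^ \<kappa> * of_real (cauchy_kernel \<kappa> x (2 * pi * real (k * q + b) / real q))))
          sums (gauss_sum q psi 1 * ((\<Sum>a\<in>{1..<q}. chi (int a) * of_real (exp (-(real a * x)))) / of_real (1 - exp (-(real q * x)))))"
proof -
  have primp: "primitive_character q psi" unfolding psi_def by (rule primitive_character_cnj[OF prim])
  have chi: "dirichlet_character q chi" using prim by (simp add: primitive_character_def)
  have psi: "dirichlet_character q psi" using primp by (simp add: primitive_character_def)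
  have psi0: "(\<Sum>b\<in>{1..<q}. psi (int b)) = 0"
    using sum_dirichlet_character_eq_0[OF psi primitive_character_imp_nontrivial[OF q primp]]
      sum_dirichlet_character_atLeast1[OF psi q, of "\<lambda>_. 1"] by simp
  define w where "w b = exp (- of_real x) * cis (2 * pi * (real b / real q))" for b
  let ?P = "\<lambda>k b. 1 / (of_real x - 2 * of_real pi * \<i> * (of_real (real b / real q) + of_nat k)) :: complex"
  let ?Q = "\<lambda>k b. 1 / (of_real x + 2 * of_real pi * \<i> * (1 - of_real (real b / real q) + of_nat k)) :: complex"
  let ?R = "\<lambda>k b. 1 / (of_real x + 2 * of_real pi * \<i> * (of_real (real b / real q) + of_nat k)) :: complex"
  have "(\<lambda>k. \<Sum>b\<in>{1..<q}. psi (int b) * (?P k b + ?Q k b)) sums (\<Sum>b\<in>{1..<q}. psi (int b) * (1 / (1 - w b) - 1 / 2))"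
    unfolding w_def by (intro sums_sum sums_mult geometric_inverse_sums x)
  \<comment> \<open>The constant 1/2 drops out because the values of \<open>psi\<close> sum to
    zero.\<close>
  also have "(\<Sum>b\<in>{1..<q}. psi (int b) * (1 / (1 - w b) - 1 / 2)) = (\<Sum>b<q. psi (int b) * (1 / (1 - w b)))"
    using psi0 sum_dirichlet_character_atLeast1[OF psi q, of "\<lambda>b. 1 / (1 - w b)"]
    by (simp add: right_diff_distrib sum_subtractf flip: sum_divide_distrib sum_distrib_right)
  also have "\<dots> = (\<Sum>b<q. psi (int b) * ((\<Sum>a<q. of_real (exp (-(real a * x))) * unit_root q (int a * int b)) / of_real (1 - exp (-(real q * x)))))"
  proof (intro sum.cong refl arg_cong2[of _ _ _ _ "(*)"])
    fix b
    have wa: "w b ^ a = of_real (exp (-(real a * x))) * unit_root q (int a * int b)" for a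
    proof -
      have "w b = of_real (exp (-x)) * unit_root q (int b)"
        by (simp add: w_def unit_root_def exp_of_real[symmetric])
      moreover have "exp (-x) ^ a = exp (-(real a * x))" by (simp flip: exp_of_nat_mult)
      ultimately show ?thesis
        by (simp add: power_mult_distrib unit_root_mult_nat mult.commute[of "int a"] flip: of_real_power)
    qed
    have "unit_root q (int q * int b) = 1" using q by (subst unit_root_eq_1_iff) auto
    hence wq: "w b ^ q = of_real (exp (-(real q * x)))" using wa[of q] by simp
    have "norm (w b) = exp (-x)" by (simp add: w_def norm_mult flip: of_real_minus)
    hence w1: "w b \<noteq> 1" using x by auto
    \<comment> \<open>A full period of the geometric series: the denominator
      \<open>1 - w b ^ q\<close> no longer depends on \<open>b\<close>, so only Gauss sums are left
      in the numerator.\<close>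
    have "(\<Sum>a<q. w b ^ a) = (1 - w b ^ q) / (1 - w b)" using w1 by (simp add: sum_gp_strict)
    moreover have "exp (-(real q * x)) \<noteq> 1" using q x by simp
    hence "1 - w b ^ q \<noteq> 0" unfolding wq by (simp add: of_real_eq_1_iff)
    ultimately have "1 / (1 - w b) = (\<Sum>a<q. w b ^ a) / (1 - w b ^ q)" by simp
    thus "1 / (1 - w b) = (\<Sum>a<q. of_real (exp (-(real a * x))) * unit_root q (int a * int b)) / of_real (1 - exp (-(real q * x)))"
      unfolding wq by (simp add: wa)
  qed
  also have "\<dots> = (\<Sum>b<q. \<Sum>a<q. of_real (exp (-(real a * x))) * (psi (int b) * unit_root q (int a * int b))) / of_real (1 - exp (-(real q * x)))"
    by (simp add: sum_divide_distrib sum_distrib_left mult_ac)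
  also have "(\<Sum>b<q. \<Sum>a<q. of_real (exp (-(real a * x))) * (psi (int b) * unit_root q (int a * int b))) =
      (\<Sum>a<q. of_real (exp (-(real a * x))) * gauss_sum q psi (int a))"
    unfolding gauss_sum_def sum_distrib_left by (rule sum.swap)
  also have "\<dots> = (\<Sum>a<q. chi (int a) * (of_real (exp (-(real a * x))) * gauss_sum q psi 1))"
    by (subst gauss_sum_primitive[OF primp]) (simp add: psi_def mult_ac)
  also have "\<dots> = gauss_sum q psi 1 * (\<Sum>a\<in>{1..<q}. chi (int a) * of_real (exp (-(real a * x))))"
    unfolding sum_dirichlet_character_atLeast1[OF chi q, symmetric]
    by (simp add: sum_distrib_left mult_ac)
  finally have sums: "(\<lambda>k. \<Sum>b\<in>{1..<q}. psi (int b) * (?P k b + ?Q k b)) sums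
     (gauss_sum q psi 1 * ((\<Sum>a\<in>{1..<q}. chi (int a) * of_real (exp (-(real a * x)))) / of_real (1 - exp (-(real q * x)))))"
    by simp
  have eq: "(\<Sum>b\<in>{1..<q}. psi (int b) * (?P k b + ?Q k b)) =
     (\<Sum>b\<in>{1..<q}. psi (int b) * (2 * \<i> ^ \<kappa> * of_real (cauchy_kernel \<kappa> x (2 * pi * real (k * q + b) / real q))))" for k
  proof -
    \<comment> \<open>Replacing \<open>b\<close> by \<open>q - b\<close> turns the poles of
      \<open>?Q\<close> into the mirror images of those of \<open>?P\<close>, at the cost of the
      sign \<open>psi (-1)\<close>.\<close>
    have "(\<Sum>b\<in>{1..<q}. psi (int b) * ?Q k b) = (\<Sum>b\<in>{1..<q}. psi (int (q - b)) * ?R k b)"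
      by (rule sum.reindex_bij_witness[of _ "\<lambda>b. q - b" "\<lambda>b. q - b"])
         (use q in \<open>auto simp: of_nat_diff diff_divide_distrib\<close>)
    also have "\<dots> = (\<Sum>b\<in>{1..<q}. psi (int b) * ((-1) ^ \<kappa> * ?R k b))"
    proof (intro sum.cong refl)
      fix b assume b: "b \<in> {1..<q}"
      have "[int (q - b) = (-1) * int b] (mod int q)"
        using b by (simp add: cong_iff_dvd_diff of_nat_diff)
      hence "psi (int (q - b)) = psi (-1) * psi (int b)"
        using dirichlet_character_cong[OF psi] dirichlet_character_mult[OF psi] by metis
      thus "psi (int (q - b)) * ?R k b = psi (int b) * ((-1) ^ \<kappa> * ?R k b)"
        by (simp add: psi_def sgn)
    qed
    finally have "(\<Sum>b\<in>{1..<q}. psi (int b) * (?P k b + ?Q k b)) =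
        (\<Sum>b\<in>{1..<q}. psi (int b) * (?P k b + (-1) ^ \<kappa> * ?R k b))"
      by (simp add: ring_distribs sum.distrib)
    moreover have "?P k b + (-1) ^ \<kappa> * ?R k b = 2 * \<i> ^ \<kappa> * of_real (cauchy_kernel \<kappa> x (2 * pi * real (k * q + b) / real q))" for b
    proof -
      have "2 * of_real pi * \<i> * (of_real (real b / real q) + of_nat k) = \<i> * of_real (2 * pi * real (k * q + b) / real q)"
        using q by (simp add: field_simps)
      thus ?thesis using cauchy_kernel_eq[OF kap x, of "2 * pi * real (k * q + b) / real q"] by simp
    qed
    ultimately show ?thesis by simp
  qed
  show ?thesis using sums unfolding eq .
qed

section \<open>The functional equation\<close>

lemma integral_sum_scaleR:
  fixes g :: "nat \<Rightarrow> real \<Rightarrow> real" and c :: "nat \<Rightarrow> complex"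
  assumes A: "finite A"
    and g: "\<And>a. a \<in> A \<Longrightarrow> g a absolutely_integrable_on S \<and> integral S (g a) = I a"
  shows "(\<lambda>x. \<Sum>a\<in>A. g a x *\<^sub>R c a) absolutely_integrable_on S \<and>
         integral S (\<lambda>x. \<Sum>a\<in>A. g a x *\<^sub>R c a) = (\<Sum>a\<in>A. I a *\<^sub>R c a)"
proof
  show "(\<lambda>x. \<Sum>a\<in>A. g a x *\<^sub>R c a) absolutely_integrable_on S"
    using g by (intro absolutely_integrable_sum[OF A] absolutely_integrable_scaleR_right) auto
  have "((\<lambda>x. \<Sum>a\<in>A. g a x *\<^sub>R c a) has_integral (\<Sum>a\<in>A. I a *\<^sub>R c a)) S"
  proof (intro has_integral_sum[OF A] has_integral_scaleR_left)
    fix a assume "a \<in> A"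
    thus "(g a has_integral I a) S"
      using g[of a] set_lebesgue_integral_eq_integral(1)[of S "g a"] by (auto simp: has_integral_iff)
  qed
  thus "integral S (\<lambda>x. \<Sum>a\<in>A. g a x *\<^sub>R c a) = (\<Sum>a\<in>A. I a *\<^sub>R c a)"
    by (rule integral_unique)
qed

text \<open>Termwise, the Mellin transform of \<open>exp (-n x)\<close> is
  \<open>Gamma s * n powr (-s)\<close>. Since the resulting series need not converge absolutely for
  small \<open>s\<close>, sum and integral are interchanged block by block.\<close>

lemma Gamma_times_L_half:
  assumes chi: "dirichlet_character q chi" and q: "q > 1" and sum0: "(\<Sum>b<q. chi (int b)) = 0"
    and s: "0 < (s::real)"
  shows "Gamma s *\<^sub>R L_half q chi s = integral {0<..} (\<lambda>x. of_real (x powr (s - 1)) *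
     ((\<Sum>a\<in>{1..<q}. chi (int a) * of_real (exp (-(real a * x)))) / of_real (1 - exp (-(real q * x)))))"
proof -
  define f where "f m x = (\<Sum>a\<in>{1..<q}. (x powr (s - 1) * exp (-(real (m * q + a) * x))) *\<^sub>R chi (int a))" for m x
  \<comment> \<open>Within a block, \<open>exp (-n x)\<close> differs from its value at the start by
    at most its total drop over the block, and there are fewer than \<open>q\<close> terms. Both
    these majorants and their integrals telescope.\<close>
  define B where "B m x = real q * (x powr (s - 1) * exp (-(real (m * q) * x)) -
      x powr (s - 1) * exp (-(real (Suc m * q) * x)))" for m x
  define I where "I m = real q * (Gamma s * real (m * q) powr (-s) - Gamma s * real (Suc m * q) powr (-s))" for m
  have int: "f m absolutely_integrable_on {0<..} \<and>
      integral {0<..} (f m) = (\<Sum>a\<in>{1..<q}. (Gamma s * real (m * q + a) powr (-s)) *\<^sub>R chi (int a))" for m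
    unfolding f_def by (intro integral_sum_scaleR powr_times_exp s) (auto intro!: add_nonneg_pos)
  have intL: "integral {0<..} (f m) = Gamma s *\<^sub>R L_block q chi s m" for m
  proof -
    have "complex_of_real (real (m * q + a) powr (-s)) = of_nat (m * q + a) powr (- of_real s)" for a
      by (subst powr_of_real[symmetric]) auto
    thus ?thesis using int[of m]
      by (simp add: L_block_def scaleR_conv_of_real sum_distrib_left mult_ac)
  qed
  have tel: "(\<lambda>m. real (m * q) powr (-s)) \<longlonglongrightarrow> 0"
  proof -
    have "filterlim (\<lambda>m. real (m * q)) at_top sequentially"
      using q by (simp add: filterlim_at_top_mult_tendsto_pos[OF tendsto_const] filterlim_real_sequentially)
    thus ?thesis using s by (intro tendsto_neg_powr) auto
  qed
  have sumI: "summable I"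
    unfolding I_def right_diff_distrib[symmetric]
    by (intro summable_mult telescope_summable'[OF tel])
  have BI: "B m absolutely_integrable_on {0<..} \<and> integral {0<..} (B m) = I m" if m: "m > 0" for m
  proof -
    let ?g = "\<lambda>m x. x powr (s - 1) * exp (-(real (m * q) * x))"
    have 1: "?g m absolutely_integrable_on {0<..} \<and> integral {0<..} (?g m) = Gamma s * real (m * q) powr (-s)"
      by (rule powr_times_exp[OF s]) (use m q in simp)
    have 2: "?g (Suc m) absolutely_integrable_on {0<..} \<and> integral {0<..} (?g (Suc m)) = Gamma s * real (Suc m * q) powr (-s)"
      by (rule powr_times_exp[OF s]) (use m q in \<open>simp del: of_nat_mult\<close>)
    have "(\<lambda>x. ?g m x - ?g (Suc m) x) absolutely_integrable_on {0<..}"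
      using 1 2 by (intro set_integral_diff(1)) auto
    moreover have "integral {0<..} (\<lambda>x. ?g m x - ?g (Suc m) x) = integral {0<..} (?g m) - integral {0<..} (?g (Suc m))"
      using 1 2 set_lebesgue_integral_eq_integral(1) by (intro integral_diff) blast+
    ultimately show ?thesis using 1 2 unfolding B_def I_def
      by (simp only: integral_mult_right) (simp del: of_nat_mult of_nat_Suc)
  qed
  have le: "norm (f m x) \<le> B m x" if m: "m > 0" and x: "x > 0" for m x
  proof -
    let ?e = "\<lambda>n. exp (-(real n * x))"
    have c0: "(\<Sum>a\<in>{1..<q}. chi (int a)) = 0"
      using sum_dirichlet_character_atLeast1[OF chi q, of "\<lambda>_. 1"] sum0 by simp
    have "f m x = x powr (s - 1) *\<^sub>R (\<Sum>a\<in>{1..<q}. ?e (m * q + a) *\<^sub>R chi (int a))"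
      by (simp add: f_def scaleR_sum_right)
    also have "(\<Sum>a\<in>{1..<q}. ?e (m * q + a) *\<^sub>R chi (int a)) = (\<Sum>a\<in>{1..<q}. (?e (m * q + a) - ?e (m * q)) *\<^sub>R chi (int a))"
      using c0 by (simp add: scaleR_diff_left sum_subtractf flip: scaleR_sum_right)
    also have "norm (x powr (s - 1) *\<^sub>R \<dots>) \<le> x powr (s - 1) * (\<Sum>a\<in>{1..<q}. ?e (m * q) - ?e (Suc m * q))"
      unfolding norm_scaleR
    proof (intro mult_mono sum_norm_le)
      fix a assume a: "a \<in> {1..<q}"
      have "norm ((?e (m * q + a) - ?e (m * q)) *\<^sub>R chi (int a)) \<le> \<bar>?e (m * q + a) - ?e (m * q)\<bar> * 1"
        unfolding norm_scaleR by (intro mult_left_mono norm_dirichlet_character_le[OF chi]) auto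
      also have "?e (m * q + a) \<le> ?e (m * q)" using x by (simp add: ring_distribs)
      hence "\<bar>?e (m * q + a) - ?e (m * q)\<bar> * 1 = ?e (m * q) - ?e (m * q + a)" by simp
      also have "?e (Suc m * q) \<le> ?e (m * q + a)"
      proof -
        have "real (m * q + a) \<le> real (Suc m * q)" using a by (simp flip: of_nat_mult of_nat_add)
        thus ?thesis using x by (simp del: of_nat_mult of_nat_add)
      qed
      hence "?e (m * q) - ?e (m * q + a) \<le> ?e (m * q) - ?e (Suc m * q)" by simp
      finally show "norm ((?e (m * q + a) - ?e (m * q)) *\<^sub>R chi (int a)) \<le> ?e (m * q) - ?e (Suc m * q)" .
    qed (auto intro!: sum_nonneg simp: x)
    also have "\<dots> = x powr (s - 1) * (real (q - 1) * (?e (m * q) - ?e (Suc m * q)))" by simp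
    also have "\<dots> \<le> x powr (s - 1) * (real q * (?e (m * q) - ?e (Suc m * q)))"
    proof (intro mult_left_mono mult_right_mono)
      have "real (m * q) \<le> real (Suc m * q)" by (simp flip: of_nat_mult of_nat_add)
      thus "0 \<le> ?e (m * q) - ?e (Suc m * q)" using x by (simp del: of_nat_mult of_nat_add)
    qed auto
    also have "\<dots> = B m x" by (simp add: B_def right_diff_distrib mult_ac)
    finally show ?thesis .
  qed
  have ptw: "summable (\<lambda>m. B m x)" if x: "x > 0" for x
  proof -
    have "(\<lambda>m. exp (-(real (m * q) * x))) \<longlonglongrightarrow> 0"
    proof -
      have "filterlim (\<lambda>m. real m * (real q * x)) at_top sequentially"
        using q x by (intro filterlim_at_top_mult_tendsto_pos[OF tendsto_const] filterlim_real_sequentially) auto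
      hence "(\<lambda>m. exp (-(real m * (real q * x)))) \<longlonglongrightarrow> 0"
        by (intro filterlim_compose[OF exp_at_bot] filterlim_uminus_at_top[THEN iffD1])
      thus ?thesis by (simp add: mult_ac)
    qed
    from telescope_summable'[OF this] show ?thesis
      unfolding B_def right_diff_distrib[symmetric] by (intro summable_mult)
  qed
  have "(\<lambda>m. Gamma s *\<^sub>R L_block q chi s m) sums integral {0<..} (\<lambda>x. \<Sum>m. f m x)"
    using sums_integral_dominated[OF conjunct1[OF int] BI le ptw sumI] intL by simp
  moreover have "(\<lambda>m. Gamma s *\<^sub>R L_block q chi s m) sums (Gamma s *\<^sub>R L_half q chi s)"
    using s by (intro sums_scaleR_right L_half_sums[OF chi q sum0]) auto
  ultimately have "Gamma s *\<^sub>R L_half q chi s = integral {0<..} (\<lambda>x. \<Sum>m. f m x)"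
    using sums_unique2 by blast
  also have "\<dots> = integral {0<..} (\<lambda>x. of_real (x powr (s - 1)) *
     ((\<Sum>a\<in>{1..<q}. chi (int a) * of_real (exp (-(real a * x)))) / of_real (1 - exp (-(real q * x)))))"
  proof (rule integral_cong)
    fix x :: real assume x: "x \<in> {0<..}"
    let ?c = "\<Sum>a\<in>{1..<q}. chi (int a) * of_real (exp (-(real a * x)))"
    let ?r = "complex_of_real (exp (-(real q * x)))"
    have "f m x = ?r ^ m * (of_real (x powr (s - 1)) * ?c)" for m
    proof -
      have "exp (-(real (m * q + a) * x)) = exp (-(real q * x)) ^ m * exp (-(real a * x))" for a
      proof -
        have "-(real (m * q + a) * x) = real m * (-(real q * x)) + -(real a * x)"
          by (simp add: algebra_simps)
        thus ?thesis by (simp only: exp_add exp_of_nat_mult)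
      qed
      thus ?thesis
        by (simp add: f_def sum_distrib_left scaleR_conv_of_real mult_ac)
    qed
    moreover have "norm ?r < 1" using x q by simp
    hence "(\<lambda>m. ?r ^ m * (of_real (x powr (s - 1)) * ?c)) sums (1 / (1 - ?r) * (of_real (x powr (s - 1)) * ?c))"
      by (intro sums_mult2 geometric_sums)
    ultimately show "(\<Sum>m. f m x) = of_real (x powr (s - 1)) * (?c / of_real (1 - exp (-(real q * x))))"
      by (simp add: sums_iff)
  qed
  finally show ?thesis .
qed

text \<open>The second evaluation of the Mellin transform. Integrating the kernel in
  \<open>x\<close> leaves a power of its pole height, and these powers form the Dirichlet series at
  \<open>1 - s\<close>.\<close>

lemma dual_L_half:
  assumes psi: "dirichlet_character q psi" and q: "q > 1" and sum0: "(\<Sum>b<q. psi (int b)) = 0"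
    and s: "0 < (s::real)" "s < 1" and kap: "\<kappa> \<in> {0, 1}"
  defines "M \<equiv> pi / (2 * sin (pi * (s + 1 - real \<kappa>) / 2))"
  shows "((2 * pi / q) powr (s - 1) * M) *\<^sub>R L_half q psi (1 - s) =
     integral {0<..} (\<lambda>x. of_real (x powr (s - 1)) * (\<Sum>k. \<Sum>b\<in>{1..<q}. psi (int b) *
        of_real (cauchy_kernel \<kappa> x (2 * pi * real (k * q + b) / real q))))"
proof -
  define Y where "Y k b = 2 * pi * real (k * q + b) / real q" for k b
  define f where "f k x = (\<Sum>b\<in>{1..<q}. (x powr (s - 1) * cauchy_kernel \<kappa> x (Y k b)) *\<^sub>R psi (int b))" for k x
  \<comment> \<open>The factor \<open>2 * pi\<close> bounds the distance of the pole heights of a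
    block from the first height \<open>2 * pi * k\<close>, and \<open>q\<close> bounds their
    number.\<close>
  define B where "B k x = (real q * (2 * pi)) * (x powr (s - 1) / (x\<^sup>2 + (2 * pi * real k)\<^sup>2))" for k x
  define I where "I k = (real q * (2 * pi)) * ((2 * pi * real k) powr (s - 2) * (pi / (2 * sin (pi * s / 2))))" for k
  have c0: "(\<Sum>a\<in>{1..<q}. psi (int a)) = 0"
    using sum_dirichlet_character_atLeast1[OF psi q, of "\<lambda>_. 1"] sum0 by simp
  have Y0: "Y k 0 = 2 * pi * real k" for k using q by (simp add: Y_def)
  have int: "f k absolutely_integrable_on {0<..} \<and>
      integral {0<..} (f k) = (\<Sum>b\<in>{1..<q}. (Y k b powr (s - 1) * M) *\<^sub>R psi (int b))" for k
    unfolding f_def M_def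
    by (intro integral_sum_scaleR cauchy_kernel_integral s kap) (use q in \<open>auto simp: Y_def intro!: divide_pos_pos mult_pos_pos add_nonneg_pos\<close>)
  have intL: "integral {0<..} (f k) = ((2 * pi / q) powr (s - 1) * M) *\<^sub>R L_block q psi (1 - s) k" for k
  proof -
    have "complex_of_real (Y k b powr (s - 1)) = of_real ((2 * pi / q) powr (s - 1)) * of_nat (k * q + b) powr (- (1 - of_real s))" for b
    proof -
      have "Y k b powr (s - 1) = (2 * pi / q * real (k * q + b)) powr (s - 1)" by (simp add: Y_def)
      also have "\<dots> = (2 * pi / q) powr (s - 1) * real (k * q + b) powr (s - 1)"
        by (rule powr_mult)
      finally have "Y k b powr (s - 1) = (2 * pi / q) powr (s - 1) * real (k * q + b) powr (s - 1)" .
      moreover have "complex_of_real (real (k * q + b) powr (s - 1)) = of_nat (k * q + b) powr (- (1 - of_real s))"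
        by (subst powr_of_real[symmetric]) auto
      ultimately show ?thesis by simp
    qed
    thus ?thesis using int[of k]
      by (simp add: L_block_def scaleR_conv_of_real sum_distrib_left mult_ac)
  qed
  have sumI: "summable I"
  proof -
    have "summable (\<lambda>k. (2 * pi) powr (s - 2) * real k powr (s - 2))"
      using s by (intro summable_mult) (simp add: summable_real_powr_iff)
    also have "(\<lambda>k. (2 * pi) powr (s - 2) * real k powr (s - 2)) = (\<lambda>k. (2 * pi * real k) powr (s - 2))"
      by (simp add: powr_mult)
    finally show ?thesis unfolding I_def by (intro summable_mult summable_mult2)
  qed
  have BI: "B k absolutely_integrable_on {0<..} \<and> integral {0<..} (B k) = I k" if k: "k > 0" for k
    using powr_over_sum_squares[of s "2 * pi * real k"] s k q unfolding B_def I_def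
    by (simp only: integral_mult_right) (simp del: times_divide_eq_right)
  have le: "norm (f k x) \<le> B k x" if k: "k > 0" and x: "x > 0" for k x
  proof -
    have "f k x = x powr (s - 1) *\<^sub>R (\<Sum>b\<in>{1..<q}. cauchy_kernel \<kappa> x (Y k b) *\<^sub>R psi (int b))"
      by (simp add: f_def scaleR_sum_right)
    also have "(\<Sum>b\<in>{1..<q}. cauchy_kernel \<kappa> x (Y k b) *\<^sub>R psi (int b)) =
        (\<Sum>b\<in>{1..<q}. (cauchy_kernel \<kappa> x (Y k b) - cauchy_kernel \<kappa> x (Y k 0)) *\<^sub>R psi (int b))"
      using c0 by (simp add: scaleR_diff_left sum_subtractf flip: scaleR_sum_right)
    also have "norm (x powr (s - 1) *\<^sub>R \<dots>) \<le> x powr (s - 1) * (\<Sum>b\<in>{1..<q}. 2 * pi / (x\<^sup>2 + (2 * pi * real k)\<^sup>2))"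
      unfolding norm_scaleR
    proof (intro mult_mono sum_norm_le)
      fix b assume b: "b \<in> {1..<q}"
      have Yb: "Y k b = Y k 0 + 2 * pi * (real b / real q)" using q by (simp add: Y_def field_simps)
      have bq: "real b / real q \<le> 1" using b by simp
      have "norm ((cauchy_kernel \<kappa> x (Y k b) - cauchy_kernel \<kappa> x (Y k 0)) *\<^sub>R psi (int b)) \<le>
          \<bar>cauchy_kernel \<kappa> x (Y k b) - cauchy_kernel \<kappa> x (Y k 0)\<bar> * 1"
        unfolding norm_scaleR by (intro mult_left_mono norm_dirichlet_character_le[OF psi]) auto
      also have "\<dots> \<le> (Y k b - Y k 0) / (x\<^sup>2 + (Y k 0)\<^sup>2)"
        using cauchy_kernel_diff_le[OF x, of "Y k 0" "Y k b" \<kappa>] k by (simp add: Yb) (simp add: Y0)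
      also have "\<dots> \<le> 2 * pi / (x\<^sup>2 + (Y k 0)\<^sup>2)"
        using mult_left_mono[OF bq, of "2 * pi"] by (intro divide_right_mono) (auto simp: Yb)
      finally show "norm ((cauchy_kernel \<kappa> x (Y k b) - cauchy_kernel \<kappa> x (Y k 0)) *\<^sub>R psi (int b)) \<le>
          2 * pi / (x\<^sup>2 + (2 * pi * real k)\<^sup>2)" by (simp add: Y0)
    qed (auto intro!: sum_nonneg)
    also have "\<dots> = x powr (s - 1) * (real (q - 1) * (2 * pi / (x\<^sup>2 + (2 * pi * real k)\<^sup>2)))" by simp
    also have "\<dots> \<le> x powr (s - 1) * (real q * (2 * pi / (x\<^sup>2 + (2 * pi * real k)\<^sup>2)))"
      by (intro mult_left_mono mult_right_mono) auto
    also have "\<dots> = B k x" by (simp add: B_def)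
    finally show ?thesis .
  qed
  have ptw: "summable (\<lambda>k. B k x)" if x: "x > 0" for x
    unfolding B_def
  proof (rule summable_mult, rule summable_comparison_test')
    have "summable (\<lambda>k. (x powr (s - 1) / (2 * pi)\<^sup>2) * inverse (real k ^ 2))"
      by (intro summable_mult inverse_power_summable) auto
    thus "summable (\<lambda>k. x powr (s - 1) / (2 * pi * real k)\<^sup>2)"
      by (simp add: field_simps)
    fix k :: nat assume k: "k \<ge> 1"
    show "norm (x powr (s - 1) / (x\<^sup>2 + (2 * pi * real k)\<^sup>2)) \<le> x powr (s - 1) / (2 * pi * real k)\<^sup>2"
      using x k by (auto intro!: divide_left_mono mult_pos_pos add_pos_pos)
  qed
  have "(\<lambda>k. ((2 * pi / q) powr (s - 1) * M) *\<^sub>R L_block q psi (1 - s) k) sums integral {0<..} (\<lambda>x. \<Sum>k. f k x)"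
    using sums_integral_dominated[OF conjunct1[OF int] BI le ptw sumI] intL by simp
  moreover have "(\<lambda>k. ((2 * pi / q) powr (s - 1) * M) *\<^sub>R L_block q psi (1 - s) k) sums
      (((2 * pi / q) powr (s - 1) * M) *\<^sub>R L_half q psi (1 - s))"
    using s by (intro sums_scaleR_right L_half_sums[OF psi q sum0]) auto
  ultimately have "((2 * pi / q) powr (s - 1) * M) *\<^sub>R L_half q psi (1 - s) = integral {0<..} (\<lambda>x. \<Sum>k. f k x)"
    using sums_unique2 by blast
  also have "\<dots> = integral {0<..} (\<lambda>x. of_real (x powr (s - 1)) * (\<Sum>k. \<Sum>b\<in>{1..<q}. psi (int b) *
        of_real (cauchy_kernel \<kappa> x (2 * pi * real (k * q + b) / real q))))"
  proof (rule integral_cong)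
    fix x :: real assume x: "x \<in> {0<..}"
    have f: "f k x = of_real (x powr (s - 1)) * (\<Sum>b\<in>{1..<q}. psi (int b) * of_real (cauchy_kernel \<kappa> x (Y k b)))" for k
      by (simp add: f_def sum_distrib_left scaleR_conv_of_real mult_ac)
    have "summable (\<lambda>k. f k x)"
      by (rule summable_comparison_test'[OF ptw, of x 1]) (use x le in auto)
    hence "summable (\<lambda>k. \<Sum>b\<in>{1..<q}. psi (int b) * of_real (cauchy_kernel \<kappa> x (Y k b)))"
      unfolding f using x by (subst (asm) summable_cmult_iff) auto
    thus "(\<Sum>k. f k x) = of_real (x powr (s - 1)) * (\<Sum>k. \<Sum>b\<in>{1..<q}. psi (int b) *
        of_real (cauchy_kernel \<kappa> x (2 * pi * real (k * q + b) / real q)))"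
      unfolding f by (subst suminf_mult) (auto simp: Y_def)
  qed
  finally show ?thesis .
qed

lemma functional_equation_real:
  assumes q: "q > 1" and prim: "primitive_character q chi" and kap: "\<kappa> \<in> {0, 1}"
    and sgn: "chi (-1) = (-1) ^ \<kappa>" and s: "0 < (s::real)" "s < 1"
  defines "psi \<equiv> (\<lambda>a. cnj (chi a))"
  shows "gauss_sum q psi 1 * (of_real (Gamma s) * L_half q chi s) =
     2 * \<i> ^ \<kappa> * (of_real ((2 * pi / q) powr (s - 1) * (pi / (2 * sin (pi * (s + 1 - real \<kappa>) / 2)))) * L_half q psi (1 - s))"
proof -
  have primp: "primitive_character q psi" unfolding psi_def by (rule primitive_character_cnj[OF prim])
  have chi: "dirichlet_character q chi" using prim by (simp add: primitive_character_def)
  have psi: "dirichlet_character q psi" using primp by (simp add: primitive_character_def)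
  note chi0 = sum_dirichlet_character_eq_0[OF chi primitive_character_imp_nontrivial[OF q prim]]
  note psi0 = sum_dirichlet_character_eq_0[OF psi primitive_character_imp_nontrivial[OF q primp]]
  let ?F = "\<lambda>x::real. (\<Sum>a\<in>{1..<q}. chi (int a) * of_real (exp (-(real a * x)))) / of_real (1 - exp (-(real q * x)))"
  let ?G = "\<lambda>x. \<Sum>k. \<Sum>b\<in>{1..<q}. psi (int b) * complex_of_real (cauchy_kernel \<kappa> x (2 * pi * real (k * q + b) / real q))"
  have key: "gauss_sum q psi 1 * ?F x = 2 * \<i> ^ \<kappa> * ?G x" if x: "x > 0" for x
  proof -
    have c: "2 * \<i> ^ \<kappa> \<noteq> 0" by simp
    have "(\<lambda>k. 2 * \<i> ^ \<kappa> * (\<Sum>b\<in>{1..<q}. psi (int b) * complex_of_real (cauchy_kernel \<kappa> x (2 * pi * real (k * q + b) / real q))))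
       sums (gauss_sum q psi 1 * ?F x)"
      using character_generating_function_sums[OF q prim kap sgn x]
      by (simp add: psi_def sum_distrib_left mult_ac)
    hence *: "(\<lambda>k. 2 * \<i> ^ \<kappa> * (\<Sum>b\<in>{1..<q}. psi (int b) * complex_of_real (cauchy_kernel \<kappa> x (2 * pi * real (k * q + b) / real q))))
       sums (2 * \<i> ^ \<kappa> * (gauss_sum q psi 1 * ?F x / (2 * \<i> ^ \<kappa>)))" using c by simp
    have "(\<lambda>k. \<Sum>b\<in>{1..<q}. psi (int b) * complex_of_real (cauchy_kernel \<kappa> x (2 * pi * real (k * q + b) / real q)))
       sums (gauss_sum q psi 1 * ?F x / (2 * \<i> ^ \<kappa>))" using * sums_mult_iff[OF c] by blast
    hence "?G x = gauss_sum q psi 1 * ?F x / (2 * \<i> ^ \<kappa>)" by (simp add: sums_iff)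
    thus ?thesis using c by simp
  qed
  have "gauss_sum q psi 1 * (of_real (Gamma s) * L_half q chi s) =
     integral {0<..} (\<lambda>x. gauss_sum q psi 1 * (of_real (x powr (s - 1)) * ?F x))"
    using Gamma_times_L_half[OF chi q chi0 s(1)]
    unfolding scaleR_conv_of_real integral_mult_right by (simp only:)
  also have "\<dots> = integral {0<..} (\<lambda>x. 2 * \<i> ^ \<kappa> * (of_real (x powr (s - 1)) * ?G x))"
  proof (rule integral_cong)
    fix x :: real assume "x \<in> {0<..}"
    hence eq: "gauss_sum q psi 1 * ?F x = 2 * \<i> ^ \<kappa> * ?G x" by (intro key) auto
    have "gauss_sum q psi 1 * (of_real (x powr (s - 1)) * ?F x) = of_real (x powr (s - 1)) * (gauss_sum q psi 1 * ?F x)"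
      by (rule mult.left_commute)
    also have "\<dots> = of_real (x powr (s - 1)) * (2 * \<i> ^ \<kappa> * ?G x)" by (simp only: eq)
    also have "\<dots> = 2 * \<i> ^ \<kappa> * (of_real (x powr (s - 1)) * ?G x)" by (rule mult.left_commute)
    finally show "gauss_sum q psi 1 * (of_real (x powr (s - 1)) * ?F x) = 2 * \<i> ^ \<kappa> * (of_real (x powr (s - 1)) * ?G x)" .
  qed
  also have "\<dots> = 2 * \<i> ^ \<kappa> * integral {0<..} (\<lambda>x. of_real (x powr (s - 1)) * ?G x)"
    by (rule integral_mult_right)
  also have "integral {0<..} (\<lambda>x. of_real (x powr (s - 1)) * ?G x) =
    of_real ((2 * pi / q) powr (s - 1) * (pi / (2 * sin (pi * (s + 1 - real \<kappa>) / 2)))) * L_half q psi (1 - s)"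
    using dual_L_half[OF psi q psi0 s kap] unfolding scaleR_conv_of_real by (rule sym)
  finally show ?thesis .
qed

text \<open>The real interval (0, 1) accumulates at 1/2, inside the connected strip where the half
  planes overlap; so the two functions agree on the whole strip and can be glued.\<close>

lemma holomorphic_extension_halfplanes:
  assumes D: "D holomorphic_on {s. Re s > 0}" and R: "R holomorphic_on {s. Re s < 1}"
    and eq: "\<And>x::real. 0 < x \<Longrightarrow> x < 1 \<Longrightarrow> D (of_real x) = R (of_real x)"
  shows "\<exists>f. f holomorphic_on UNIV \<and> (\<forall>s. Re s > 0 \<longrightarrow> f s = D s) \<and> (\<forall>s. Re s < 1 \<longrightarrow> f s = R s)"
proof -
  let ?S = "{s. Re s > 0} \<inter> {s. Re s < 1}"
  have S: "open ?S" "connected ?S"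
    by (intro open_Int open_halfspace_Re_gt open_halfspace_Re_lt)
       (intro convex_connected convex_Int convex_halfspace_Re_gt convex_halfspace_Re_lt)
  have *: "D s - R s = 0" if "s \<in> ?S" for s
  proof (rule analytic_continuation[of "\<lambda>s. D s - R s" ?S "of_real ` {0<..<1}" "1/2"])
    show "(\<lambda>s. D s - R s) holomorphic_on ?S"
      by (intro holomorphic_intros holomorphic_on_subset[OF D] holomorphic_on_subset[OF R]) auto
    show "(1/2 :: complex) islimpt of_real ` {0<..<1}"
    proof -
      have "(1/2::real) islimpt {0<..<1}"
        by (rule interior_limit_point) auto
      moreover have "eventually (\<lambda>y. complex_of_real y \<noteq> complex_of_real (1/2)) (at (1/2))"
        by (simp only: of_real_eq_iff eventually_neq_at_within)
      ultimately have "complex_of_real (1/2) islimpt of_real ` {0<..<1}"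
        by (intro islimpt_isCont_image) auto
      thus ?thesis by simp
    qed
  qed (use S eq that in auto)
  define f where "f s = (if Re s > 0 then D s else R s)" for s
  have fR: "f s = R s" if "Re s < 1" for s using * that by (auto simp: f_def)
  have fD: "f s = D s" if "Re s > 0" for s using that by (simp add: f_def)
  have "f holomorphic_on {s. Re s > 0} \<union> {s. Re s < 1}"
  proof (rule holomorphic_on_Un)
    show "f holomorphic_on {s. Re s > 0}"
      by (rule holomorphic_transform[OF D]) (simp add: fD)
    show "f holomorphic_on {s. Re s < 1}"
      by (rule holomorphic_transform[OF R]) (simp add: fR)
  qed (auto intro: open_halfspace_Re_gt open_halfspace_Re_lt)
  also have "{s. Re s > 0} \<union> {s. Re s < 1} = UNIV" by auto
  finally show ?thesis using fR fD by blast
qed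

text \<open>The asymmetric form, in which the right-hand side is holomorphic on
  \<open>Re s < 1\<close> because \<open>Gamma (1 - s)\<close> has no pole there. \<open>K\<close>
  collects the Gauss sum and all other factors independent of \<open>s\<close>.\<close>

theorem dirichlet_L_functional_equation:
  assumes q: "q > 1" and prim: "primitive_character q chi" and kap: "\<kappa> \<in> {0, 1}"
    and sgn: "chi (-1) = (-1) ^ \<kappa>"
  shows "dirichlet_L q chi holomorphic_on UNIV \<and> (\<exists>K. K \<noteq> 0 \<and> (\<forall>s. Re s < 1 \<longrightarrow>
     dirichlet_L q chi s = K * of_real (2 * pi / q) powr s * sin (of_real pi * (s + of_nat \<kappa>) / 2) *
       Gamma (1 - s) * L_half q (\<lambda>a. cnj (chi a)) (1 - s)))"
proof -
  define psi where "psi = (\<lambda>a. cnj (chi a))"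
  have primp: "primitive_character q psi" unfolding psi_def by (rule primitive_character_cnj[OF prim])
  have chi: "dirichlet_character q chi" using prim by (simp add: primitive_character_def)
  have psi: "dirichlet_character q psi" using primp by (simp add: primitive_character_def)
  note chi0 = sum_dirichlet_character_eq_0[OF chi primitive_character_imp_nontrivial[OF q prim]]
  note psi0 = sum_dirichlet_character_eq_0[OF psi primitive_character_imp_nontrivial[OF q primp]]
  define \<tau> where "\<tau> = gauss_sum q psi 1"
  have tau: "\<tau> \<noteq> 0" unfolding \<tau>_def by (rule gauss_sum_primitive_nonzero[OF q primp])
  define c where "c = 2 * pi / real q"
  have c: "c > 0" using q by (simp add: c_def)
  define K where "K = 2 * \<i> ^ \<kappa> / (\<tau> * of_real c)"
  have K: "K \<noteq> 0" using tau c by (simp add: K_def)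
  define R where "R s = K * of_real c powr s * sin (of_real pi * (s + of_nat \<kappa>) / 2) *
       Gamma (1 - s) * L_half q psi (1 - s)" for s
  have R: "R holomorphic_on {s. Re s < 1}"
    unfolding R_def
  proof (intro holomorphic_intros)
    show "(\<lambda>s. L_half q psi (1 - s)) holomorphic_on {s. Re s < 1}"
    proof -
      have "(L_half q psi \<circ> (\<lambda>s. 1 - s)) holomorphic_on {s. Re s < 1}"
        by (rule holomorphic_on_compose_gen[OF _ L_half_holomorphic[OF psi q psi0]])
           (auto intro!: holomorphic_intros)
      thus ?thesis by (simp add: o_def)
    qed
  qed (use c in \<open>auto elim!: nonpos_Ints_cases' dest!: arg_cong[of _ _ Re]\<close>)
  have eq: "L_half q chi (of_real s) = R (of_real s)" if s: "0 < s" "s < 1" for s :: real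
  proof -
    define S1 where "S1 = sin (pi * (s + real \<kappa>) / 2)"
    define S2 where "S2 = sin (pi * (s + 1 - real \<kappa>) / 2)"
    \<comment> \<open>With the reflection formula this trades \<open>Gamma s\<close> and the sine in
      the denominator for \<open>Gamma (1 - s)\<close> and the sine that carries the trivial
      zeros.\<close>
    have sn: "sin (pi * s) = 2 * S1 * S2"
    proof -
      have "sin (pi * s) = sin (2 * (pi * s / 2))" by simp
      also have "\<dots> = 2 * sin (pi * s / 2) * cos (pi * s / 2)" by (rule sin_double)
      also have "\<dots> = 2 * S1 * S2"
      proof -
        have "sin (pi * (s + 1) / 2) = cos (pi * s / 2)"
          by (simp add: ring_distribs add_divide_distrib sin_add)
        thus ?thesis using kap by (auto simp: S1_def S2_def)
      qed
      finally show ?thesis .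
    qed
    have "sin (pi * s) > 0" using s by (intro sin_gt_zero) auto
    hence S2: "S2 \<noteq> 0" using sn by auto
    have G: "Gamma s > 0" using s by (simp add: Gamma_real_pos)
    have refl: "pi = 2 * S1 * S2 * Gamma (1 - s) * Gamma s"
    proof -
      have "2 * S1 * S2 \<noteq> 0" using \<open>sin (pi * s) > 0\<close> unfolding sn by auto
      hence "2 * S1 * S2 * (Gamma s * Gamma (1 - s)) = pi"
        unfolding Gamma_reflection_real sn by simp
      thus ?thesis by (simp add: mult_ac)
    qed
    hence real: "c powr (s - 1) * (pi / (2 * S2)) = Gamma s * (c powr s / c * S1 * Gamma (1 - s))"
    proof -
      have "pi / (2 * S2) = Gamma s * (S1 * Gamma (1 - s))"
        by (subst refl) (use S2 in simp)
      thus ?thesis using c by (simp only: powr_diff powr_one mult_ac times_divide_eq_left)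
    qed
    have "\<tau> * (of_real (Gamma s) * L_half q chi s) =
       2 * \<i> ^ \<kappa> * (of_real (c powr (s - 1) * (pi / (2 * S2))) * L_half q psi (1 - s))"
      using functional_equation_real[OF q prim kap sgn s] by (simp add: \<tau>_def psi_def S2_def c_def)
    hence "\<tau> * (of_real (Gamma s) * L_half q chi s) =
       of_real (Gamma s) * (2 * \<i> ^ \<kappa> * of_real (c powr s / c * S1 * Gamma (1 - s)) * L_half q psi (1 - s))"
      unfolding real by (simp add: mult_ac)
    hence A: "of_real (Gamma s) * (\<tau> * L_half q chi s) = of_real (Gamma s) *
        (2 * \<i> ^ \<kappa> * of_real (c powr s / c * S1 * Gamma (1 - s)) * L_half q psi (1 - s))"
      by (subst mult.left_commute)
    have "complex_of_real (Gamma s) \<noteq> 0" using G by simp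
    from mult_left_cancel[OF this, THEN iffD1, OF A] have "\<tau> * L_half q chi s = 2 * \<i> ^ \<kappa> * of_real (c powr s / c * S1 * Gamma (1 - s)) * L_half q psi (1 - s)"
      .
    hence "L_half q chi s = K * of_real (c powr s) * of_real S1 * of_real (Gamma (1 - s)) * L_half q psi (1 - s)"
      using tau c by (simp add: K_def field_simps)
    also have "complex_of_real (c powr s) = of_real c powr of_real s"
      using c by (simp add: powr_of_real)
    also have "complex_of_real S1 = sin (of_real pi * (of_real s + of_nat \<kappa>) / 2)"
      by (simp add: S1_def flip: sin_of_real)
    also have "complex_of_real (Gamma (1 - s)) = Gamma (1 - of_real s)"
      by (simp flip: Gamma_complex_of_real)
    finally show ?thesis by (simp add: R_def)
  qed
  obtain f where f: "f holomorphic_on UNIV" "\<And>s. Re s > 0 \<Longrightarrow> f s = L_half q chi s" "\<And>s. Re s < 1 \<Longrightarrow> f s = R s"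
    using holomorphic_extension_halfplanes[OF L_half_holomorphic[OF chi q chi0] R eq] by blast
  note np = primitive_character_imp_not_principal[OF q prim]
  have "dirichlet_L q chi = f"
    unfolding dirichlet_L_def
  proof (rule the_equality)
    show "f holomorphic_on (if principal_character q chi then UNIV - {1} else UNIV) \<and>
      (principal_character q chi \<longrightarrow> f 1 = 0) \<and>
      (\<forall>s. 1 < Re s \<longrightarrow> (\<lambda>n. chi (int (Suc n)) / of_nat (Suc n) powr s) sums f s)"
      using f np dirichlet_series_sums_L_half[OF chi q chi0] by simp
  next
    fix g assume g: "g holomorphic_on (if principal_character q chi then UNIV - {1} else UNIV) \<and>
      (principal_character q chi \<longrightarrow> g 1 = 0) \<and>
      (\<forall>s. 1 < Re s \<longrightarrow> (\<lambda>n. chi (int (Suc n)) / of_nat (Suc n) powr s) sums g s)"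
    show "g = f"
    proof
      fix z
      show "g z = f z"
      proof (rule analytic_continuation_open[of "{s. Re s > 1}" UNIV g f])
        show "open {s. 1 < Re s}" by (rule open_halfspace_Re_gt)
        show "g holomorphic_on UNIV" using g np by simp
        show "f holomorphic_on UNIV" by (rule f(1))
        show "{s. 1 < Re s} \<noteq> {}" by (auto intro!: exI[of _ 2])
        fix s assume "s \<in> {s. 1 < Re s}"
        hence s: "Re s > 1" by simp
        have "(\<lambda>n. chi (int (Suc n)) / of_nat (Suc n) powr s) sums g s" using g s by blast
        moreover have "(\<lambda>n. chi (int (Suc n)) / of_nat (Suc n) powr s) sums f s"
          using dirichlet_series_sums_L_half[OF chi q chi0 s] f(2)[of s] s by simp
        ultimately show "g s = f s" by (rule sums_unique2)
      qed auto
    qed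
  qed
  thus ?thesis using f K unfolding R_def c_def psi_def by blast
qed

section \<open>The logarithmic derivative\<close>

text \<open>The value \<open>sin (pi / 6) = 1/2\<close> is compared with the cubic Taylor polynomial
  of the sine at \<open>3.14 / 6\<close> and at \<open>3.15 / 6\<close>.\<close>

lemma pi_bounds: "pi > 3.14" "pi < 3.15"
proof -
  have sin: "\<bar>sin x - (x - x ^ 3 / 6)\<bar> \<le> \<bar>x\<bar> ^ 5 / 120" for x :: real
  proof -
    have "(\<Sum>m<5. sin_coeff m * x ^ m) = x - x ^ 3 / 6"
    proof -
      have "{..<5::nat} = {0, 1, 2, 3, 4}" by auto
      thus ?thesis by (simp add: sin_coeff_def fact_numeral)
    qed
    thus ?thesis using Maclaurin_sin_bound[of x 5] by (simp add: fact_numeral)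
  qed
  have lo: "x - x ^ 3 / 6 - x ^ 5 / 120 \<le> sin x" and hi: "sin x \<le> x - x ^ 3 / 6 + x ^ 5 / 120"
    if "x \<ge> 0" for x :: real
    using sin[of x] that unfolding abs_le_iff by auto
  show "pi > 3.14"
  proof (rule ccontr)
    assume "\<not> pi > 3.14"
    hence "sin (pi / 6) \<le> sin (3.14 / 6)" using pi_ge_two by (intro sin_monotone_2pi_le) auto
    moreover have "sin (3.14 / 6) < (1/2 :: real)"
      using hi[of "3.14 / 6"] by (simp add: power_divide)
    ultimately show False by (simp add: sin_30)
  qed
  show "pi < 3.15"
  proof (rule ccontr)
    assume "\<not> pi < 3.15"
    hence "sin (3.15 / 6) \<le> sin (pi / 6)" by (intro sin_monotone_2pi_le) auto
    moreover have "sin (3.15 / 6) > (1/2 :: real)"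
      using lo[of "3.15 / 6"] by (simp add: power_divide)
    ultimately show False by (simp add: sin_30)
  qed
qed

section \<open>Dirichlet series of the von Mangoldt function, twisted by a multiplicative
  function\<close>

lemma summable_ln_over_powr:
  assumes "\<sigma> > (1::real)"
  shows "summable (\<lambda>n. ln (real n) * real n powr (-\<sigma>))"
proof (rule summable_comparison_test')
  define e where "e = (\<sigma> - 1) / 2"
  have e: "e > 0" "e - \<sigma> < -1" using assms by (auto simp: e_def field_simps)
  show "summable (\<lambda>n. 1 / e * real n powr (e - \<sigma>))"
    using e by (intro summable_mult) (simp add: summable_real_powr_iff)
  fix n :: nat assume n: "n \<ge> 1"
  have "ln (real n) * real n powr (-\<sigma>) \<le> real n powr e / e * real n powr (-\<sigma>)"
    using n e by (intro mult_right_mono ln_powr_bound) auto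
  also have "\<dots> = 1 / e * real n powr (e - \<sigma>)" by (simp add: powr_diff powr_minus divide_inverse)
  finally show "norm (ln (real n) * real n powr (-\<sigma>)) \<le> 1 / e * real n powr (e - \<sigma>)" using n by simp
qed

lemma norm_div_nat_powr:
  "norm (z / of_nat n powr w :: complex) = norm z * real n powr (-Re w)"
  unfolding norm_divide using norm_powr_real_powr[of "of_nat n" w]
  by (simp add: powr_minus divide_inverse)

lemma mangoldt_le_ln: "(mangoldt n :: real) \<le> ln (real n)"
  by (cases "n = 0") (auto intro: mangoldt_le)

lemma summable_mangoldt:
  assumes "\<sigma> > (1::real)"
  shows "summable (\<lambda>n. mangoldt n * real n powr (-\<sigma>))"
  by (rule summable_comparison_test'[OF summable_ln_over_powr[OF assms], of 0])
     (auto intro!: mult_right_mono mangoldt_le_ln simp: mangoldt_nonneg abs_mult)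

text \<open>For completely multiplicative \<open>f\<close> this is -G'/G, where G is the Dirichlet
  series of \<open>f\<close>. The term at 0 is zero.\<close>

definition mangoldt_series :: "(nat \<Rightarrow> complex) \<Rightarrow> complex \<Rightarrow> complex" where
  "mangoldt_series f w = (\<Sum>n. mangoldt n * f n / of_nat n powr w)"

lemma summable_mangoldt_series:
  assumes f: "\<And>n. norm (f n) \<le> 1" and w: "Re w > 1"
  shows "summable (\<lambda>n. norm (mangoldt n * f n / of_nat n powr w))"
proof (rule summable_comparison_test'[OF summable_mangoldt[OF w], of 0])
  fix n
  have "norm (mangoldt n * f n / of_nat n powr w) = mangoldt n * norm (f n) * real n powr (-Re w)"
    by (simp add: norm_div_nat_powr norm_mult)
  also have "\<dots> \<le> mangoldt n * 1 * real n powr (-Re w)"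
    by (intro mult_mono f) (auto simp: mangoldt_nonneg)
  finally show "norm (norm (mangoldt n * f n / of_nat n powr w)) \<le> mangoldt n * real n powr (-Re w)" by simp
qed

lemma has_sum_nat_pos:
  assumes "(f has_sum S) (UNIV :: nat set)" "f 0 = 0"
  shows "(f has_sum S) {0<..}"
  using assms by (subst has_sum_cong_neutral[of "UNIV" "{0<..}" f f]) auto

text \<open>This is the Dirichlet convolution \<open>\<Lambda> * 1 = ln\<close>, twisted by \<open>f\<close>.\<close>

lemma mangoldt_series_mult_sums:
  fixes f :: "nat \<Rightarrow> complex"
  assumes f: "\<And>n. norm (f n) \<le> 1" and mult: "\<And>m n. f (m * n) = f m * f n" and w: "Re w > 1"
    and G: "(\<lambda>n. f n / of_nat n powr w) sums G"
  shows "(\<lambda>n. of_real (ln (real n)) * (f n / of_nat n powr w)) sums (mangoldt_series f w * G)"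
proof -
  let ?a = "\<lambda>n. mangoldt n * f n / of_nat n powr w" and ?b = "\<lambda>n. f n / of_nat n powr w"
  let ?S = "{0::nat<..}"
  have sa: "summable (\<lambda>n. norm (?a n))" by (rule summable_mangoldt_series[OF f w])
  have sb: "summable (\<lambda>n. norm (?b n))"
    using summable_dirichlet_series[OF f w] by (subst (asm) summable_Suc_iff)
  have ha: "(?a has_sum mangoldt_series f w) ?S"
    using summable_sums[OF summable_norm_cancel[OF sa]] unfolding mangoldt_series_def
    by (intro has_sum_nat_pos norm_summable_imp_has_sum[OF sa]) auto
  have hb: "(?b has_sum G) ?S"
    by (intro has_sum_nat_pos norm_summable_imp_has_sum[OF sb] G) auto
  have absa: "(\<lambda>n. norm (?a n)) summable_on ?S" and absb: "(\<lambda>n. norm (?b n)) summable_on ?S"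
    using norm_summable_imp_summable_on[of "\<lambda>n. norm (?a n)"] norm_summable_imp_summable_on[of "\<lambda>n. norm (?b n)"] sa sb
    by (auto intro: summable_on_subset_banach)
  have "((\<lambda>(d, m). ?a d * ?b m) has_sum (mangoldt_series f w * G)) (Sigma ?S (\<lambda>_. ?S))"
  proof (rule has_sum_SigmaI)
    show "((\<lambda>y. case (x, y) of (d, m) \<Rightarrow> ?a d * ?b m) has_sum ?a x * G) ?S" for x
      using has_sum_cmult_right[OF hb, of "?a x"] by simp
    show "((\<lambda>x. ?a x * G) has_sum (mangoldt_series f w * G)) ?S"
      by (rule has_sum_cmult_left[OF ha])
    show "(\<lambda>(d, m). ?a d * ?b m) summable_on ?S \<times> ?S"
    proof (rule abs_summable_summable)
      have "(\<lambda>p. norm (case p of (d, m) \<Rightarrow> ?a d * ?b m)) = (\<lambda>(d, m). norm (?a d) * norm (?b m))"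
        by (simp only: fun_eq_iff split_paired_All prod.case norm_mult) simp
      moreover have "(\<lambda>(d, m). norm (?a d) * norm (?b m)) summable_on ?S \<times> ?S"
      proof (rule summable_on_SigmaI)
        show "((\<lambda>m. case (d, m) of (d, m) \<Rightarrow> norm (?a d) * norm (?b m)) has_sum
            norm (?a d) * (\<Sum>\<^sub>\<infinity>m\<in>?S. norm (?b m))) ?S" for d
          using has_sum_cmult_right[OF has_sum_infsum[OF absb], of "norm (?a d)"] by simp
        show "(\<lambda>d. norm (?a d) * (\<Sum>\<^sub>\<infinity>m\<in>?S. norm (?b m))) summable_on ?S"
          by (rule summable_on_cmult_left[OF absa])
      qed auto
      ultimately show "(\<lambda>p. norm (case p of (d, m) \<Rightarrow> ?a d * ?b m)) summable_on ?S \<times> ?S" by simp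
    qed
  qed
  also have "?this \<longleftrightarrow> ((\<lambda>(n, d). ?a d * ?b (n div d)) has_sum (mangoldt_series f w * G)) (Sigma ?S (\<lambda>n. {d. d dvd n}))"
    by (rule has_sum_reindex_bij_witness[of _ "\<lambda>(n, d). (d, n div d)" "\<lambda>(d, m). (d * m, d)"])
       (auto intro: Nat.gr0I)
  finally have "((\<lambda>n. \<Sum>d | d dvd n. ?a d * ?b (n div d)) has_sum (mangoldt_series f w * G)) ?S"
    by (rule has_sum_SigmaD) (auto intro!: has_sum_finiteI)
  also have "?this \<longleftrightarrow> ((\<lambda>n. of_real (ln (real n)) * ?b n) has_sum (mangoldt_series f w * G)) ?S"
  proof (rule has_sum_cong)
    fix n assume n: "n \<in> ?S"
    have "(\<Sum>d | d dvd n. ?a d * ?b (n div d)) = (\<Sum>d | d dvd n. mangoldt d * ?b n)"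
    proof (intro sum.cong refl)
      fix d assume "d \<in> {d. d dvd n}"
      then obtain m where m: "n = d * m" by auto
      hence "d > 0" "n div d = m" using n by auto
      thus "?a d * ?b (n div d) = mangoldt d * ?b n"
        by (simp add: m mult powr_times_real)
    qed
    also have "\<dots> = of_real (ln (real n)) * ?b n"
      using n mangoldt_sum[of n, where ?'a = complex] by (simp flip: sum_distrib_right sum_divide_distrib)
    finally show "(\<Sum>d | d dvd n. ?a d * ?b (n div d)) = of_real (ln (real n)) * ?b n" .
  qed
  also have "\<dots> \<longleftrightarrow> ((\<lambda>n. of_real (ln (real n)) * ?b n) has_sum (mangoldt_series f w * G)) UNIV"
    by (rule has_sum_cong_neutral) auto
  finally show ?thesis by (rule has_sum_imp_sums)
qed

text \<open>Termwise differentiation brings down \<open>- ln n\<close>, and the twisted convolution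
  identity factors the resulting series.\<close>

lemma dirichlet_series_derivative:
  fixes f :: "nat \<Rightarrow> complex"
  assumes f: "\<And>n. norm (f n) \<le> 1" and mult: "\<And>m n. f (m * n) = f m * f n" and w: "Re w > 1"
    and G: "\<And>s. Re s > 1 \<Longrightarrow> (\<lambda>n. f (Suc n) / of_nat (Suc n) powr s) sums G s"
  shows "(G has_field_derivative - (mangoldt_series f w * G w)) (at w)"
proof -
  let ?S = "{s. Re s > 1}"
  let ?b = "\<lambda>n s. f (Suc n) / of_nat (Suc n) powr s"
  let ?b' = "\<lambda>n s. - (of_real (ln (real (Suc n))) * ?b n s)"
  have "\<exists>g g'. \<forall>s \<in> ?S. ((\<lambda>n. ?b n s) sums g s) \<and> ((\<lambda>n. ?b' n s) sums g' s) \<and>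
          (g has_field_derivative g' s) (at s)"
  proof (rule series_and_derivative_comparison_local)
    show "open ?S" by (rule open_halfspace_Re_gt)
    show "((\<lambda>s. ?b n s) has_field_derivative ?b' n s) (at s)" for n s
    proof -
      have nz: "complex_of_nat (Suc n) \<noteq> 0" by (simp del: of_nat_Suc)
      have ln: "Ln (complex_of_nat (Suc n)) = of_real (ln (real (Suc n)))"
        using Ln_of_real[of "real (Suc n)"] by (simp del: of_nat_Suc)
      have "((\<lambda>s. f (Suc n) * of_nat (Suc n) powr (-s)) has_field_derivative
          f (Suc n) * (Ln (of_nat (Suc n)) * of_nat (Suc n) powr (-s) * - 1)) (at s)"
        by (intro DERIV_cmult DERIV_chain'[OF DERIV_minus[OF DERIV_ident] has_field_derivative_powr_right[OF nz], THEN DERIV_cong]) simp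
      thus ?thesis unfolding ln by (simp add: powr_minus divide_inverse mult_ac del: of_nat_Suc)
    qed
    fix s assume s: "s \<in> ?S"
    define d where "d = (Re s - 1) / 2"
    have d: "d > 0" using s by (simp add: d_def)
    have "summable (\<lambda>n. real n powr (-(1 + d)))" using d by (simp add: summable_real_powr_iff)
    hence "summable (\<lambda>n. real (Suc n) powr (-(1 + d)))" by (subst summable_Suc_iff)
    moreover have "norm (?b n y) \<le> real (Suc n) powr (-(1 + d))" if "y \<in> ball s d" for n y
    proof -
      have "Re (s - y) < d" using that complex_Re_le_cmod[of "s - y"] by (simp add: dist_norm)
      hence "Re y \<ge> 1 + d" by (simp add: d_def field_simps)
      hence "real (Suc n) powr (-Re y) \<le> real (Suc n) powr (-(1 + d))"
        by (intro powr_mono) auto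
      moreover have "norm (?b n y) \<le> 1 * real (Suc n) powr (-Re y)"
        unfolding norm_div_nat_powr by (intro mult_right_mono f) auto
      ultimately show ?thesis by simp
    qed
    ultimately show "\<exists>d h. 0 < d \<and> summable h \<and> (\<forall>\<^sub>F n in sequentially. \<forall>y\<in>ball s d \<inter> ?S. norm (?b n y) \<le> h n)"
      using d by (intro exI[of _ d] exI[of _ "\<lambda>n. real (Suc n) powr (-(1 + d))"]) auto
  qed
  then obtain g g' where g: "\<And>s. Re s > 1 \<Longrightarrow> (\<lambda>n. ?b n s) sums g s"
    "\<And>s. Re s > 1 \<Longrightarrow> (\<lambda>n. ?b' n s) sums g' s"
    "\<And>s. Re s > 1 \<Longrightarrow> (g has_field_derivative g' s) (at s)" by blast
  have gG: "g s = G s" if "Re s > 1" for s using g(1)[OF that] G[OF that] by (rule sums_unique2)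
  have "(\<lambda>n. f n / of_nat n powr w) sums G w"
    using G[OF w] by (subst (asm) sums_Suc_iff) simp
  from mangoldt_series_mult_sums[OF f mult w this]
  have "(\<lambda>n. of_real (ln (real (Suc n))) * ?b n w) sums (mangoldt_series f w * G w)"
    by (subst sums_Suc_iff) simp
  from sums_minus[OF this] g(2)[OF w] have "g' w = - (mangoldt_series f w * G w)"
    using sums_unique2 by blast
  hence "(g has_field_derivative - (mangoldt_series f w * G w)) (at w)" using g(3)[OF w] by simp
  thus ?thesis
    by (rule has_field_derivative_transform_within_open[OF _ open_halfspace_Re_gt[of 1]]) (use w gG in auto)
qed

text \<open>The terms after the first have total modulus at most \<open>pi\<^sup>2 / 6 - 1\<close>,
  which is less than 1 because \<open>pi\<^sup>2 < 12\<close>.\<close>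

lemma dirichlet_series_nonzero:
  fixes f :: "nat \<Rightarrow> complex"
  assumes f: "\<And>n. norm (f n) \<le> 1" and f1: "f 1 = 1" and w: "Re w \<ge> 2"
    and G: "(\<lambda>n. f (Suc n) / of_nat (Suc n) powr w) sums G"
  shows "G \<noteq> 0"
proof
  assume "G = 0"
  with G have "(\<lambda>n. f (Suc n) / of_nat (Suc n) powr w) sums 0" by simp
  hence 1: "(\<lambda>n. f (Suc (Suc n)) / of_nat (Suc (Suc n)) powr w) sums (0 - 1)"
    using f1 sums_Suc_iff[of "\<lambda>n. f (Suc n) / of_nat (Suc n) powr w" "0 - 1"] by simp
  have 2: "(\<lambda>n. 1 / real (Suc (Suc n)) ^ 2) sums (pi\<^sup>2 / 6 - 1)"
    using inverse_squares_sums by (subst sums_Suc_iff) (simp add: add_ac)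
  have le: "norm (f (Suc (Suc n)) / of_nat (Suc (Suc n)) powr w) \<le> 1 / real (Suc (Suc n)) ^ 2" for n
  proof -
    have "norm (f (Suc (Suc n)) / of_nat (Suc (Suc n)) powr w) \<le> 1 * real (Suc (Suc n)) powr (-Re w)"
      unfolding norm_div_nat_powr by (intro mult_right_mono f) auto
    also have "\<dots> \<le> 1 * real (Suc (Suc n)) powr (-2)" using w by (intro mult_left_mono powr_mono) auto
    also have "\<dots> = 1 / real (Suc (Suc n)) ^ 2" by (simp add: powr_minus powr_numeral divide_inverse del: of_nat_Suc)
    finally show ?thesis .
  qed
  have "norm (\<Sum>n. f (Suc (Suc n)) / of_nat (Suc (Suc n)) powr w) \<le> (\<Sum>n. 1 / real (Suc (Suc n)) ^ 2)"
    by (rule norm_suminf_le[OF le sums_summable[OF 2]])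
  hence "1 \<le> pi\<^sup>2 / 6 - 1" using 1 2 by (simp add: sums_iff)
  hence "12 \<le> pi\<^sup>2" by simp
  moreover have "pi\<^sup>2 < 3.15\<^sup>2"
    using pi_bounds by (intro power_strict_mono) auto
  ultimately show False by (simp add: power2_eq_square)
qed

section \<open>Numerical bounds\<close>

text \<open>Separating the modulus of a term from its phase makes the exact savings at small
  \<open>n\<close> accessible.\<close>

lemma Re_mangoldt_term:
  assumes "n > 0"
  shows "Re (mangoldt n * f n / of_nat n powr w) =
           mangoldt n * real n powr (-Re w) * Re (f n * cis (-(Im w * ln (real n))))"
proof -
  have "complex_of_nat n powr w = of_real (real n powr Re w) * cis (Im w * ln (real n))"
    using assms by (simp add: powr_def exp_eq_polar[of "w * _"] Ln_of_nat mult.commute exp_of_real)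
  hence "mangoldt n * f n / of_nat n powr w =
      mangoldt n * of_real (inverse (real n powr Re w)) * (f n * cis (-(Im w * ln (real n))))"
    by (simp only: divide_inverse inverse_mult_distrib cis_inverse of_real_inverse mult_ac)
  also have "mangoldt n * of_real (inverse (real n powr Re w)) = complex_of_real (mangoldt n * real n powr (-Re w))"
    by (simp add: powr_minus)
  finally show ?thesis by simp
qed

lemma Re_mangoldt_series_le:
  fixes f :: "nat \<Rightarrow> complex"
  assumes f: "\<And>n. norm (f n) \<le> 1" and w: "Re w > 1"
    and c: "summable c" "\<And>n. Re (mangoldt n * f n / of_nat n powr w) \<le> c n"
  shows "Re (mangoldt_series f w) \<le> suminf c"
proof -
  have "summable (\<lambda>n. mangoldt n * f n / of_nat n powr w)"
    by (rule summable_norm_cancel[OF summable_mangoldt_series[OF f w]])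
  hence "Re (mangoldt_series f w) = (\<Sum>n. Re (mangoldt n * f n / of_nat n powr w))"
    "summable (\<lambda>n. Re (mangoldt n * f n / of_nat n powr w))"
    unfolding mangoldt_series_def by (auto simp: Re_suminf summable_Re)
  thus ?thesis using c by (simp add: suminf_le)
qed

lemma Re_mangoldt_term_le:
  fixes f :: "nat \<Rightarrow> complex"
  assumes f: "norm (f n) \<le> 1" and w: "Re w \<ge> \<sigma>"
  shows "Re (mangoldt n * f n / of_nat n powr w) \<le> mangoldt n * real n powr (-\<sigma>)"
proof (cases "n = 0")
  case False
  have "Re (mangoldt n * f n / of_nat n powr w) \<le> norm (mangoldt n * f n / of_nat n powr w)"
    by (rule complex_Re_le_cmod)
  also have "\<dots> = mangoldt n * norm (f n) * real n powr (-Re w)"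
    by (simp add: norm_div_nat_powr norm_mult)
  also have "\<dots> \<le> mangoldt n * 1 * real n powr (-\<sigma>)"
    using False f w by (intro mult_mono powr_mono) (auto simp: mangoldt_nonneg)
  finally show ?thesis by simp
qed auto

text \<open>The logarithms of 3 and 5 are tied to ln 2 by powers of comparable size: 8 < 9, 243 <
  256, 4 < 5 and 125 < 128.\<close>

lemma ln_numeral_bounds:
  shows "ln 2 \<ge> (2/3::real)" "ln 2 \<le> (25/36::real)" "ln 3 \<ge> (1::real)" "ln 3 \<le> (10/9::real)"
    "ln 5 \<ge> (4/3::real)" "ln 5 \<le> (175/108::real)"
proof -
  show 2: "ln 2 \<ge> (2/3::real)" "ln 2 \<le> (25/36::real)"
    by (rule ln2_ge_two_thirds ln2_le_25_over_36)+
  have "ln (2 ^ 3) \<le> (ln (3 ^ 2) :: real)" by (subst ln_le_cancel_iff) auto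
  thus "ln 3 \<ge> (1::real)" using 2 by (simp add: ln_realpow del: power_numeral)
  have "ln (3 ^ 5) \<le> (ln (2 ^ 8) :: real)" by (subst ln_le_cancel_iff) auto
  thus "ln 3 \<le> (10/9::real)" using 2 by (simp add: ln_realpow del: power_numeral)
  have "ln (2 ^ 2) \<le> (ln 5 :: real)" by (subst ln_le_cancel_iff) auto
  thus "ln 5 \<ge> (4/3::real)" using 2 by (simp add: ln_realpow del: power_numeral)
  have "ln (5 ^ 3) \<le> (ln (2 ^ 7) :: real)" by (subst ln_le_cancel_iff) auto
  thus "ln 5 \<le> (175/108::real)" using 2 by (simp add: ln_realpow del: power_numeral)
qed

text \<open>\<open>(ln x + 1) / x\<close> is the antiderivative of \<open>-ln x / x^2\<close>; its differences dominate the tail.\<close>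

lemma ln_over_square_le_diff:
  assumes "n \<ge> 5"
  shows "ln (real n) / real n ^ 2 \<le> (ln (real n - 1) + 1) / (real n - 1) - (ln (real n) + 1) / real n"
proof -
  define x where "x = real n"
  have x: "x \<ge> 5" using assms by (simp add: x_def)
  have "ln 2 \<le> ln x / 2"
  proof -
    have "ln (2 ^ 2) \<le> ln x" using x by (subst ln_le_cancel_iff) auto
    thus ?thesis by (simp add: ln_realpow del: power_numeral)
  qed
  hence lnx: "ln x \<ge> 4/3" using ln_numeral_bounds by simp
  have "ln (x / (x - 1)) \<le> x / (x - 1) - 1" using x by (intro ln_le_minus_one) auto
  hence d: "ln x - ln (x - 1) \<le> 1 / (x - 1)" using x by (simp add: ln_div field_simps)
  hence "x * (ln x - ln (x - 1)) \<le> x / (x - 1)" using x mult_left_mono[OF d, of x] by simp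
  moreover have "x / (x - 1) \<le> 4/3" using x by (simp add: field_simps)
  \<comment> \<open>Clearing denominators reduces the claim to the condition stated after
    \<open>if\<close>. Its left side is at most \<open>x / (x - 1)\<close>, hence at most 4/3, and
    \<open>ln x\<close> is at least 4/3 from 5 on.\<close>
  ultimately have key: "(x - 1) * ln x \<le> x * (ln x - x * (ln x - ln (x - 1)) + 1)" if "x * (x * (ln x - ln (x - 1)) - 1) \<le> ln x"
    using that by (simp add: algebra_simps)
  have "x * (x * (ln x - ln (x - 1)) - 1) \<le> x * (x / (x - 1) - 1)"
    using x \<open>x * (ln x - ln (x - 1)) \<le> x / (x - 1)\<close> by (intro mult_left_mono) auto
  also have "\<dots> = x / (x - 1)" using x by (simp add: field_simps)
  also note \<open>x / (x - 1) \<le> 4/3\<close>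
  also note lnx
  finally have 1: "(x - 1) * ln x \<le> x * (ln x - x * (ln x - ln (x - 1)) + 1)" by (rule key)
  have 2: "(ln (x - 1) + 1) / (x - 1) - (ln x + 1) / x = x * (ln x - x * (ln x - ln (x - 1)) + 1) / (x\<^sup>2 * (x - 1))"
    using x by (simp add: divide_simps) (simp add: algebra_simps power2_eq_square)
  have 3: "ln x / x\<^sup>2 = (x - 1) * ln x / (x\<^sup>2 * (x - 1))" using x by simp
  show ?thesis unfolding x_def[symmetric] 2 3 using 1 x by (intro divide_right_mono) auto
qed

text \<open>The sum is -zeta'/zeta(2), about 0.570. Its product with zeta(2) is the sum of
  \<open>ln n / n\<^sup>2\<close>; there the terms up to 6 are kept and the tail is bounded by
  telescoping.\<close>

lemma mangoldt_sum_2_le: "(\<Sum>n. mangoldt n * real n powr (-2)) \<le> 0.59"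
proof -
  define S where "S = (\<Sum>n. mangoldt n * real n powr (-2))"
  have smS: "summable (\<lambda>n. mangoldt n * real n powr (-2))" by (rule summable_mangoldt) simp
  have z: "(\<lambda>n. 1 / real n ^ 2) sums (pi\<^sup>2 / 6)"
  proof -
    have "(\<lambda>n. 1 / real (Suc n) ^ 2) sums (pi\<^sup>2 / 6)" using inverse_squares_sums by (simp add: add_ac)
    thus ?thesis by (subst (asm) sums_Suc_iff) simp
  qed
  have p2: "complex_of_nat n powr 2 = of_real (real n ^ 2)" for n
    by (cases "n = 0") (simp_all add: powr_numeral)
  have "(\<lambda>n. (\<lambda>_. 1 :: complex) n / of_nat n powr 2) sums of_real (pi\<^sup>2 / 6)"
    using sums_of_real[OF z, where ?'a = complex] unfolding p2 by simp
  hence "(\<lambda>n. of_real (ln (real n)) * (1 / complex_of_nat n powr 2)) sums (mangoldt_series (\<lambda>_. 1) 2 * of_real (pi\<^sup>2 / 6))"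
    by (intro mangoldt_series_mult_sums) auto
  also have "mangoldt_series (\<lambda>_. 1) 2 = of_real S"
  proof -
    have "mangoldt n * 1 / complex_of_nat n powr 2 = of_real (mangoldt n * real n powr (-2))" for n
      unfolding p2 by (cases "n = 0") (simp_all add: powr_minus powr_numeral divide_inverse)
    thus ?thesis unfolding mangoldt_series_def S_def by (simp add: suminf_of_real[OF smS] del: of_real_mult)
  qed
  also have "(\<lambda>n. of_real (ln (real n)) * (1 / complex_of_nat n powr 2)) = (\<lambda>n. of_real (ln (real n) / real n ^ 2))"
    unfolding p2 by simp
  finally have T: "(\<lambda>n. ln (real n) / real n ^ 2) sums (S * (pi\<^sup>2 / 6))"
    unfolding of_real_mult[symmetric] sums_of_real_iff .
  define G where "G n = (ln (real n) + 1) / real n" for n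
  have G0: "G \<longlonglongrightarrow> 0"
  proof -
    have "(\<lambda>n. ln (real n) / real n + 1 / real n) \<longlonglongrightarrow> 0 + 0"
      by (intro tendsto_add lim_ln_over_n lim_1_over_n)
    thus ?thesis by (simp add: G_def[abs_def] add_divide_distrib)
  qed
  have "(\<lambda>n. G (n + 6)) \<longlonglongrightarrow> 0" using G0 by (rule LIMSEQ_ignore_initial_segment)
  from telescope_sums'[OF this] have tel: "(\<lambda>n. G (n + 6) - G (Suc n + 6)) sums (G 6 - 0)" by simp
  have T': "(\<lambda>n. ln (real (n + 7)) / real (n + 7) ^ 2) sums (S * (pi\<^sup>2 / 6) - (\<Sum>n<7. ln (real n) / real n ^ 2))"
    using T sums_iff_shift[of "\<lambda>n. ln (real n) / real n ^ 2" 7] by simp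
  have "S * (pi\<^sup>2 / 6) - (\<Sum>n<7. ln (real n) / real n ^ 2) \<le> G 6 - 0"
  proof (rule sums_le[OF _ T' tel])
    fix n show "ln (real (n + 7)) / real (n + 7) ^ 2 \<le> G (n + 6) - G (Suc n + 6)"
      using ln_over_square_le_diff[of "n + 7"] by (simp add: G_def algebra_simps)
  qed
  moreover have "(\<Sum>n<7. ln (real n) / real n ^ 2) = ln 2 / 4 + ln 3 / 9 + ln 4 / 16 + ln 5 / 25 + ln 6 / 36"
  proof -
    have "{..<7::nat} = {0, 1, 2, 3, 4, 5, 6}" by auto
    thus ?thesis by simp
  qed
  moreover have "ln 4 = 2 * (ln 2 :: real)" using ln_realpow[of 2 2] by simp
  moreover have "ln 6 = ln 2 + (ln 3 :: real)" using ln_mult_pos[of "2::real" 3] by simp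
  ultimately have "S * (pi\<^sup>2 / 6) \<le> 41/72 * ln 2 + 11/36 * ln 3 + ln 5 / 25 + 1 / 6"
    by (simp add: G_def field_simps)
  also have "\<dots> \<le> 0.9665" using ln_numeral_bounds by simp
  finally have le: "S * (pi\<^sup>2 / 6) \<le> 0.9665" .
  have S0: "S \<ge> 0" unfolding S_def using smS by (intro suminf_nonneg) (auto simp: mangoldt_nonneg)
  have "(3.14)\<^sup>2 \<le> pi\<^sup>2" using pi_bounds by (intro power_mono) auto
  hence "1.6432 \<le> pi\<^sup>2 / 6" by (simp add: power2_eq_square)
  hence "S * 1.6432 \<le> S * (pi\<^sup>2 / 6)" using S0 by (intro mult_left_mono)
  with le show ?thesis unfolding S_def[symmetric] by simp
qed

lemma mangoldt_term_sums_2: "(\<lambda>n. mangoldt n * real n powr (-2)) sums (\<Sum>n. mangoldt n * real n powr (-2))"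
  by (intro summable_sums summable_mangoldt) simp

text \<open>The terms in \<open>F\<close> are kept exactly and the others are bounded by their
  moduli; the subtracted sum is the saving over the trivial bound.\<close>

lemma Re_mangoldt_series_le_S2:
  fixes f :: "nat \<Rightarrow> complex"
  assumes f: "\<And>n. norm (f n) \<le> 1" and w: "Re w = 2" and F: "finite F" "0 \<notin> F"
  shows "Re (mangoldt_series f w) \<le>
     0.59 - (\<Sum>n\<in>F. mangoldt n / real n ^ 2 * (1 - Re (f n * cis (-(Im w * ln (real n))))))"
proof -
  let ?m = "\<lambda>n. mangoldt n * real n powr (-2)"
  let ?g = "\<lambda>n. mangoldt n * real n powr (-2) * (1 - Re (f n * cis (-(Im w * ln (real n)))))"
  let ?c = "\<lambda>n. ?m n - (if n \<in> F then ?g n else 0)"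
  have c: "?c sums ((\<Sum>n. ?m n) - (\<Sum>n\<in>F. ?g n))"
    using F(1) by (intro sums_diff mangoldt_term_sums_2 sums_If_finite_set)
  have "Re (mangoldt_series f w) \<le> suminf ?c"
  proof (rule Re_mangoldt_series_le[OF f])
    show "Re (mangoldt n * f n / of_nat n powr w) \<le> ?c n" for n
    proof (cases "n \<in> F")
      case True
      hence "n > 0" using F(2) by (cases n) auto
      thus ?thesis using True w by (simp add: Re_mangoldt_term algebra_simps)
    next
      case False
      thus ?thesis using Re_mangoldt_term_le[OF f, of 2 w n] w by simp
    qed
  qed (use c w in \<open>auto simp: sums_iff\<close>)
  also have "\<dots> = (\<Sum>n. ?m n) - (\<Sum>n\<in>F. ?g n)" using c by (simp add: sums_iff)
  also have "(\<Sum>n\<in>F. ?g n) = (\<Sum>n\<in>F. mangoldt n / real n ^ 2 * (1 - Re (f n * cis (-(Im w * ln (real n))))))"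
  proof (intro sum.cong refl)
    fix n assume "n \<in> F"
    hence "n > 0" using F(2) by (cases n) auto
    hence "real n powr (-2) = 1 / real n ^ 2" by (simp add: powr_minus powr_numeral divide_inverse)
    thus "?g n = mangoldt n / real n ^ 2 * (1 - Re (f n * cis (-(Im w * ln (real n)))))" by simp
  qed
  finally show ?thesis using mangoldt_sum_2_le by simp
qed

text \<open>Derived from the bound at exponent 2: one more factor \<open>1 / n\<close> is at most
  1/2 for \<open>n \<ge> 2\<close>, and at most 1/5 once the terms at 2, 3 and 4 are treated
  separately.\<close>

lemma Re_mangoldt_series_le_cube:
  fixes f :: "nat \<Rightarrow> complex"
  assumes f: "\<And>n. norm (f n) \<le> 1" and w: "Re w \<ge> 3"
  shows "Re (mangoldt_series f w) \<le> 0.295"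
    and "f 3 = 0 \<Longrightarrow> Re (mangoldt_series f w) \<le> 0.151"
proof -
  let ?m = "\<lambda>n. mangoldt n * real n powr (-2)"
  have cube: "real n powr (-3) = real n powr (-2) / real n" for n
    by (cases "n = 0") (simp_all add: powr_minus powr_numeral divide_inverse eval_nat_numeral)
  have le: "Re (mangoldt n * f n / of_nat n powr w) \<le> ?m n / real n" for n
    using Re_mangoldt_term_le[OF f, of 3 w n] w by (simp add: cube)
  have m0: "?m n \<ge> 0" for n by (simp add: mangoldt_nonneg)
  have "Re (mangoldt_series f w) \<le> (\<Sum>n. ?m n / 2)"
  proof (rule Re_mangoldt_series_le[OF f])
    show "Re (mangoldt n * f n / of_nat n powr w) \<le> ?m n / 2" for n
    proof (cases "n \<ge> 2")
      case True
      have "?m n / real n \<le> ?m n / 2" using True by (intro divide_left_mono m0) auto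
      thus ?thesis by (rule order_trans[OF le[of n]])
    next
      case False
      hence "n = 0 \<or> n = 1" by auto
      thus ?thesis by auto
    qed
  qed (use w mangoldt_term_sums_2 in \<open>auto intro!: summable_divide simp: sums_iff\<close>)
  also have "\<dots> = (\<Sum>n. ?m n) / 2" using mangoldt_term_sums_2 by (simp add: suminf_divide sums_iff)
  finally show "Re (mangoldt_series f w) \<le> 0.295" using mangoldt_sum_2_le by simp
  show "Re (mangoldt_series f w) \<le> 0.151" if f3: "f 3 = 0"
  proof -
    \<comment> \<open>Corrects the weight 1/5 at small \<open>n\<close>: at 2 and 4 it restores the
      true terms \<open>ln 2 / 8\<close> and \<open>ln 2 / 64\<close>, and at 3 it removes the
      term.\<close>
    define h where "h n = (if n = 2 then ln 2 * (1/8 - 1/20) else if n = 3 then - ln 3 / 45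
        else if n = 4 then ln 2 * (1/64 - 1/80) else (0::real))" for n :: nat
    let ?F = "{2, 3, 4::nat}"
    have mv: "?m 2 = ln 2 / 4" "?m 3 = ln 3 / 9" "?m 4 = ln 2 / 16"
    proof -
      have "mangoldt (2 ^ 2 :: nat) = ln (2::real)" by (subst mangoldt_primepow) auto
      thus "?m 2 = ln 2 / 4" "?m 3 = ln 3 / 9" "?m 4 = ln 2 / 16"
        by (simp_all add: powr_minus powr_numeral)
    qed
    have hs: "h sums (\<Sum>n\<in>?F. h n)" by (rule sums_finite) (auto simp: h_def)
    have c: "(\<lambda>n. ?m n / 5 + h n) sums ((\<Sum>n. ?m n) / 5 + (\<Sum>n\<in>?F. h n))"
      by (intro sums_add sums_divide mangoldt_term_sums_2 hs)
    have "Re (mangoldt_series f w) \<le> (\<Sum>n. ?m n / 5 + h n)"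
    proof (rule Re_mangoldt_series_le[OF f])
      show "Re (mangoldt n * f n / of_nat n powr w) \<le> ?m n / 5 + h n" for n
      proof -
        consider "n = 0" | "n = 1" | "n = 2" | "n = 3" | "n = 4" | "n \<ge> 5" by linarith
        thus ?thesis
        proof cases
          assume n: "n = 2"
          have "?m 2 / real 2 = ?m 2 / 5 + h 2" unfolding mv by (simp add: h_def)
          from order_trans[OF le[of 2] eq_refl[OF this]] show ?thesis unfolding n .
        next
          assume "n = 3"
          thus ?thesis using mv f3 by (simp add: h_def)
        next
          assume "n = 4"
          thus ?thesis using le[of 4] mv by (simp add: h_def)
        next
          assume n: "n \<ge> 5"
          have "?m n / real n \<le> ?m n / 5" using n by (intro divide_left_mono m0) auto
          also have "\<dots> = ?m n / 5 + h n" using n by (simp add: h_def)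
          finally show ?thesis by (rule order_trans[OF le[of n]])
        qed (auto simp: h_def)
      qed
    qed (use w c in \<open>auto simp: sums_iff\<close>)
    also have "\<dots> = (\<Sum>n. ?m n) / 5 + (\<Sum>n\<in>?F. h n)" using c by (simp add: sums_iff)
    also have "(\<Sum>n\<in>?F. h n) = ln 2 * (1/8 - 1/20) - ln 3 / 45 + ln 2 * (1/64 - 1/80)"
      by (simp add: h_def)
    finally show ?thesis using mangoldt_sum_2_le ln_numeral_bounds by simp
  qed
qed

section \<open>Lower bounds for the digamma function\<close>

text \<open>Subtract the series of \<open>Digamma (Re w)\<close> from the real part of that of
  \<open>Digamma w\<close>. The difference is a series of nonnegative terms, so every partial sum is
  a lower bound.\<close>

lemma Re_Digamma_ge:
  fixes w :: complex
  assumes x: "Re w > 0"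
  shows "Re (Digamma w) \<ge> Digamma (Re w) + (\<Sum>k<K. (Im w)\<^sup>2 / ((Re w + real k) * ((Re w + real k)\<^sup>2 + (Im w)\<^sup>2)))"
proof -
  define x where "x = Re w"
  define t where "t = Im w"
  have x: "x > 0" using assms by (simp add: x_def)
  have wn: "w \<noteq> 0" using assms by auto
  have s1: "(\<lambda>k. inverse (of_nat (Suc k)) - inverse (w + of_nat k)) sums (Digamma w + euler_mascheroni)"
    using summable_Digamma[OF wn] by (simp add: Digamma_def summable_sums)
  have s2: "(\<lambda>k. inverse (of_nat (Suc k)) - inverse (x + of_nat k)) sums (Digamma x + euler_mascheroni)"
    using summable_Digamma[of x] x by (simp add: Digamma_def summable_sums)
  have em: "Re (euler_mascheroni :: complex) = euler_mascheroni"
    by (metis Re_complex_of_real of_real_euler_mascheroni)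
  have "(\<lambda>k. Re (inverse (of_nat (Suc k)) - inverse (w + of_nat k)) - (inverse (of_nat (Suc k)) - inverse (x + of_nat k)))
     sums (Re (Digamma w + euler_mascheroni) - (Digamma x + euler_mascheroni))"
    by (intro sums_diff s2 sums_Re s1)
  moreover have "Re (inverse (of_nat (Suc k)) - inverse (w + of_nat k)) - (inverse (of_nat (Suc k)) - inverse (x + of_nat k)) =
      t\<^sup>2 / ((x + real k) * ((x + real k)\<^sup>2 + t\<^sup>2))" for k
  proof -
    have "Re (inverse (complex_of_nat (Suc k))) = inverse (real (Suc k))"
      by (metis Re_complex_of_real of_real_inverse of_real_of_nat_eq)
    moreover have "Re (inverse (w + of_nat k)) = (x + real k) / ((x + real k)\<^sup>2 + t\<^sup>2)"
      by (simp add: x_def t_def)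
    moreover have "inverse y - y / (y\<^sup>2 + t\<^sup>2) = t\<^sup>2 / (y * (y\<^sup>2 + t\<^sup>2))" if "y > 0" for y
    proof -
      have "y\<^sup>2 + t\<^sup>2 > 0" using that by (simp add: add_pos_nonneg)
      thus ?thesis using that by (simp add: field_simps power2_eq_square)
    qed
    ultimately show ?thesis using x by simp
  qed
  ultimately have "(\<lambda>k. t\<^sup>2 / ((x + real k) * ((x + real k)\<^sup>2 + t\<^sup>2))) sums (Re (Digamma w) - Digamma x)"
    by (simp add: em)
  hence "summable (\<lambda>k. t\<^sup>2 / ((x + real k) * ((x + real k)\<^sup>2 + t\<^sup>2)))"
    "(\<Sum>k. t\<^sup>2 / ((x + real k) * ((x + real k)\<^sup>2 + t\<^sup>2))) = Re (Digamma w) - Digamma x"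
    by (auto simp: sums_iff)
  moreover have "0 \<le> t\<^sup>2 / ((x + real k) * ((x + real k)\<^sup>2 + t\<^sup>2))" for k
    using x by (intro divide_nonneg_nonneg mult_nonneg_nonneg add_nonneg_nonneg) auto
  ultimately have "(\<Sum>k<K. t\<^sup>2 / ((x + real k) * ((x + real k)\<^sup>2 + t\<^sup>2))) \<le> Re (Digamma w) - Digamma x"
    using sum_le_suminf[of "\<lambda>k. t\<^sup>2 / ((x + real k) * ((x + real k)\<^sup>2 + t\<^sup>2))" "{..<K}"] by simp
  thus ?thesis by (simp add: x_def t_def)
qed

lemma fraction_mono_square:
  fixes m :: real
  assumes "0 \<le> a" "a \<le> b" "m > 0"
  shows "a / (m * (m\<^sup>2 + a)) \<le> b / (m * (m\<^sup>2 + b))"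
proof -
  have "m\<^sup>2 + a > 0" "m\<^sup>2 + b > 0" using assms by (auto intro: add_pos_nonneg)
  moreover have "a * (m\<^sup>2 + b) \<le> b * (m\<^sup>2 + a)" using assms by (simp add: algebra_simps mult_right_mono)
  ultimately have X: "m * (m\<^sup>2 + a) > 0" and Y: "m * (m\<^sup>2 + b) > 0"
    and *: "m * (a * (m\<^sup>2 + b)) \<le> m * (b * (m\<^sup>2 + a))"
    using assms by auto
  from * have "a * (m * (m\<^sup>2 + b)) \<le> b * (m * (m\<^sup>2 + a))" by (simp only: mult_ac)
  thus ?thesis by (simp only: pos_divide_le_eq[OF X] times_divide_eq_left pos_le_divide_eq[OF Y])
qed

text \<open>\<open>Digamma 2\<close> is 1 minus the Euler-Mascheroni constant, which is below 13/22;
  the three fractions are the first three terms of the growth series at the smaller value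
  \<open>a\<close>.\<close>

lemma Re_Digamma_2_ge:
  fixes w :: complex
  assumes w: "Re w = 2" and a: "0 \<le> a" "a \<le> (Im w)\<^sup>2"
  shows "Re (Digamma w) \<ge> 9/22 + a / (2 * (4 + a)) + a / (3 * (9 + a)) + a / (4 * (16 + a))"
proof -
  have "Digamma (2::real) \<ge> 9/22"
    using euler_mascheroni_less_13_over_22 by (simp add: Digamma_numeral harm_expand)
  moreover have "(\<Sum>k<3. (Im w)\<^sup>2 / ((2 + real k) * ((2 + real k)\<^sup>2 + (Im w)\<^sup>2))) =
     (Im w)\<^sup>2 / (2 * (2\<^sup>2 + (Im w)\<^sup>2)) + (Im w)\<^sup>2 / (3 * (3\<^sup>2 + (Im w)\<^sup>2)) + (Im w)\<^sup>2 / (4 * (4\<^sup>2 + (Im w)\<^sup>2))"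
  proof -
    have "{..<3::nat} = {0, 1, 2}" by auto
    thus ?thesis by simp
  qed
  ultimately show ?thesis
    using Re_Digamma_ge[of w 3] w fraction_mono_square[OF a, of 2] fraction_mono_square[OF a, of 3]
      fraction_mono_square[OF a, of 4] by simp
qed

section \<open>Even primitive characters of small modulus\<close>

text \<open>For these moduli 1 and -1 are the only units, so an even character is trivial.\<close>

lemma even_primitive_character_modulus:
  assumes q: "q > 1" and prim: "primitive_character q psi" and sgn: "psi (-1) = 1"
  shows "q \<notin> {2, 3, 4, 6}"
proof
  assume q': "q \<in> {2, 3, 4, 6}"
  have psi: "dirichlet_character q psi" using prim by (simp add: primitive_character_def)
  obtain a where a: "coprime a (int q)" "psi a \<noteq> 1"
    using primitive_character_imp_nontrivial[OF q prim] by blast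
  define b where "b = a mod int q"
  have b: "0 \<le> b" "b < int q" "[a = b] (mod int q)" using q by (auto simp: b_def cong_def)
  have cb: "coprime b (int q)" using a(1) b(3) cong_imp_coprime by blast
  have "b = 1 \<or> b = int q - 1"
  proof -
    have no_divisor: "\<not> p dvd b" if "p dvd int q" "p > 1" for p
      using coprime_common_divisor[OF cb, of p] that by auto
    have b0: "0 < b" using no_divisor[of "int q"] q b by (cases "b = 0") auto
    from q' consider "q = 2" | "q = 3" | "q = 4" | "q = 6" by blast
    thus ?thesis
    proof cases
      assume "q = 2"
      thus ?thesis using b b0 by simp
    next
      assume "q = 3"
      thus ?thesis using b b0 by simp presburger
    next
      assume "q = 4"
      thus ?thesis using b b0 no_divisor[of 2] by simp presburger
    next
      assume "q = 6"
      thus ?thesis using b b0 no_divisor[of 2] no_divisor[of 3] by simp presburger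
    qed
  qed
  moreover have "[int q - 1 = -1] (mod int q)" by (simp add: cong_iff_dvd_diff)
  ultimately have "[a = 1] (mod int q) \<or> [a = -1] (mod int q)" using b(3) by (metis cong_trans)
  with dirichlet_character_mod_eq_1[OF psi sgn a(1)] a(2) show False by blast
qed

lemma primitive_character_ge_3:
  assumes q: "q > 1" and prim: "primitive_character q psi"
  shows "q \<ge> 3"
proof (rule ccontr)
  assume "\<not> q \<ge> 3"
  hence q2: "q = 2" using q by simp
  have psi: "dirichlet_character q psi" using prim by (simp add: primitive_character_def)
  have "psi (-1) = psi 1" by (rule dirichlet_character_cong[OF psi]) (simp add: q2 cong_def)
  hence "psi (-1) = 1" by (simp add: dirichlet_character_1[OF psi])
  from even_primitive_character_modulus[OF q prim this] q2 show False by simp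
qed

text \<open>The units modulo 5 up to sign form a group of order two generated by 2, on which the
  character is not trivial.\<close>

lemma even_primitive_character_5:
  assumes prim: "primitive_character 5 psi" and sgn: "psi (-1) = 1"
  shows "psi 2 = -1" "psi 3 = -1" "psi 5 = 0"
proof -
  have psi: "dirichlet_character 5 psi" using prim by (simp add: primitive_character_def)
  note mult = dirichlet_character_mult[OF psi] and cong = dirichlet_character_cong[OF psi]
  have 3: "psi 3 = psi 2" using mult[of "-1" 2] cong[of 3 "-2"] sgn by (simp add: cong_def)
  have 4: "psi 4 = 1" using cong[of 4 "-1"] sgn by (simp add: cong_def)
  have "psi 2 * psi 2 = 1" using mult[of 2 2] 4 by simp
  hence "psi 2 = 1 \<or> psi 2 = -1" by (simp add: square_eq_1_iff)
  moreover have "psi 2 \<noteq> 1"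
  proof
    assume 2: "psi 2 = 1"
    obtain a where a: "coprime a (int 5)" "psi a \<noteq> 1"
      using primitive_character_imp_nontrivial[OF _ prim] by auto
    define b where "b = a mod 5"
    have b: "0 \<le> b" "b < 5" "[a = b] (mod 5)" by (auto simp: b_def cong_def)
    have "psi a = psi b" using cong[of a b] b by simp
    moreover have "b \<in> {0, 1, 2, 3, 4}" using b by auto
    moreover have "psi 1 = 1" by (rule dirichlet_character_1[OF psi])
    moreover have "b \<noteq> 0" using a(1) by (auto simp: b_def coprime_iff_gcd_eq_1 gcd_proj2_iff)
    ultimately show False using a(2) 2 3 4 by auto
  qed
  ultimately show "psi 2 = -1" by blast
  thus "psi 3 = -1" using 3 by simp
  show "psi 5 = 0" using dirichlet_character_eq_0_iff[OF psi, of 5] by simp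
qed

text \<open>The units modulo 7 up to sign form a group of order three generated by 2, so
  \<open>psi 2\<close> is a primitive cube root of unity.\<close>

lemma even_primitive_character_7:
  assumes prim: "primitive_character 7 psi" and sgn: "psi (-1) = 1"
  shows "Re (psi 2) = -1/2"
proof -
  have psi: "dirichlet_character 7 psi" using prim by (simp add: primitive_character_def)
  note mult = dirichlet_character_mult[OF psi] and cong = dirichlet_character_cong[OF psi]
  have 1: "psi 1 = 1" by (rule dirichlet_character_1[OF psi])
  have 4: "psi 4 = psi 2 * psi 2" using mult[of 2 2] by simp
  have 8: "psi 2 * psi 4 = 1" using mult[of 2 4] cong[of 8 1] 1 by (simp add: cong_def)
  have 3: "psi 3 = psi 4" using mult[of "-1" 4] cong[of 3 "-4"] sgn by (simp add: cong_def)
  have 5: "psi 5 = psi 2" using mult[of "-1" 2] cong[of 5 "-2"] sgn by (simp add: cong_def)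
  have 6: "psi 6 = 1" using cong[of 6 "-1"] sgn by (simp add: cong_def)
  have ne: "psi 2 \<noteq> 1"
  proof
    assume 2: "psi 2 = 1"
    obtain a where a: "coprime a (int 7)" "psi a \<noteq> 1"
      using primitive_character_imp_nontrivial[OF _ prim] by auto
    define b where "b = a mod 7"
    have b: "0 \<le> b" "b < 7" "[a = b] (mod 7)" by (auto simp: b_def cong_def)
    have "psi a = psi b" using cong[of a b] b by simp
    moreover have "b \<in> {0, 1, 2, 3, 4, 5, 6}" using b by auto
    moreover have "b \<noteq> 0" using a(1) by (auto simp: b_def coprime_iff_gcd_eq_1 gcd_proj2_iff)
    ultimately show False using a(2) 1 2 3 4 5 6 by auto
  qed
  have nz: "psi 2 \<noteq> 0" using 8 by auto
  have "norm (psi 2) ^ 3 = 1"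
  proof -
    have "psi 2 ^ 3 = 1" using 8 4 by (simp add: power3_eq_cube mult.assoc)
    thus ?thesis by (metis norm_one norm_power)
  qed
  hence n1: "norm (psi 2) = 1" using power_eq_1_iff[of "norm (psi 2)" 3] by simp
  have "(psi 2 - 1) * (psi 2 * psi 2 + psi 2 + 1) = 0" using 8 4 by (simp add: algebra_simps)
  hence "psi 2 * psi 2 + psi 2 + 1 = 0" using ne by simp
  hence "psi 2 * (psi 2 + 1 + cnj (psi 2)) = 0"
    using complex_norm_square[of "psi 2"] n1 by (simp add: algebra_simps)
  hence "psi 2 + 1 + cnj (psi 2) = 0" using nz by simp
  hence "Re (psi 2 + 1 + cnj (psi 2)) = 0" by simp
  thus ?thesis by simp
qed

text \<open>Here 6.3 is an upper bound for \<open>2 * pi\<close>, and the second form is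
  \<open>ln y \<ge> 1 - 1 / y\<close>.\<close>

lemma ln_modulus_ge:
  assumes "q > (0::nat)"
  shows "ln (real q / (2 * pi)) \<ge> ln (real q / 6.3)" "ln (real q / (2 * pi)) \<ge> 1 - 6.3 / real q"
proof -
  have "real q / 6.3 \<le> real q / (2 * pi)" using pi_bounds by (intro divide_left_mono) auto
  thus 1: "ln (real q / (2 * pi)) \<ge> ln (real q / 6.3)" using assms by (subst ln_le_cancel_iff) auto
  have "ln (1 / (real q / 6.3)) \<le> 1 / (real q / 6.3) - 1" using assms by (intro ln_le_minus_one) auto
  hence "- ln (real q / 6.3) \<le> 6.3 / real q - 1" using assms by (simp add: ln_div)
  thus "ln (real q / (2 * pi)) \<ge> 1 - 6.3 / real q" using 1 by simp
qed

lemma Re_neg_cis_ge: "1 - Re ((-1) * cis x) \<ge> 2 - x\<^sup>2 / 2"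
proof -
  have "(sin (x / 2))\<^sup>2 \<le> (x / 2)\<^sup>2"
    using abs_sin_x_le_abs_x[of "x / 2"] by (simp only: abs_le_square_iff)
  moreover have "cos x = 1 - 2 * (sin (x / 2))\<^sup>2" using cos_double_sin[of "x / 2"] by simp
  ultimately show ?thesis by (simp add: power_divide)
qed

text \<open>For \<open>Re w \<ge> 3\<close> the crude bound \<open>\<bar>L'/L\<bar> \<le> -\<zeta>'/\<zeta>\<close> suffices, without the
  term of \<open>3\<close> if \<open>q = 3\<close>. For \<open>Re w = 2\<close> it fails
  when \<open>q = 5\<close> and is too tight when \<open>q = 7\<close>: there, the values of \<open>psi\<close> at \<open>2\<close> (and at \<open>3\<close>
  if \<open>q = 5\<close>) give a saving for small \<open>Im w\<close>, and for larger \<open>Im w\<close> the digamma function has grown enough.\<close>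

lemma log_derivative_positive:
  assumes q: "q > 1" and prim: "primitive_character q psi" and kap: "\<kappa> \<in> {0, 1}"
    and sgn: "psi (-1) = (-1) ^ \<kappa>" and j: "j \<ge> 1" and w: "Re w = 2 * real j + real \<kappa>"
  shows "ln (real q / (2 * pi)) + Re (Digamma w) - Re (mangoldt_series (\<lambda>n. psi (int n)) w) > 0"
proof -
  have psi: "dirichlet_character q psi" using prim by (simp add: primitive_character_def)
  let ?f = "\<lambda>n. psi (int n)" and ?t = "Im w"
  have f: "norm (?f n) \<le> 1" for n by (rule norm_dirichlet_character_le[OF psi])
  have q3: "q \<ge> 3" by (rule primitive_character_ge_3[OF q prim])
  show ?thesis
  proof (cases "\<kappa> = 0 \<and> j = 1")
    case False
    have w3: "Re w \<ge> 3"
    proof -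
      have "2 * j + \<kappa> \<ge> 3" using False kap j by auto
      hence "real (2 * j + \<kappa>) \<ge> real 3" by (simp only: of_nat_le_iff)
      thus ?thesis using w by simp
    qed
    have "Digamma (3::real) \<ge> 10/11"
      using euler_mascheroni_less_13_over_22 by (simp add: Digamma_numeral harm_expand)
    also have "Digamma 3 \<le> Digamma (Re w)" using w3 by (intro Digamma_real_mono) auto
    also have "\<dots> \<le> Re (Digamma w)" using Re_Digamma_ge[of w 0] w3 by simp
    finally have D: "Re (Digamma w) \<ge> 10/11" .
    show ?thesis
    proof (cases "q = 3")
      case True
      have "?f 3 = 0" using dirichlet_character_eq_0_iff[OF psi, of 3] True by simp
      hence A: "Re (mangoldt_series ?f w) \<le> 0.151" by (intro Re_mangoldt_series_le_cube f w3)
      \<comment> \<open>For \<open>q = 3\<close> the logarithm to be bounded is that of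
        \<open>3 / 6.3 = 1 / 2.1\<close>.\<close>
      have "ln (2.1::real) = ln 2 + ln 1.05" using ln_mult_pos[of "2::real" "1.05"] by simp
      also have "ln (1.05::real) \<le> 0.05" using ln_le_minus_one[of "1.05::real"] by simp
      finally have "ln (2.1::real) \<le> 25/36 + 0.05" using ln_numeral_bounds by simp
      moreover have "ln (real q / 6.3) = - ln 2.1" using True ln_inverse[of "2.1::real"] by simp
      ultimately show ?thesis using ln_modulus_ge(1)[of q] q3 D A by simp
    next
      case False
      hence "real q \<ge> 4" using q3 by simp
      hence "6.3 / real q \<le> 6.3 / 4" by (intro divide_left_mono) auto
      hence "ln (real q / (2 * pi)) \<ge> 1 - 6.3 / 4" using ln_modulus_ge(2)[of q] q3 by simp
      moreover have "Re (mangoldt_series ?f w) \<le> 0.295" by (rule Re_mangoldt_series_le_cube[OF f w3])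
      ultimately show ?thesis using D by simp
    qed
  next
    case True
    have w2: "Re w = 2" using True w by simp
    have sgn1: "psi (-1) = 1" using sgn True by simp
    have qn: "q = 5 \<or> q = 7 \<or> q \<ge> 8" using even_primitive_character_modulus[OF q prim sgn1] q3 by auto
    note S2 = Re_mangoldt_series_le_S2[of ?f w, OF f w2]
    note D = Re_Digamma_2_ge[OF w2]
    note lnb = ln_numeral_bounds
    from qn consider "q = 5" | "q = 7" | "q \<ge> 8" by blast
    thus ?thesis
    proof cases
      assume "q \<ge> 8"
      hence "real q \<ge> 8" by simp
      hence "6.3 / real q \<le> 6.3 / 8" by (intro divide_left_mono) auto
      hence "ln (real q / (2 * pi)) \<ge> 1 - 6.3 / 8" using ln_modulus_ge(2)[of q] q3 by simp
      thus ?thesis using S2[of "{}"] D[of 0] by simp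
    next
      assume q7: "q = 7"
      have L: "ln (real q / (2 * pi)) \<ge> 0.1" using ln_modulus_ge(2)[of q] q7 by simp
      \<comment> \<open>The trivial bounds fall short by 0.59 - 9/22 - 0.1, about 0.081. For small
        \<open>Im w\<close> the phase moves \<open>psi 2\<close> by less than 25/36 from a point
        with real part -1/2, and the saving at 2 suffices; otherwise the growth of digamma
        does.\<close>
      show ?thesis
      proof (cases "\<bar>?t\<bar> \<le> 1")
        case True
        let ?x = "-(?t * ln 2)"
        have "\<bar>?t\<bar> * ln 2 \<le> 1 * (25/36)" using True lnb by (intro mult_mono) auto
        hence x: "\<bar>?x\<bar> \<le> 25/36" using lnb by (simp add: abs_mult)
        have "psi 2 * cis ?x = psi 2 + psi 2 * (cis ?x - 1)" by (simp add: algebra_simps)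
        hence "Re (psi 2 * cis ?x) = Re (psi 2) + Re (psi 2 * (cis ?x - 1))" by (metis plus_complex.sel(1))
        also have "Re (psi 2) = -1/2" using even_primitive_character_7[of psi] prim sgn1 q7 by simp
        also have "Re (psi 2 * (cis ?x - 1)) \<le> norm (psi 2 * (cis ?x - 1))" by (rule complex_Re_le_cmod)
        also have "\<dots> \<le> 1 * norm (cis ?x - 1)"
          unfolding norm_mult by (intro mult_right_mono norm_dirichlet_character_le[OF psi]) auto
        also have "norm (cis ?x - 1) \<le> \<bar>?x\<bar>"
        proof -
          have "norm (cis ?x - 1) = 2 * \<bar>sin (?x / 2)\<bar>"
            using dist_exp_i_1[of ?x] by (simp only: cis_conv_exp)
          thus ?thesis using abs_sin_x_le_abs_x[of "?x / 2"] by simp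
        qed
        finally have "Re (psi 2 * cis ?x) \<le> -1/2 + 25/36" using x by simp
        hence R: "1 - 7/36 \<le> 1 - Re (psi 2 * cis ?x)" by linarith
        have "(2/3) / 4 * (1 - 7/36) \<le> ln 2 / 4 * (1 - Re (psi 2 * cis ?x))"
          by (rule mult_mono[OF _ R]) (use lnb in auto)
        thus ?thesis using S2[of "{2}"] D[of 0] L by simp
      next
        case False
        hence "1 \<le> ?t\<^sup>2" using abs_le_square_iff[of 1 ?t] by simp
        thus ?thesis using S2[of "{}"] D[of 1] L by simp
      qed
    next
      assume q5: "q = 5"
      have v: "psi 2 = -1" "psi 3 = -1" "psi 5 = 0"
        using even_primitive_character_5[of psi] prim sgn1 q5 by simp_all
      \<comment> \<open>For \<open>q = 5\<close> the logarithm is that of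
        \<open>5 / 6.3 = 1 / 1.26\<close>, and the cube of 1.26 happens to be almost exactly
        2.\<close>
      have "ln (1.26 ^ 3 :: real) = ln (2 * 1.000188)" by (simp add: power3_eq_cube)
      also have "\<dots> = ln 2 + ln (1.000188::real)" by (subst ln_mult_pos) auto
      also have "ln (1.000188::real) \<le> 0.000188" using ln_le_minus_one[of "1.000188::real"] by simp
      finally have "3 * ln (1.26::real) \<le> 25/36 + 0.000188"
        using lnb by (simp add: ln_realpow del: power_numeral)
      moreover have "ln (real q / 6.3) = - ln 1.26" using q5 ln_inverse[of "1.26::real"] by simp
      ultimately have L: "ln (real q / (2 * pi)) \<ge> - 0.2316" using ln_modulus_ge(1)[of q] q5 by simp
      \<comment> \<open>As \<open>psi 5 = 0\<close>, the whole term at 5 is saved, whatever the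
        value of \<open>Im w\<close>.\<close>
      have g5: "ln 5 / 25 \<ge> (4/75::real)" using lnb by simp
      have g: "ln (real n) / real n ^ 2 * (1 - Re (psi (int n) * cis (-(?t * ln (real n))))) \<ge>
          lo / real n ^ 2 * (2 - (T * hi)\<^sup>2 / 2)"
        if "n \<in> {2, 3}" "\<bar>?t\<bar> \<le> T" "0 \<le> lo" "lo \<le> ln (real n)" "ln (real n) \<le> hi" "(T * hi)\<^sup>2 \<le> 4" for n T lo hi
      proof -
        let ?x = "-(?t * ln (real n))"
        have "\<bar>?t\<bar> * ln (real n) \<le> T * hi" using that by (intro mult_mono) auto
        hence "\<bar>?x\<bar> \<le> T * hi" using that by (simp add: abs_mult)
        hence "\<bar>?x\<bar>\<^sup>2 \<le> (T * hi)\<^sup>2" by (intro power_mono) auto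
        hence "?x\<^sup>2 \<le> (T * hi)\<^sup>2" by simp
        hence "2 - (T * hi)\<^sup>2 / 2 \<le> 1 - Re ((-1) * cis ?x)" using Re_neg_cis_ge[of ?x] by simp
        moreover have "psi (int n) = -1" using that v by auto
        moreover have "lo / real n ^ 2 \<le> ln (real n) / real n ^ 2" using that by (intro divide_right_mono) auto
        ultimately show ?thesis using that by (intro mult_mono) auto
      qed
      \<comment> \<open>The deficit is now 0.2316 + 0.59 - 9/22, about 0.413. Besides the term at 5
        it is covered by the savings at 2 and 3 up to 1.3, by the saving at 2 and the digamma growth
        up to 2, and by that growth alone beyond.\<close>
      consider "\<bar>?t\<bar> \<le> 1.3" | "1.3 \<le> \<bar>?t\<bar>" "\<bar>?t\<bar> \<le> 2" | "2 \<le> \<bar>?t\<bar>" by linarith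
      thus ?thesis
      proof cases
        assume t: "\<bar>?t\<bar> \<le> 1.3"
        have "(2/3) / real 2 ^ 2 * (2 - (1.3 * (25/36))\<^sup>2 / 2) \<le> ln (real 2) / real 2 ^ 2 * (1 - Re (psi (int 2) * cis (-(?t * ln (real 2)))))"
          using t lnb by (intro g) (auto simp: power2_eq_square)
        moreover have "1 / real 3 ^ 2 * (2 - (1.3 * (10/9))\<^sup>2 / 2) \<le> ln (real 3) / real 3 ^ 2 * (1 - Re (psi (int 3) * cis (-(?t * ln (real 3)))))"
          using t lnb by (intro g) (auto simp: power2_eq_square)
        ultimately show ?thesis using S2[of "{2, 3, 5}"] D[of 0] L g5 v by (simp add: power2_eq_square)
      next
        assume t: "1.3 \<le> \<bar>?t\<bar>" "\<bar>?t\<bar> \<le> 2"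
        have "(2/3) / real 2 ^ 2 * (2 - (2 * (25/36))\<^sup>2 / 2) \<le> ln (real 2) / real 2 ^ 2 * (1 - Re (psi (int 2) * cis (-(?t * ln (real 2)))))"
          using t lnb by (intro g) (auto simp: power2_eq_square)
        moreover have "1.69 \<le> ?t\<^sup>2" using power_mono[OF t(1), of 2] by (simp add: power2_eq_square)
        ultimately show ?thesis using S2[of "{2, 5}"] D[of "1.69"] L g5 v by (simp add: power2_eq_square)
      next
        assume t: "2 \<le> \<bar>?t\<bar>"
        have "4 \<le> ?t\<^sup>2" using power_mono[OF t, of 2] by simp
        thus ?thesis using S2[of "{5}"] D[of 4] L g5 v by simp
      qed
    qed
  qed
qed

section \<open>Critical points near a simple zero\<close>

text \<open>Rouche's theorem for \<open>deriv F\<close> and \<open>-c F\<close>: the positivity of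
  the real part on the contour makes \<open>c F\<close> dominate \<open>deriv F + c F\<close> for a
  large constant \<open>c\<close>, so the simple zero of \<open>F\<close> accounts for exactly one
  zero of the derivative.\<close>

lemma unique_critical_point_of_simple_zero:
  fixes F :: "complex \<Rightarrow> complex"
  assumes F: "F holomorphic_on UNIV" and a: "Re a1 < Re a3" "Im a1 < Im a3"
    and bd: "\<And>z. z \<in> path_image (rectpath a1 a3) \<Longrightarrow> F z \<noteq> 0 \<and> Re (- (deriv F z / F z)) > 0"
    and s0: "s0 \<in> box a1 a3" "F s0 = 0" "deriv F s0 \<noteq> 0"
    and s0_unique: "\<And>z. z \<in> box a1 a3 \<Longrightarrow> F z = 0 \<Longrightarrow> z = s0"
  shows "\<exists>!s. s \<in> box a1 a3 \<and> deriv F s = 0"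
proof -
  define \<gamma> where "\<gamma> = rectpath a1 a3"
  have F': "deriv F holomorphic_on UNIV" by (rule holomorphic_deriv[OF F]) auto
  have cF: "continuous_on S F" "continuous_on S (deriv F)" for S
    using F F' holomorphic_on_imp_continuous_on holomorphic_on_subset by blast+
  \<comment> \<open>With W = -F'/F this is |W|^2 / (2 Re W), the threshold above which |c - W| < c.
    It is continuous on the contour, hence bounded.\<close>
  let ?h = "\<lambda>z. (norm (deriv F z / F z))\<^sup>2 / (2 * Re (- (deriv F z / F z)))"
  have compact: "compact (path_image \<gamma>)" unfolding \<gamma>_def by (rule compact_path_image) auto
  have ne: "F z \<noteq> 0" "Re (deriv F z / F z) \<noteq> 0" if "z \<in> path_image \<gamma>" for z
    using bd[of z] that unfolding \<gamma>_def by auto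
  have "continuous_on (path_image \<gamma>) ?h"
    using ne by (intro continuous_intros cF) auto
  hence "bounded (?h ` path_image \<gamma>)"
    using compact by (intro compact_imp_bounded compact_continuous_image)
  then obtain B where B: "norm (?h z) \<le> B" if "z \<in> path_image \<gamma>" for z
    unfolding bounded_iff by blast
  define c where "c = max B 0 + 1"
  have c: "c > 0" by (simp add: c_def)
  have hc: "?h z < c" if "z \<in> path_image \<gamma>" for z
  proof -
    have "?h z \<le> \<bar>?h z\<bar>" by (rule abs_ge_self)
    also have "\<dots> \<le> B" using B[OF that] by (simp only: real_norm_def)
    also have "\<dots> < c" by (simp add: c_def)
    finally show ?thesis .
  qed
  have less: "norm (deriv F z + of_real c * F z) < norm (- of_real c * F z)" if z: "z \<in> path_image \<gamma>" for z
  proof -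
    define W where "W = - (deriv F z / F z)"
    have Fz: "F z \<noteq> 0" and W: "Re W > 0" using bd z by (auto simp: \<gamma>_def W_def)
    have "(norm W)\<^sup>2 / (2 * Re W) < c" using hc[OF z] by (simp add: W_def)
    hence "(norm W)\<^sup>2 < 2 * c * Re W" using W by (simp add: field_simps)
    moreover have "(norm (of_real c - W))\<^sup>2 = c\<^sup>2 - 2 * c * Re W + (norm W)\<^sup>2"
      unfolding cmod_power2 by (simp add: power2_eq_square algebra_simps)
    ultimately have "(norm (of_real c - W))\<^sup>2 < c\<^sup>2" by simp
    hence "norm (of_real c - W) < c" using c by (intro power_less_imp_less_base[of _ 2 c]) auto
    moreover have "deriv F z + of_real c * F z = (of_real c - W) * F z"
      using Fz by (simp add: W_def field_simps)
    ultimately show ?thesis using Fz c by (simp add: norm_mult)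
  qed
  \<comment> \<open>An open connected neighbourhood of the closed rectangle, still inside a compact
    box, so that only finitely many zeros occur in it.\<close>
  define S where "S = box (a1 - Complex 1 1) (a3 + Complex 1 1)"
  have S: "open S" "connected S" unfolding S_def by (auto intro: convex_connected convex_box open_box)
  have sub: "cbox a1 a3 \<subseteq> S" by (auto simp: S_def in_box_complex_iff in_cbox_complex_iff)
  have path: "path_image \<gamma> \<subseteq> cbox a1 a3"
    unfolding \<gamma>_def using a by (intro path_image_rectpath_subset_cbox) auto
  have path': "path_image \<gamma> = cbox a1 a3 - box a1 a3"
    unfolding \<gamma>_def using a by (intro path_image_rectpath_cbox_minus_box) auto
  have fin: "finite {z \<in> S. G z = 0}" if G: "G holomorphic_on UNIV" "G z0 \<noteq> 0" for G z0
  proof (cases "G constant_on UNIV")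
    case True
    hence "{z \<in> S. G z = 0} = {}" using G(2) by (auto simp: constant_on_def)
    thus ?thesis by (simp only: finite.emptyI)
  next
    case False
    have "finite {z \<in> cbox (a1 - Complex 1 1) (a3 + Complex 1 1). G z = 0}"
      by (rule holomorphic_compact_finite_zeros[OF G(1) _ _ _ _ False]) auto
    thus ?thesis by (rule rev_finite_subset) (use box_subset_cbox in \<open>auto simp: S_def\<close>)
  qed
  have a1: "a1 \<in> path_image \<gamma>" unfolding \<gamma>_def
    using pathstart_in_path_image[of "rectpath a1 a3"] by simp
  let ?f = "\<lambda>z. - of_real c * F z" and ?g = "\<lambda>z. deriv F z + of_real c * F z"
  have fg: "?f z + ?g z = deriv F z" for z by simp
  have F1: "F a1 \<noteq> 0" using bd a1 by (simp add: \<gamma>_def)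
  have wn_in: "winding_number \<gamma> z = 1" if "z \<in> box a1 a3" for z
    unfolding \<gamma>_def by (rule winding_number_rectpath[OF that])
  have wn_out: "winding_number \<gamma> z = 0" if "z \<notin> cbox a1 a3" for z
    unfolding \<gamma>_def using a that by (intro winding_number_rectpath_outside) auto
  have rouche: "(\<Sum>p\<in>{p\<in>S. deriv F p = 0}. winding_number \<gamma> p * zorder (deriv F) p)
          = (\<Sum>p\<in>{p\<in>S. ?f p = 0}. winding_number \<gamma> p * zorder ?f p)"
  proof (rule Rouche_theorem[of S ?f ?g \<gamma>, unfolded fg])
    show "finite {p \<in> S. deriv F p = 0}" by (rule fin[OF F' s0(3)])
    show "finite {p \<in> S. ?f p = 0}"
      using c F1 by (intro fin[of _ a1] holomorphic_intros F) auto
    show "?f holomorphic_on S" "?g holomorphic_on S"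
      by (intro holomorphic_intros holomorphic_on_subset[OF F] holomorphic_on_subset[OF F']; simp)+
    show "\<forall>z. z \<notin> S \<longrightarrow> winding_number \<gamma> z = 0" using sub wn_out by blast
    show "path_image \<gamma> \<subseteq> S" using path sub by blast
  qed (use S less in \<open>auto simp: \<gamma>_def\<close>)
  have inside: "(\<Sum>p\<in>{p\<in>S. G p = 0}. winding_number \<gamma> p * zorder G p) = of_int (\<Sum>p\<in>{p\<in>box a1 a3. G p = 0}. zorder G p)"
    if G: "G holomorphic_on UNIV" "G z0 \<noteq> 0" "\<And>z. z \<in> path_image \<gamma> \<Longrightarrow> G z \<noteq> 0" for G z0
  proof -
    have "(\<Sum>p\<in>{p\<in>S. G p = 0}. winding_number \<gamma> p * zorder G p) = (\<Sum>p\<in>{p\<in>box a1 a3. G p = 0}. of_int (zorder G p))"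
    proof (rule sum.mono_neutral_cong_right)
      show "finite {p\<in>S. G p = 0}" by (rule fin[OF G(1,2)])
      show "{p \<in> box a1 a3. G p = 0} \<subseteq> {p \<in> S. G p = 0}" using sub box_subset_cbox by blast
      show "\<forall>p\<in>{p\<in>S. G p = 0} - {p\<in>box a1 a3. G p = 0}. winding_number \<gamma> p * zorder G p = 0"
        using wn_out path' G(3) by auto
    qed (auto simp: wn_in)
    thus ?thesis by simp
  qed
  have zf: "zorder ?f s0 = 1"
  proof -
    have "deriv ?f s0 = - of_real c * deriv F s0"
      using F by (intro deriv_cmult) (auto simp: holomorphic_on_def)
    hence "zorder ?f s0 = int 1" using s0 c
      by (intro zorder_zero_eqI[of _ UNIV]) (auto intro!: holomorphic_intros F)
    thus ?thesis by simp
  qed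
  have f0: "?f p = 0 \<longleftrightarrow> F p = 0" for p using c by simp
  have single: "{p\<in>box a1 a3. ?f p = 0} = {s0}"
    unfolding f0 using s0(1,2) s0_unique by blast
  have e1: "(\<Sum>p\<in>{p\<in>S. ?f p = 0}. winding_number \<gamma> p * zorder ?f p) = of_int (\<Sum>p\<in>{p\<in>box a1 a3. ?f p = 0}. zorder ?f p)"
  proof (rule inside[of ?f a1])
    show "?f holomorphic_on UNIV" by (intro holomorphic_intros F)
    show "?f a1 \<noteq> 0" using f0 F1 by blast
    show "?f z \<noteq> 0" if "z \<in> path_image \<gamma>" for z using f0 ne(1)[OF that] by blast
  qed
  have e2: "(\<Sum>p\<in>{p\<in>box a1 a3. ?f p = 0}. zorder ?f p) = zorder ?f s0"
    by (subst single) simp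
  have "(\<Sum>p\<in>{p\<in>S. ?f p = 0}. winding_number \<gamma> p * zorder ?f p) = 1"
    by (simp only: e1 e2 zf of_int_1)
  moreover have nz: "deriv F z \<noteq> 0" if "z \<in> path_image \<gamma>" for z
    using ne(2)[OF that] by auto
  ultimately have "of_int (\<Sum>p\<in>{p\<in>box a1 a3. deriv F p = 0}. zorder (deriv F) p) = (1 :: complex)"
    using inside[OF F' s0(3) nz] rouche by simp
  hence one: "(\<Sum>p\<in>{p\<in>box a1 a3. deriv F p = 0}. zorder (deriv F) p) = 1"
    by (simp only: of_int_eq_1_iff)
  let ?Z = "{p\<in>box a1 a3. deriv F p = 0}"
  \<comment> \<open>The orders add up to 1 and each is at least 1, which leaves a single
    zero.\<close>
  have pos: "zorder (deriv F) p \<ge> 1" if "p \<in> ?Z" for p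
  proof -
    have "\<exists>w\<in>UNIV. deriv F w \<noteq> 0" using s0(3) by blast
    from zorder_exist_zero[OF F' _ _ _ this, of p] that have "zorder (deriv F) p > 0" by auto
    thus ?thesis by simp
  qed
  have finZ: "finite ?Z"
    by (rule finite_subset[OF _ fin[OF F' s0(3)]]) (use sub box_subset_cbox in blast)
  have "int (card ?Z) = (\<Sum>p\<in>?Z. 1)" by simp
  also have "\<dots> \<le> (\<Sum>p\<in>?Z. zorder (deriv F) p)" using pos by (intro sum_mono)
  finally have "card ?Z \<le> 1" using one by simp
  moreover have "?Z \<noteq> {}"
  proof
    assume "?Z = {}"
    with one show False by simp
  qed
  hence "card ?Z \<noteq> 0" using finZ by simp
  ultimately have "card ?Z = 1" by simp
  then obtain z where "?Z = {z}" by (rule card_1_singletonE)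
  hence "s \<in> box a1 a3 \<and> deriv F s = 0 \<longleftrightarrow> s = z" for s by blast
  thus ?thesis by auto
qed

text \<open>On such a vertical line the sine is real and the cosine purely imaginary.\<close>

lemma Re_cot_critical:
  fixes u :: complex
  assumes "cos (Re u) = 0"
  shows "sin u \<noteq> 0" "Re (cos u / sin u) = 0"
proof -
  have "sin (Re u) \<noteq> 0" using assms sin_cos_squared_add[of "Re u"] by auto
  hence "Re (sin u) \<noteq> 0" unfolding Re_sin by (simp add: add_pos_pos less_imp_neq[symmetric])
  thus "sin u \<noteq> 0" by auto
  have "Re (cos u) = 0" "Im (sin u) = 0" by (simp_all add: Re_cos Im_sin assms)
  thus "Re (cos u / sin u) = 0" by (simp add: Re_divide)
qed

text \<open>The squared moduli of cosine and sine are \<open>(E + 2 cos (2 Re u)) / 4\<close> and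
  \<open>(E - 2 cos (2 Re u)) / 4\<close> with \<open>E = 2 cosh (2 Im u)\<close>. The bound 2 needs
  only \<open>E \<ge> 10/3\<close>; the quadratic Taylor bound of exp gives 5.\<close>

lemma norm_cot_le:
  fixes u :: complex
  assumes "\<bar>Im u\<bar> \<ge> 1"
  shows "sin u \<noteq> 0" "norm (cos u / sin u) \<le> 2"
proof -
  define b where "b = Im u"
  define E where "E = exp (2 * b) + exp (- (2 * b))"
  have E: "E \<ge> 5"
  proof -
    have "exp (2 * \<bar>b\<bar>) \<ge> 1 + 2 * \<bar>b\<bar> + (2 * \<bar>b\<bar>)\<^sup>2 / 2"
      by (rule exp_lower_Taylor_quadratic) simp
    moreover have "(2 * \<bar>b\<bar>)\<^sup>2 \<ge> 2\<^sup>2" using assms by (intro power_mono) (auto simp: b_def)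
    ultimately have "exp (2 * \<bar>b\<bar>) \<ge> 5" using assms by (simp add: b_def)
    thus ?thesis by (cases "b \<ge> 0") (auto simp: E_def add_increasing add_increasing2)
  qed
  have s: "(norm (sin u))\<^sup>2 = (E - 2 * cos (2 * Re u)) / 4"
    by (simp add: norm_sin_squared E_def b_def exp_minus)
  have "cos (2 * Re u) = 2 * (cos (Re u))\<^sup>2 - 1" by (rule cos_double_cos)
  moreover have "(exp b - inverse (exp b))\<^sup>2 = E - 2"
    by (simp add: E_def power2_diff exp_minus exp_double power_inverse)
  ultimately have c: "(norm (cos u))\<^sup>2 = (E + 2 * cos (2 * Re u)) / 4"
    by (simp add: norm_cos_squared b_def[symmetric])
  have cb: "cos (2 * Re u) \<le> 1" by simp
  show nz: "sin u \<noteq> 0"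
  proof
    assume "sin u = 0"
    hence "E - 2 * cos (2 * Re u) = 0" using s by simp
    thus False using E cb by linarith
  qed
  have "(norm (cos u))\<^sup>2 \<le> (2 * norm (sin u))\<^sup>2"
    unfolding power_mult_distrib s c
    by (simp add: field_simps) (use E cos_le_one[of "Re u * 2"] in linarith)
  hence "norm (cos u) \<le> 2 * norm (sin u)" by (rule power2_le_imp_le) simp
  thus "norm (cos u / sin u) \<le> 2" using nz by (simp add: norm_divide field_simps)
qed

text \<open>When \<open>Im w\<close> dominates \<open>Re w + k\<close> in modulus, the k-th term of
  the growth series is at least half of \<open>1 / (Re w + k)\<close>. The harmonic series diverges,
  so finitely many such terms exceed \<open>M\<close>, uniformly in the strip.\<close>

lemma Re_Digamma_large:
  fixes X M :: real
  shows "\<exists>T>0. \<forall>w. 2 \<le> Re w \<longrightarrow> Re w \<le> X \<longrightarrow> \<bar>Im w\<bar> \<ge> T \<longrightarrow> Re (Digamma w) \<ge> M"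
proof -
  define N where "N = nat \<lceil>\<bar>X\<bar>\<rceil> + 1"
  have N: "X \<le> real N" "N > 0" unfolding N_def by linarith+
  have "\<not> summable (\<lambda>k. 1 / real (k + N))"
    using not_summable_harmonic[where 'a = real] summable_iff_shift[of "\<lambda>k. inverse (real k)" N]
    by (simp add: inverse_eq_divide)
  hence "\<exists>K. (\<Sum>k<K. 1 / real (k + N)) > 2 * M"
    using summableI_nonneg_bounded[of "\<lambda>k. 1 / real (k + N)" "2 * M"] by (auto simp: not_less) (meson not_less)
  then obtain K where K: "(\<Sum>k<K. 1 / real (k + N)) > 2 * M" by blast
  define T where "T = real (N + K)"
  show ?thesis
  proof (intro exI[of _ T] conjI allI impI)
    show "T > 0" using N by (simp add: T_def)
    fix w :: complex assume w: "2 \<le> Re w" "Re w \<le> X" "\<bar>Im w\<bar> \<ge> T"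
    have "Digamma (2::real) \<ge> 9/22"
      using euler_mascheroni_less_13_over_22 by (simp add: Digamma_numeral harm_expand)
    also have "Digamma 2 \<le> Digamma (Re w)" using w by (intro Digamma_real_mono) auto
    finally have D: "0 \<le> Digamma (Re w)" by simp
    have "M \<le> (\<Sum>k<K. 1 / real (k + N)) / 2" using K by simp
    also have "\<dots> = (\<Sum>k<K. 1 / (2 * real (k + N)))" by (simp add: sum_divide_distrib mult.commute)
    also have "\<dots> \<le> (\<Sum>k<K. (Im w)\<^sup>2 / ((Re w + real k) * ((Re w + real k)\<^sup>2 + (Im w)\<^sup>2)))"
    proof (rule sum_mono)
      fix k assume k: "k \<in> {..<K}"
      define y where "y = Re w + real k"
      have y: "0 < y" "y \<le> real (k + N)" using w N by (auto simp: y_def)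
      have "y \<le> \<bar>Im w\<bar>" using y k w(3) by (simp add: T_def)
      hence yt: "y\<^sup>2 \<le> (Im w)\<^sup>2" using y(1) by (simp add: abs_le_square_iff[symmetric])
      have "1 / (2 * real (k + N)) \<le> 1 / (2 * y)" using y by (intro divide_left_mono) auto
      also have "\<dots> \<le> (Im w)\<^sup>2 / (y * (y\<^sup>2 + (Im w)\<^sup>2))"
      proof -
        have "0 < y\<^sup>2 + (Im w)\<^sup>2" using y(1) by (simp add: add_pos_nonneg)
        moreover have "y\<^sup>2 + (Im w)\<^sup>2 \<le> 2 * (Im w)\<^sup>2" using yt by simp
        ultimately have "1 / 2 \<le> (Im w)\<^sup>2 / (y\<^sup>2 + (Im w)\<^sup>2)" by (simp add: pos_le_divide_eq)
        hence "(1 / 2) / y \<le> (Im w)\<^sup>2 / (y\<^sup>2 + (Im w)\<^sup>2) / y" using y(1) by (intro divide_right_mono) auto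
        thus ?thesis by (simp add: mult.commute)
      qed
      finally show "1 / (2 * real (k + N)) \<le> (Im w)\<^sup>2 / ((Re w + real k) * ((Re w + real k)\<^sup>2 + (Im w)\<^sup>2))"
        by (simp add: y_def)
    qed
    also have "\<dots> \<le> Re (Digamma w)" using Re_Digamma_ge[of w K] w D by simp
    finally show "M \<le> Re (Digamma w)" .
  qed
qed

section \<open>Zeros of the derivative\<close>

lemma Re_mangoldt_series_le_half_plane:
  fixes f :: "nat \<Rightarrow> complex"
  assumes f: "\<And>n. norm (f n) \<le> 1" and w: "Re w \<ge> 2"
  shows "Re (mangoldt_series f w) \<le> 0.59"
proof -
  have "Re (mangoldt_series f w) \<le> (\<Sum>n. mangoldt n * real n powr (-2))"
  proof (rule Re_mangoldt_series_le[OF f])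
    show "Re (mangoldt n * f n / of_nat n powr w) \<le> mangoldt n * real n powr (-2)" for n
      by (rule Re_mangoldt_term_le[OF f w])
  qed (use w mangoldt_term_sums_2 in \<open>auto simp: sums_iff\<close>)
  thus ?thesis using mangoldt_sum_2_le by simp
qed

text \<open>Separating the sine from the nonvanishing factor \<open>E\<close> keeps the formula for the derivative
  valid at the trivial zeros.\<close>

lemma dirichlet_L_left_half_plane:
  assumes q: "q > 1" and prim: "primitive_character q chi" and kap: "\<kappa> \<in> {0, 1}"
    and sgn: "chi (-1) = (-1) ^ \<kappa>"
  defines "psi \<equiv> (\<lambda>a. cnj (chi a))" and "u \<equiv> (\<lambda>s. of_real pi * (s + of_nat \<kappa>) / 2)"
  shows "\<exists>E. \<forall>s. Re s \<le> -1 \<longrightarrow> E s \<noteq> 0 \<and> dirichlet_L q chi s = E s * sin (u s) \<and>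
     deriv (dirichlet_L q chi) s = E s * (of_real pi / 2 * cos (u s) - (of_real (ln (real q / (2 * pi))) + Digamma (1 - s)
                - mangoldt_series (\<lambda>n. psi (int n)) (1 - s)) * sin (u s))"
proof -
  have primp: "primitive_character q psi" unfolding psi_def by (rule primitive_character_cnj[OF prim])
  have psi: "dirichlet_character q psi" using primp by (simp add: primitive_character_def)
  note psi0 = sum_dirichlet_character_eq_0[OF psi primitive_character_imp_nontrivial[OF q primp]]
  define c where "c = 2 * pi / real q"
  have c: "c > 0" using q by (simp add: c_def)
  obtain K where K: "K \<noteq> 0" and L: "\<And>s. Re s < 1 \<Longrightarrow> dirichlet_L q chi s =
     K * of_real c powr s * sin (u s) * Gamma (1 - s) * L_half q psi (1 - s)"
    using dirichlet_L_functional_equation[OF q prim kap sgn] unfolding c_def u_def psi_def by blast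
  define A where "A = mangoldt_series (\<lambda>n. psi (int n))"
  define E where "E s = K * of_real c powr s * Gamma (1 - s) * L_half q psi (1 - s)" for s
  have f: "norm (psi (int n)) \<le> 1" for n by (rule norm_dirichlet_character_le[OF psi])
  have mult: "psi (int (m * n)) = psi (int m) * psi (int n)" for m n
    by (simp add: dirichlet_character_mult[OF psi])
  have one: "psi (int 1) = 1" by (simp add: dirichlet_character_1[OF psi])
  have G: "(\<lambda>n. psi (int (Suc n)) / of_nat (Suc n) powr s) sums L_half q psi s" if "Re s > 1" for s
    by (rule dirichlet_series_sums_L_half[OF psi q psi0 that])
  have Gam: "1 - s \<notin> \<int>\<^sub>\<le>\<^sub>0" if "Re s \<le> -1" for s
    using that by (auto elim!: nonpos_Ints_cases' dest!: arg_cong[of _ _ Re])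
  have lnc: "ln c = - ln (real q / (2 * pi))" using q by (simp add: c_def ln_div)
  show ?thesis
  proof (intro exI[of _ E] allI impI conjI)
    fix s :: complex assume s: "Re s \<le> -1"
    have w: "Re (1 - s) \<ge> 2" using s by simp
    hence w1: "Re (1 - s) > 1" by linarith
    have "L_half q psi (1 - s) \<noteq> 0"
      by (rule dirichlet_series_nonzero[of "\<lambda>n. psi (int n)", OF f one w G[OF w1]])
    thus "E s \<noteq> 0" using K c Gam[OF s] by (simp add: E_def Gamma_eq_zero_iff)
    show "dirichlet_L q chi s = E s * sin (u s)" using L[of s] s by (simp add: E_def)
    have dL: "(L_half q psi has_field_derivative - (A (1 - s) * L_half q psi (1 - s))) (at (1 - s))"
      unfolding A_def by (rule dirichlet_series_derivative[OF f mult w1 G])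
    have dH: "((\<lambda>s. L_half q psi (1 - s)) has_field_derivative A (1 - s) * L_half q psi (1 - s)) (at s)"
    proof -
      have "((\<lambda>s. 1 - s) has_field_derivative -1) (at s)" by (auto intro!: derivative_eq_intros)
      from DERIV_chain'[OF this dL] show ?thesis by simp
    qed
    have dP: "((\<lambda>s. of_real c powr s) has_field_derivative of_real (ln c) * of_real c powr s) (at s)"
      using has_field_derivative_powr_right[of "of_real c" s] c by (simp add: Ln_of_real)
    have dS: "((\<lambda>s. sin (u s)) has_field_derivative of_real pi / 2 * cos (u s)) (at s)"
      unfolding u_def by (auto intro!: derivative_eq_intros)
    have dG: "((\<lambda>s. Gamma (1 - s)) has_field_derivative - (Gamma (1 - s) * Digamma (1 - s))) (at s)"
      using Gam[OF s] by (auto intro!: derivative_eq_intros)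
    have "((\<lambda>s. K * of_real c powr s * sin (u s) * Gamma (1 - s) * L_half q psi (1 - s)) has_field_derivative
       E s * (of_real pi / 2 * cos (u s) - (- of_real (ln c) + Digamma (1 - s) - A (1 - s)) * sin (u s))) (at s)"
      by (rule DERIV_cong[OF DERIV_mult[OF DERIV_mult[OF DERIV_mult[OF DERIV_cmult[OF dP] dS] dG] dH]])
         (simp add: E_def algebra_simps)
    hence "(dirichlet_L q chi has_field_derivative
       E s * (of_real pi / 2 * cos (u s) - (- of_real (ln c) + Digamma (1 - s) - A (1 - s)) * sin (u s))) (at s)"
      by (rule has_field_derivative_transform_within_open[OF _ open_halfspace_Re_lt[of 1]]) (use s L in auto)
    thus "deriv (dirichlet_L q chi) s =
       E s * (of_real pi / 2 * cos (u s) - (of_real (ln (real q / (2 * pi))) + Digamma (1 - s)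
                - mangoldt_series (\<lambda>n. psi (int n)) (1 - s)) * sin (u s))"
      using DERIV_imp_deriv by (simp add: lnc A_def)
  qed
qed

theorem theorem2:
  fixes q \<kappa> j :: nat and chi :: "int \<Rightarrow> complex"
  assumes "q > 1"
    and "primitive_character q chi"
    and "\<kappa> \<in> {0, 1}"
    and "chi (-1) = (-1) ^ \<kappa>"
    and "j \<ge> 1"
  shows "(\<exists>!s. - 2 * real j - real \<kappa> - 1 < Re s \<and> Re s < - 2 * real j - real \<kappa> + 1 \<and>
               deriv (dirichlet_L q chi) s = 0) \<and>
         (\<forall>s. Re s = - 2 * real j - real \<kappa> + 1 \<longrightarrow> deriv (dirichlet_L q chi) s \<noteq> 0)"
proof -
  note q = assms(1) and prim = assms(2) and kap = assms(3) and sgn = assms(4) and j = assms(5)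
  define psi where "psi = (\<lambda>a. cnj (chi a))"
  define u where "u = (\<lambda>s. of_real pi * (s + of_nat \<kappa>) / 2 :: complex)"
  define L where "L = dirichlet_L q chi"
  define H where "H s = of_real (ln (real q / (2 * pi))) + Digamma (1 - s) - mangoldt_series (\<lambda>n. psi (int n)) (1 - s)" for s
  have primp: "primitive_character q psi" unfolding psi_def by (rule primitive_character_cnj[OF prim])
  have psi: "dirichlet_character q psi" using primp by (simp add: primitive_character_def)
  have sgnp: "psi (-1) = (-1) ^ \<kappa>" by (simp add: psi_def sgn)
  have f: "norm (psi (int n)) \<le> 1" for n by (rule norm_dirichlet_character_le[OF psi])
  obtain E where E: "\<And>s. Re s \<le> -1 \<Longrightarrow> E s \<noteq> 0" "\<And>s. Re s \<le> -1 \<Longrightarrow> L s = E s * sin (u s)"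
    "\<And>s. Re s \<le> -1 \<Longrightarrow> deriv L s = E s * (of_real pi / 2 * cos (u s) - H s * sin (u s))"
    using dirichlet_L_left_half_plane[OF q prim kap sgn] unfolding u_def psi_def L_def H_def by blast
  have Lholo: "L holomorphic_on UNIV"
    using dirichlet_L_functional_equation[OF q prim kap sgn] by (simp add: L_def)
  have u: "Re (u s) = pi * (Re s + real \<kappa>) / 2" "Im (u s) = pi * Im s / 2" for s
    by (simp_all add: u_def)
  have quot: "- (deriv L s / L s) = H s - of_real pi / 2 * (cos (u s) / sin (u s))" "L s \<noteq> 0"
    if "Re s \<le> -1" "sin (u s) \<noteq> 0" for s
    using E[OF that(1)] that(2) by (simp_all add: field_simps)
  \<comment> \<open>On this line \<open>Re (u s) = pi / 2 - i * pi\<close>, and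
    \<open>Re (1 - s) = 2 * i + \<kappa>\<close> is where the positivity was proved for
    \<open>psi\<close>. The case \<open>i = j\<close> is the right edge and \<open>i = j + 1\<close>
    the left one.\<close>
  have line: "L s \<noteq> 0 \<and> Re (- (deriv L s / L s)) > 0"
    if i: "i \<ge> 1" and s: "Re s = - 2 * real i - real \<kappa> + 1" for i :: nat and s
  proof -
    have s1: "Re s \<le> -1" using i s by simp
    have "Re (u s) = pi / 2 - real i * pi" by (simp add: u s field_simps)
    hence "cos (Re (u s)) = 0" by (simp add: cos_diff)
    note crit = Re_cot_critical[OF this]
    have "Re (H s) > 0"
      using log_derivative_positive[OF q primp kap sgnp i, of "1 - s"] s by (simp add: H_def)
    moreover have "Re (of_real pi / 2 * (cos (u s) / sin (u s))) = 0"
    proof -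
      have "of_real pi / 2 * (cos (u s) / sin (u s)) = of_real (pi / 2) * (cos (u s) / sin (u s))" by simp
      moreover have "Re (of_real r * z) = r * Re z" for r z by simp
      ultimately show ?thesis using crit(2) by (simp only: mult_zero_right)
    qed
    ultimately show ?thesis using quot[OF s1 crit(1)] by simp
  qed
  define s0 :: complex where "s0 = of_real (- 2 * real j - real \<kappa>)"
  \<comment> \<open>The value 6 leaves 6 + (1 - 6.3/3) - 0.59 > 4 for \<open>Re (H s)\<close>, while
    the cotangent term is at most \<open>pi / 2 * 2 < 4\<close>.\<close>
  obtain T0 where T0: "T0 > 0" "\<And>w. 2 \<le> Re w \<Longrightarrow> Re w \<le> 2 * real j + real \<kappa> + 2 \<Longrightarrow> \<bar>Im w\<bar> \<ge> T0 \<Longrightarrow> Re (Digamma w) \<ge> 6"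
    using Re_Digamma_large[of "2 * real j + real \<kappa> + 2" 6] by blast
  have horizontal: "L s \<noteq> 0 \<and> Re (- (deriv L s / L s)) > 0"
    if s: "- 2 * real j - real \<kappa> - 1 \<le> Re s" "Re s \<le> - 2 * real j - real \<kappa> + 1" "\<bar>Im s\<bar> \<ge> max T0 1" for s
  proof -
    have s1: "Re s \<le> -1" using j s by simp
    have "1 * 1 \<le> (pi / 2) * \<bar>Im s\<bar>" using s(3) pi_ge_two by (intro mult_mono) auto
    hence "\<bar>Im (u s)\<bar> \<ge> 1" by (simp add: u abs_mult)
    note cot = norm_cot_le[OF this]
    have D: "Re (Digamma (1 - s)) \<ge> 6" using s s1 by (intro T0) auto
    have A: "Re (mangoldt_series (\<lambda>n. psi (int n)) (1 - s)) \<le> 0.59"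
      using s1 by (intro Re_mangoldt_series_le_half_plane f) auto
    have "real q \<ge> 3" using primitive_character_ge_3[OF q prim] by simp
    hence "6.3 / real q \<le> 6.3 / 3" by (intro divide_left_mono) auto
    hence "ln (real q / (2 * pi)) \<ge> 1 - 6.3 / 3" using ln_modulus_ge(2)[of q] q by simp
    with D A have H: "Re (H s) \<ge> 4" by (simp add: H_def)
    have "Re (of_real pi / 2 * (cos (u s) / sin (u s))) \<le> norm (of_real pi / 2 * (cos (u s) / sin (u s)))"
      by (rule complex_Re_le_cmod)
    also have "\<dots> = pi / 2 * norm (cos (u s) / sin (u s))" by (simp add: norm_mult norm_divide)
    also have "\<dots> \<le> pi / 2 * 2" by (intro mult_left_mono cot) auto
    finally have "Re (of_real pi / 2 * (cos (u s) / sin (u s))) < 4" using pi_less_4 by simp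
    with H show ?thesis using quot[OF s1 cot(1)] by simp
  qed
  have u0: "Re (u s0) = - (real j * pi)" "u s0 = of_real (- (real j * pi))"
    by (simp_all add: u_def s0_def field_simps)
  have s01: "Re s0 \<le> -1" using j by (simp add: s0_def)
  have sin0: "sin (u s0) = 0" unfolding u0(2) by (simp only: sin_of_real) simp
  have cos0: "cos (u s0) \<noteq> 0"
    unfolding u0(2) by (simp only: cos_of_real of_real_eq_0_iff) simp
  have box: "\<exists>!s. s \<in> box (Complex (- 2 * real j - real \<kappa> - 1) (-T)) (Complex (- 2 * real j - real \<kappa> + 1) T) \<and> deriv L s = 0"
    if T: "T \<ge> max T0 1" for T
  proof -
    let ?a = "Complex (- 2 * real j - real \<kappa> - 1) (-T)" and ?b = "Complex (- 2 * real j - real \<kappa> + 1) T"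
    show ?thesis
    proof (rule unique_critical_point_of_simple_zero[OF Lholo, where ?s0.0 = s0])
      show "Re ?a < Re ?b"
        "Im ?a < Im ?b"
        using T by auto
      show "s0 \<in> box ?a ?b"
        using T by (simp add: in_box_complex_iff s0_def)
      show "L s0 = 0" using E(2)[OF s01] sin0 by simp
      have d: "deriv L s0 = E s0 * (of_real pi / 2 * cos (u s0))"
        using E(3)[OF s01] by (simp only: sin0 mult_zero_right diff_zero)
      have "E s0 * (of_real pi / 2 * cos (u s0)) \<noteq> 0" using E(1)[OF s01] cos0 by simp
      thus "deriv L s0 \<noteq> 0" unfolding d .
    next
      fix z assume "z \<in> path_image (rectpath ?a ?b)"
      hence "Re z = - 2 * real j - real \<kappa> - 1 \<or> Re z = - 2 * real j - real \<kappa> + 1 \<or>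
         (\<bar>Im z\<bar> = T \<and> - 2 * real j - real \<kappa> - 1 \<le> Re z \<and> Re z \<le> - 2 * real j - real \<kappa> + 1)"
        using T by (subst (asm) path_image_rectpath) auto
      thus "L z \<noteq> 0 \<and> Re (- (deriv L z / L z)) > 0"
      proof (elim disjE)
        assume "Re z = - 2 * real j - real \<kappa> - 1"
        thus ?thesis using line[of "j + 1" z] by simp
      next
        assume "Re z = - 2 * real j - real \<kappa> + 1"
        thus ?thesis using line[of j z] j by simp
      next
        assume "\<bar>Im z\<bar> = T \<and> - 2 * real j - real \<kappa> - 1 \<le> Re z \<and> Re z \<le> - 2 * real j - real \<kappa> + 1"
        thus ?thesis using horizontal[of z] T by simp
      qed
    next
      fix z assume z: "z \<in> box ?a ?b" "L z = 0"
      hence zr: "- 2 * real j - real \<kappa> - 1 < Re z" "Re z < - 2 * real j - real \<kappa> + 1"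
        by (auto simp: in_box_complex_iff)
      have "Re z \<le> -1" using zr j by simp
      \<comment> \<open>Since \<open>E\<close> does not vanish, zeros of \<open>L\<close> here are
        zeros of the sine: real points with \<open>z + \<kappa>\<close> an even integer. The open
        strip of width 2 contains just one.\<close>
      hence "sin (u z) = 0" using E(1,2)[of z] z(2) by simp
      then obtain n :: int where "u z = of_real (of_int n * pi)"
        by (auto simp: sin_eq_0 mult.commute)
      hence un: "Re (u z) = of_int n * pi" "Im (u z) = 0" by simp_all
      have "pi * (Re z + real \<kappa>) = pi * (2 * of_int n)" using un(1) by (simp add: u field_simps)
      from mult_left_cancel[OF pi_neq_zero, THEN iffD1, OF this]
      have Re: "Re z + real \<kappa> = 2 * of_int n" .
      have "Im z = 0" using un(2) by (simp add: u)
      moreover have "- 2 * int j - 1 < 2 * n" "2 * n < - 2 * int j + 1"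
        using zr Re by linarith+
      hence "n = - int j" by linarith
      hence "Re z = - 2 * real j - real \<kappa>" using Re by simp
      ultimately show "z = s0" by (simp add: s0_def complex_eq_iff)
    qed
  qed
  have "\<exists>!s. - 2 * real j - real \<kappa> - 1 < Re s \<and> Re s < - 2 * real j - real \<kappa> + 1 \<and> deriv L s = 0"
  proof (rule ex_ex1I)
    show "\<exists>s. - 2 * real j - real \<kappa> - 1 < Re s \<and> Re s < - 2 * real j - real \<kappa> + 1 \<and> deriv L s = 0"
      using box[of "max T0 1"] by (auto simp: in_box_complex_iff)
    fix s s' assume s: "- 2 * real j - real \<kappa> - 1 < Re s \<and> Re s < - 2 * real j - real \<kappa> + 1 \<and> deriv L s = 0"
      "- 2 * real j - real \<kappa> - 1 < Re s' \<and> Re s' < - 2 * real j - real \<kappa> + 1 \<and> deriv L s' = 0"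
    \<comment> \<open>High enough for the box to contain both points, so uniqueness in boxes gives
      uniqueness in the strip.\<close>
    define T where "T = max (max T0 1) (max (\<bar>Im s\<bar>) (\<bar>Im s'\<bar>) + 1)"
    have T1: "T \<ge> max T0 1" and T: "\<bar>Im s\<bar> < T" "\<bar>Im s'\<bar> < T" unfolding T_def by linarith+
    let ?B = "box (Complex (- 2 * real j - real \<kappa> - 1) (-T)) (Complex (- 2 * real j - real \<kappa> + 1) T)"
    have "-T < Im s" "Im s < T" "-T < Im s'" "Im s' < T" using T by linarith+
    hence "s \<in> ?B" "s' \<in> ?B" unfolding in_box_complex_iff using s by simp_all
    with box[OF T1] s show "s = s'" by blast
  qed
  moreover have "deriv L s \<noteq> 0" if "Re s = - 2 * real j - real \<kappa> + 1" for s
    using line[OF j that] by auto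
  ultimately show ?thesis unfolding L_def by blast
qed

end
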